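(* Let $\mathcal{C}$ be a class of instance labeling functions $c:\mathcal{X}\to\mathbb{R}$, $\mathcal{X}\subseteq\mathbb{R}^n$, and let $u:\mathbb{R}\to[0,1]$ be monotone (non-decreasing) and $L$-Lipschitz. Suppose there is a kernel $\mathcal{K}$ on $\mathcal{X}$ such that every $c\in\mathcal{C}$ is $(\epsilon/(CL),B)$-uniformly approximated by $\mathcal{K}$, for a large enough constant $C>0$. Then $\mathcal{C}$ is $(\epsilon,\delta)$-Probabilistic MIL for $u$ with sample complexity $\left(\frac{BL}{\epsilon}\right)^2\cdot\log(1/\delta)$ and running time $\mathrm{poly}(n,B,L,1/\epsilon,\log(1/\delta))$.
   Context: Kernels are efficiently computable and normalized so that $\mathcal{K}(\mathbf{x},\mathbf{x}')\le1$. A function $c:\mathcal{X}\to\mathbb{R}$ is $(\epsilon,B)$-uniformly approximated by kernel $\mathcal{K}$ (with RKHS $\mathcal{H}$, feature map $\psi$) if there is $\mathbf{v}\in\mathcal{H}$, $\|\mathbf{v}\|\le B$, with $|c(\mathbf{x})-\langle\mathbf{v},\psi(\mathbf{x})\rangle|\le\epsilon$ for all $\mathbf{x}\in\mathcal{X}$. A bag $\beta$ is a finite nonempty collection of instances from $\mathcal{X}$; $\mathfrak{B}$ is the space of bags and $\mathcal{D}$ is a distribution over $\mathfrak{B}$ (instances within a bag may be dependent). Probabilistic MI assumption for $u$: the label $f_{\mathsf{bag}}(\beta)\in\{0,1\}$ of bag $\beta$ is a random variable with $\Pr[f_{\mathsf{bag}}(\beta)=1]=u\left(\frac{1}{|\beta|}\sum_{\mathbf{x}\in\beta}c(\mathbf{x})\right)$,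 where $c$ is the instance labeling function. $\mathcal{C}$ is $(\epsilon,\delta)$-Probabilistic MIL for $u$ with sample complexity $M'$ and running time $T'$ if under the probabilistic MI assumption for $u$ there is an algorithm that, for every $c\in\mathcal{C}$ and every distribution $\mathcal{D}$ on $\mathfrak{B}$, draws at most $M'$ i.i.d. labeled bags, runs in time at most $T'$, and returns a bag-labeling hypothesis $h$ such that with probability $1-\delta$, $\mathbb{E}_{\beta\sim\mathcal{D}}\left[\left(h(\beta)-u\left(\frac{1}{|\beta|}\sum_{\mathbf{x}\in\beta}c(\mathbf{x})\right)\right)^2\right]\le\epsilon$.
   Formalization: The sample complexity is proved up to a constant factor that is uniform for δ ≤ δ0 but may depend on δ0 < 1 (arbitrary), as may the algorithm and the time polynomial; as δ tends to 1 the literal bound allows zero samples and fails. Instance functions and the kernel are Borel measurable. *)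

theory Defs
  imports "HOL-Probability.Probability" "HOL-Computational_Algebra.Polynomial"
begin

section \<open>Kernels, reproducing kernel Hilbert spaces, uniform approximation\<close>

text \<open>
  Elements of the RKHS are functions on \<open>X\<close>, represented as functions on the whole type that
  vanish outside \<open>X\<close>. The carrier \<open>H\<close> and the inner product \<open>ip\<close> are terms, not a type, so that
  constants can be chosen before (hence independently of) the Hilbert space.
\<close>

definition feature :: "'x set \<Rightarrow> ('x \<Rightarrow> 'x \<Rightarrow> real) \<Rightarrow> 'x \<Rightarrow> ('x \<Rightarrow> real)" where
  "feature X K x = (\<lambda>y. if y \<in> X then K x y else 0)"

definition inner_product_on ::
  "('x \<Rightarrow> real) set \<Rightarrow> (('x \<Rightarrow> real) \<Rightarrow> ('x \<Rightarrow> real) \<Rightarrow> real) \<Rightarrow> bool" where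
  "inner_product_on H ip \<longleftrightarrow>
     (\<lambda>_. 0) \<in> H \<and>
     (\<forall>f\<in>H. \<forall>g\<in>H. (\<lambda>x. f x + g x) \<in> H) \<and>
     (\<forall>a. \<forall>f\<in>H. (\<lambda>x. a * f x) \<in> H) \<and>
     (\<forall>f\<in>H. \<forall>g\<in>H. ip f g = ip g f) \<and>
     (\<forall>f\<in>H. \<forall>g\<in>H. \<forall>h\<in>H. ip (\<lambda>x. f x + g x) h = ip f h + ip g h) \<and>
     (\<forall>a. \<forall>f\<in>H. \<forall>g\<in>H. ip (\<lambda>x. a * f x) g = a * ip f g) \<and>
     (\<forall>f\<in>H. 0 \<le> ip f f) \<and>
     (\<forall>f\<in>H. ip f f = 0 \<longrightarrow> f = (\<lambda>_. 0))"

definition ip_norm ::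
  "(('x \<Rightarrow> real) \<Rightarrow> ('x \<Rightarrow> real) \<Rightarrow> real) \<Rightarrow> ('x \<Rightarrow> real) \<Rightarrow> real" where
  "ip_norm ip f = sqrt (ip f f)"

text \<open>
  \<open>(H, ip)\<close> is the RKHS of \<open>K\<close> on \<open>X\<close>. In particular \<open>K\<close> is then symmetric and positive
  semidefinite on \<open>X\<close>, with \<open>K x y = ip (feature X K x) (feature X K y)\<close>.
\<close>

definition rkhs ::
  "'x set \<Rightarrow> ('x \<Rightarrow> 'x \<Rightarrow> real) \<Rightarrow> ('x \<Rightarrow> real) set \<Rightarrow>
   (('x \<Rightarrow> real) \<Rightarrow> ('x \<Rightarrow> real) \<Rightarrow> real) \<Rightarrow> bool" where
  "rkhs X K H ip \<longleftrightarrow>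
     (\<forall>f\<in>H. \<forall>x. x \<notin> X \<longrightarrow> f x = 0) \<and>
     inner_product_on H ip \<and>
     Metric_space.mcomplete H (\<lambda>f g. ip_norm ip (\<lambda>x. f x - g x)) \<and>
     (\<forall>x\<in>X. feature X K x \<in> H) \<and>
     (\<forall>f\<in>H. \<forall>x\<in>X. ip f (feature X K x) = f x)"

definition uniformly_approximated ::
  "'x set \<Rightarrow> ('x \<Rightarrow> 'x \<Rightarrow> real) \<Rightarrow> ('x \<Rightarrow> real) set \<Rightarrow>
   (('x \<Rightarrow> real) \<Rightarrow> ('x \<Rightarrow> real) \<Rightarrow> real) \<Rightarrow> real \<Rightarrow> real \<Rightarrow> ('x \<Rightarrow> real) \<Rightarrow> bool" where
  "uniformly_approximated X K H ip \<epsilon> B c \<longleftrightarrow>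
     (\<exists>v\<in>H. ip_norm ip v \<le> B \<and> (\<forall>x\<in>X. \<bar>c x - ip v (feature X K x)\<bar> \<le> \<epsilon>))"


section \<open>Instances, bags, and the probabilistic multiple-instance assumption\<close>

text \<open>\<open>X \<subseteq> \<real>\<^sup>n\<close> with the trace of the Borel sigma-algebra; points of \<open>\<real>\<^sup>n\<close> are indexed by \<open>{..<n}\<close>.\<close>

definition instance_space :: "nat \<Rightarrow> (nat \<Rightarrow> real) set \<Rightarrow> (nat \<Rightarrow> real) measure" where
  "instance_space n X = restrict_space (\<Pi>\<^sub>M i\<in>{..<n}. borel) X"

text \<open>
  A bag is a nonempty finite list of instances (repetitions allowed). The sigma-algebra is the
  disjoint union over the bag sizes of the product sigma-algebras.
\<close>

definition bag_space :: "'x measure \<Rightarrow> 'x list measure" where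
  "bag_space M = sigma {\<beta> \<in> lists (space M). \<beta> \<noteq> []} {listset As |As. As \<noteq> [] \<and> set As \<subseteq> sets M}"

definition bag_mean :: "('x \<Rightarrow> real) \<Rightarrow> 'x list \<Rightarrow> real" where
  "bag_mean c \<beta> = (\<Sum>x\<leftarrow>\<beta>. c x) / real (length \<beta>)"

text \<open>
  Joint law of a bag \<open>\<beta>\<close> drawn from \<open>D\<close> and its label, which is \<open>True\<close> (that is, 1) with
  conditional probability \<open>u (bag_mean c \<beta>)\<close>.
\<close>

definition labeled_bag ::
  "(real \<Rightarrow> real) \<Rightarrow> ('x \<Rightarrow> real) \<Rightarrow> 'x list measure \<Rightarrow> ('x list \<times> bool) measure" where
  "labeled_bag u c D = density (D \<Otimes>\<^sub>M count_space UNIV)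
     (\<lambda>(\<beta>, y). ennreal (if y then u (bag_mean c \<beta>) else 1 - u (bag_mean c \<beta>)))"

text \<open>
  The randomness of a run: an i.i.d. sequence of labeled bags, and independently an i.i.d.
  sequence of uniform variates (the internal coins of a randomized algorithm).
\<close>

definition run_space ::
  "(real \<Rightarrow> real) \<Rightarrow> ('x \<Rightarrow> real) \<Rightarrow> 'x list measure \<Rightarrow>
   ((nat \<Rightarrow> 'x list \<times> bool) \<times> (nat \<Rightarrow> real)) measure" where
  "run_space u c D =
     (\<Pi>\<^sub>M i\<in>UNIV. labeled_bag u c D) \<Otimes>\<^sub>M (\<Pi>\<^sub>M i\<in>UNIV. uniform_measure lborel {0..<1})"


section \<open>A model of computation\<close>

text \<open>
  Algorithms are programs of a real RAM: a memory of natural numbers (used for indices and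
  indirect addressing) and a memory of reals with exact rational arithmetic operations and
  comparisons. There is no rounding from reals to naturals, and there are no real constants
  other than those obtained from natural numbers. Drawn bags are held in random-access storage;
  an instance is addressed by the number of its bag and its position in the bag. Instances can
  be accessed only through the kernel oracle, which computes \<open>K\<close> at a cost of \<open>kernel_time\<close> steps;
  the link \<open>u\<close> is a unit-cost oracle. All other commands take one step: expressions are part of
  the program text, so their sizes are bounded by a constant of the program.
\<close>

datatype nexp =
    NConst nat
  | NMem nexp
  | NAdd nexp nexp
  | NSub nexp nexp
  | NMul nexp nexp

datatype rexp =
    RNat nexp
  | RMem nexp
  | RAdd rexp rexp
  | RSub rexp rexp
  | RMul rexp rexp
  | RDiv rexp rexp

datatype bexp =
    NLess nexp nexp
  | RLess rexp rexp
  | Neg bexp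
  | Conj bexp bexp

primrec nval :: "(nat \<Rightarrow> nat) \<Rightarrow> nexp \<Rightarrow> nat" where
  "nval N (NConst k) = k"
| "nval N (NMem a) = N (nval N a)"
| "nval N (NAdd a b) = nval N a + nval N b"
| "nval N (NSub a b) = nval N a - nval N b"
| "nval N (NMul a b) = nval N a * nval N b"

primrec rval :: "(nat \<Rightarrow> nat) \<Rightarrow> (nat \<Rightarrow> real) \<Rightarrow> rexp \<Rightarrow> real" where
  "rval N R (RNat a) = real (nval N a)"
| "rval N R (RMem a) = R (nval N a)"
| "rval N R (RAdd a b) = rval N R a + rval N R b"
| "rval N R (RSub a b) = rval N R a - rval N R b"
| "rval N R (RMul a b) = rval N R a * rval N R b"
| "rval N R (RDiv a b) = rval N R a / rval N R b"

primrec bval :: "(nat \<Rightarrow> nat) \<Rightarrow> (nat \<Rightarrow> real) \<Rightarrow> bexp \<Rightarrow> bool" where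
  "bval N R (NLess a b) \<longleftrightarrow> nval N a < nval N b"
| "bval N R (RLess a b) \<longleftrightarrow> rval N R a < rval N R b"
| "bval N R (Neg b) \<longleftrightarrow> \<not> bval N R b"
| "bval N R (Conj a b) \<longleftrightarrow> bval N R a \<and> bval N R b"

text \<open>In every command with a target, the first argument is the address that is written.\<close>

datatype com =
    Skip
  | NSet nexp nexp
  | RSet nexp rexp
  | Draw                              \<comment> \<open>obtain the next labeled bag\<close>
  | GetLabel nexp nexp                \<comment> \<open>label of the bag with the given number\<close>
  | GetSize nexp nexp                 \<comment> \<open>size of the bag with the given number\<close>
  | Rand nexp nexp                    \<comment> \<open>uniformly random element of \<open>{..<k}\<close>\<close>
  | Kernel nexp nexp nexp nexp nexp   \<comment> \<open>bag and position of either kernel argument\<close>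
  | Link nexp rexp
  | Seq com com
  | If bexp com com
  | While bexp com

record 'x state =
  nmem :: "nat \<Rightarrow> nat"
  rmem :: "nat \<Rightarrow> real"
  seen :: "('x list \<times> bool) list"
  coins :: nat                        \<comment> \<open>number of coins consumed so far\<close>

record 'x oracles =
  kernel :: "'x \<Rightarrow> 'x \<Rightarrow> real"
  kernel_time :: nat
  link :: "real \<Rightarrow> real"

text \<open>
  \<open>exec Or S W p s t s'\<close>: with oracles \<open>Or\<close>, stream of labeled bags \<open>S\<close> and stream of coins \<open>W\<close>,
  program \<open>p\<close> started in state \<open>s\<close> halts after \<open>t\<close> steps in state \<open>s'\<close>. Accesses to nonexistent
  bags or instances are stuck.
\<close>

inductive exec ::
  "'x oracles \<Rightarrow> (nat \<Rightarrow> 'x list \<times> bool) \<Rightarrow> (nat \<Rightarrow> real) \<Rightarrow>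
   com \<Rightarrow> 'x state \<Rightarrow> nat \<Rightarrow> 'x state \<Rightarrow> bool"
  for Or S W where
  Skip: "exec Or S W Skip s 1 s"
| NSet: "exec Or S W (NSet a e) s 1
    (s\<lparr>nmem := (nmem s)(nval (nmem s) a := nval (nmem s) e)\<rparr>)"
| RSet: "exec Or S W (RSet a e) s 1
    (s\<lparr>rmem := (rmem s)(nval (nmem s) a := rval (nmem s) (rmem s) e)\<rparr>)"
| Draw: "exec Or S W Draw s 1 (s\<lparr>seen := seen s @ [S (length (seen s))]\<rparr>)"
| GetLabel: "nval (nmem s) i < length (seen s) \<Longrightarrow>
    exec Or S W (GetLabel a i) s 1
      (s\<lparr>nmem := (nmem s)(nval (nmem s) a := of_bool (snd (seen s ! nval (nmem s) i)))\<rparr>)"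
| GetSize: "nval (nmem s) i < length (seen s) \<Longrightarrow>
    exec Or S W (GetSize a i) s 1
      (s\<lparr>nmem := (nmem s)(nval (nmem s) a := length (fst (seen s ! nval (nmem s) i)))\<rparr>)"
| Rand: "exec Or S W (Rand a k) s 1
    (s\<lparr>nmem := (nmem s)(nval (nmem s) a := nat \<lfloor>frac (W (coins s)) * real (nval (nmem s) k)\<rfloor>),
       coins := Suc (coins s)\<rparr>)"
| Kernel: "nval (nmem s) i < length (seen s) \<Longrightarrow>
    nval (nmem s) j < length (fst (seen s ! nval (nmem s) i)) \<Longrightarrow>
    nval (nmem s) i' < length (seen s) \<Longrightarrow>
    nval (nmem s) j' < length (fst (seen s ! nval (nmem s) i')) \<Longrightarrow>
    exec Or S W (Kernel a i j i' j') s (1 + kernel_time Or)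
      (s\<lparr>rmem := (rmem s)(nval (nmem s) a :=
          kernel Or (fst (seen s ! nval (nmem s) i) ! nval (nmem s) j)
                    (fst (seen s ! nval (nmem s) i') ! nval (nmem s) j'))\<rparr>)"
| Link: "exec Or S W (Link a e) s 1
    (s\<lparr>rmem := (rmem s)(nval (nmem s) a := link Or (rval (nmem s) (rmem s) e))\<rparr>)"
| Seq: "exec Or S W p s t s' \<Longrightarrow> exec Or S W q s' t' s'' \<Longrightarrow> exec Or S W (Seq p q) s (t + t') s''"
| IfTrue: "bval (nmem s) (rmem s) b \<Longrightarrow> exec Or S W p s t s' \<Longrightarrow>
    exec Or S W (If b p q) s (1 + t) s'"
| IfFalse: "\<not> bval (nmem s) (rmem s) b \<Longrightarrow> exec Or S W q s t s' \<Longrightarrow>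
    exec Or S W (If b p q) s (1 + t) s'"
| WhileTrue: "bval (nmem s) (rmem s) b \<Longrightarrow> exec Or S W p s t s' \<Longrightarrow>
    exec Or S W (While b p) s' t' s'' \<Longrightarrow> exec Or S W (While b p) s (1 + t + t') s''"
| WhileFalse: "\<not> bval (nmem s) (rmem s) b \<Longrightarrow> exec Or S W (While b p) s 1 s"

inductive_cases exec_SkipE: "exec Or S W Skip s t s'"
inductive_cases exec_NSetE: "exec Or S W (NSet a e) s t s'"
inductive_cases exec_RSetE: "exec Or S W (RSet a e) s t s'"
inductive_cases exec_DrawE: "exec Or S W Draw s t s'"
inductive_cases exec_GetLabelE: "exec Or S W (GetLabel a i) s t s'"
inductive_cases exec_GetSizeE: "exec Or S W (GetSize a i) s t s'"
inductive_cases exec_RandE: "exec Or S W (Rand a k) s t s'"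
inductive_cases exec_KernelE: "exec Or S W (Kernel a i j i' j') s t s'"
inductive_cases exec_LinkE: "exec Or S W (Link a e) s t s'"
inductive_cases exec_SeqE: "exec Or S W (Seq p q) s t s'"
inductive_cases exec_IfE: "exec Or S W (If b p q) s t s'"
inductive_cases exec_WhileE: "exec Or S W (While b p) s t s'"

text \<open>Runs are deterministic, so existence of a run with some property is unambiguous.\<close>

lemma exec_deterministic:
  assumes "exec Or S W p s t s'" and "exec Or S W p s t2 s2"
  shows "t2 = t \<and> s2 = s'"
  using assms
proof (induction arbitrary: t2 s2)
  case (Skip s)
  then show ?case by (elim exec_SkipE) simp
next
  case (NSet a e s)
  then show ?case by (elim exec_NSetE) simp
next
  case (RSet a e s)
  then show ?case by (elim exec_RSetE) simp
next
  case (Draw s)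
  then show ?case by (elim exec_DrawE) simp
next
  case (GetLabel s i a)
  from GetLabel.prems show ?case by (elim exec_GetLabelE) simp
next
  case (GetSize s i a)
  from GetSize.prems show ?case by (elim exec_GetSizeE) simp
next
  case (Rand a k s)
  then show ?case by (elim exec_RandE) simp
next
  case (Kernel s i j i' j' a)
  from Kernel.prems show ?case by (elim exec_KernelE) simp
next
  case (Link a e s)
  then show ?case by (elim exec_LinkE) simp
next
  case (Seq p s t s' q t' s'')
  from Seq.prems obtain t1 s1 t1' where
    *: "exec Or S W p s t1 s1" "exec Or S W q s1 t1' s2" "t2 = t1 + t1'"
    by (elim exec_SeqE) simp
  from Seq.IH(1)[OF *(1)] *(2) have "exec Or S W q s' t1' s2" by simp
  with Seq.IH(1)[OF *(1)] Seq.IH(2) *(3) show ?case by simp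
next
  case (IfTrue s b p t s' q)
  from IfTrue.prems IfTrue.hyps(1) obtain t1 where *: "exec Or S W p s t1 s2" "t2 = 1 + t1"
    by (cases rule: exec_IfE) auto
  from IfTrue.IH[OF *(1)] *(2) show ?case by simp
next
  case (IfFalse s b q t s' p)
  from IfFalse.prems IfFalse.hyps(1) obtain t1 where *: "exec Or S W q s t1 s2" "t2 = 1 + t1"
    by (cases rule: exec_IfE) auto
  from IfFalse.IH[OF *(1)] *(2) show ?case by simp
next
  case (WhileTrue s b p t s' t' s'')
  from WhileTrue.prems WhileTrue.hyps(1) obtain t1 s1 t1' where
    *: "exec Or S W p s t1 s1" "exec Or S W (While b p) s1 t1' s2" "t2 = 1 + t1 + t1'"
    by (cases rule: exec_WhileE) auto
  from WhileTrue.IH(1)[OF *(1)] *(2) have "exec Or S W (While b p) s' t1' s2" by simp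
  with WhileTrue.IH(1)[OF *(1)] WhileTrue.IH(2) *(3) show ?case by simp
next
  case (WhileFalse s b p)
  from WhileFalse.prems WhileFalse.hyps show ?case by (cases rule: exec_WhileE) auto
qed

primrec sampling_free :: "com \<Rightarrow> bool" where
  "sampling_free Skip \<longleftrightarrow> True"
| "sampling_free (NSet a e) \<longleftrightarrow> True"
| "sampling_free (RSet a e) \<longleftrightarrow> True"
| "sampling_free Draw \<longleftrightarrow> False"
| "sampling_free (GetLabel a i) \<longleftrightarrow> True"
| "sampling_free (GetSize a i) \<longleftrightarrow> True"
| "sampling_free (Rand a k) \<longleftrightarrow> False"
| "sampling_free (Kernel a i j i' j') \<longleftrightarrow> True"
| "sampling_free (Link a e) \<longleftrightarrow> True"
| "sampling_free (Seq p q) \<longleftrightarrow> sampling_free p \<and> sampling_free q"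
| "sampling_free (If b p q) \<longleftrightarrow> sampling_free p \<and> sampling_free q"
| "sampling_free (While b p) \<longleftrightarrow> sampling_free p"

definition initial_state :: "real list \<Rightarrow> 'x state" where
  "initial_state xs =
     \<lparr>nmem = (\<lambda>_. 0), rmem = (\<lambda>i. if i < length xs then xs ! i else 0), seen = [], coins = 0\<rparr>"


section \<open>Probabilistic multiple-instance learning\<close>

text \<open>
  An algorithm consists of a training program and a prediction program. The hypothesis returned
  by training is the final memory, interpreted by the prediction program: to evaluate it at a bag
  \<open>\<beta>\<close>, the bag is appended (with a dummy label) to the stored bags, and the prediction program,
  which may neither draw bags nor toss coins, leaves the value in real memory cell 0. Evaluation
  must take time at most \<open>T\<close> per instance of \<open>\<beta>\<close>; without such a bound a training program could
  defer its work to the hypothesis.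
\<close>

type_synonym learner = "com \<times> com"

definition represents_hypothesis ::
  "'x oracles \<Rightarrow> (nat \<Rightarrow> 'x list \<times> bool) \<Rightarrow> (nat \<Rightarrow> real) \<Rightarrow> 'x measure \<Rightarrow>
   com \<Rightarrow> 'x state \<Rightarrow> real \<Rightarrow> ('x list \<Rightarrow> real) \<Rightarrow> bool" where
  "represents_hypothesis Or S W M q s T h \<longleftrightarrow>
     (\<forall>\<beta>\<in>space (bag_space M). \<exists>t s'.
        exec Or S W q (s\<lparr>seen := seen s @ [(\<beta>, False)]\<rparr>) t s' \<and>
        rmem s' 0 = h \<beta> \<and> real t \<le> T * real (length \<beta>))"

text \<open>
  The class \<open>\<C>\<close> on the instance space \<open>M\<close> is \<open>(\<epsilon>, \<delta>)\<close>-probabilistic MIL for \<open>u\<close> with sample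
  complexity \<open>m\<close> and running time \<open>T\<close>, as witnessed by the algorithm \<open>alg\<close> run with numerical
  inputs \<open>xs\<close> and with oracles for \<open>K\<close> and \<open>u\<close>. The bounds on time and on the number of bags hold on
  every run; the error bound holds on an event of probability at least \<open>1 - \<delta>\<close>. As the library
  integral of a nonintegrable function is 0, the error is a nonnegative extended integral of a
  hypothesis that is required to be measurable.
\<close>

definition probabilistic_MIL ::
  "learner \<Rightarrow> real list \<Rightarrow> ('x \<Rightarrow> 'x \<Rightarrow> real) \<Rightarrow> nat \<Rightarrow> 'x measure \<Rightarrow> ('x \<Rightarrow> real) set \<Rightarrow>
   (real \<Rightarrow> real) \<Rightarrow> real \<Rightarrow> real \<Rightarrow> real \<Rightarrow> real \<Rightarrow> bool" where
  "probabilistic_MIL alg xs K \<kappa> M \<C> u \<epsilon> \<delta> m T \<longleftrightarrow>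
     sampling_free (snd alg) \<and>
     (\<forall>c\<in>\<C>. \<forall>D. prob_space D \<and> sets D = sets (bag_space M) \<longrightarrow>
       (\<exists>E\<in>sets (run_space u c D). measure (run_space u c D) E \<ge> 1 - \<delta> \<and>
         (\<forall>(S, W)\<in>space (run_space u c D). \<exists>t s h.
            exec \<lparr>kernel = K, kernel_time = \<kappa>, link = u\<rparr> S W (fst alg) (initial_state xs) t s \<and>
            real t \<le> T \<and>
            real (length (seen s)) \<le> m \<and>
            represents_hypothesis \<lparr>kernel = K, kernel_time = \<kappa>, link = u\<rparr> S W M (snd alg) s T h \<and>
            ((S, W) \<in> E \<longrightarrow>
               h \<in> borel_measurable D \<and>
               (\<integral>\<^sup>+\<beta>. ennreal ((h \<beta> - u (bag_mean c \<beta>))\<^sup>2) \<partial>D) \<le> ennreal \<epsilon>))))"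

end

theory Submission
  imports Defs
begin

text \<open>
  The learner runs stochastic gradient descent in the RKHS: starting from \<open>f\<^sub>0 = 0\<close>, it draws a bag with
  label \<open>y\<close>, picks a random instance \<open>x\<close> of it, and sets \<open>f\<^sub>t\<^sub>+\<^sub>1 = f\<^sub>t + \<eta> (y - u a) K(x, \<cdot>)\<close>, where \<open>a\<close>
  is an estimate of the mean of \<open>f\<^sub>t\<close> over the bag from \<open>m\<close> random positions (bags may be large, so
  the exact mean is too expensive). The hypothesis is the average of the bag predictions
  \<open>u (bag_mean f\<^sub>t)\<close>, \<open>t < N\<close>, with \<open>N\<close> about \<open>(B L / \<epsilon>)\<^sup>2 log (1 / \<delta>)\<close> and \<open>\<eta>\<close> about
  \<open>\<epsilon> / (L log (1 / \<delta>))\<close>.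

  Because \<open>u\<close> is monotone and \<open>L\<close>-Lipschitz, \<open>(u a - u b) (a - b) \<ge> (u a - u b)\<^sup>2 / L\<close>; hence the squared
  distance to the approximating element \<open>v\<close> decreases in expectation by \<open>2 \<eta> / L\<close> times the
  current squared error, up to small terms. Hoeffding's lemma turns this into an exponential moment
  bound for the sum of all squared errors. Its variance proxy is the squared distance itself, so it
  is absorbed by slowly increasing the rate in the exponent. Markov's inequality then bounds the
  failure probability by \<open>\<delta>\<close>, and convexity passes from the sum of the errors to the error of
  the average.
\<close>

section \<open>Measurability on the space of bags\<close>

text \<open>An iterate is only known to have norm at most \<open>\<eta> * (N - 1)\<close>, and a
  concentration inequality with one worst-case range for all increments would therefore cost further
  powers of \<open>B * L / \<epsilon>\<close> in the number of bags. Each increment has, however, a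
  range proportional to the current distance to \<open>v\<close>, and this lets the potential pay
  for its own variance.

  The error of the estimated bag means is pushed down by a large \<open>m\<close>: coins count
  toward the running time only, not toward the number of bags. Predictions are averaged rather than
  the functions \<open>f\<^sub>t\<close>, since the link may destroy convexity of the error in the
  function. The machine has neither logarithms nor square roots nor rounding, so \<open>N\<close>,
  \<open>m\<close> and the integer standing for \<open>log (1 / \<delta>)\<close> are found by
  counting loops. Finally, the permitted number of bags vanishes for \<open>B = 0\<close>; hence the
  zero function counts among the \<open>N\<close> averaged hypotheses and only \<open>N - 1\<close>
  bags are drawn.\<close>

lemma mem_listset: "xs \<in> listset As \<longleftrightarrow> list_all2 (\<in>) xs As"
  by (induction As arbitrary: xs) (auto simp: set_Cons_def list_all2_Cons2)

lemma bag_generators_subset: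
  "{listset As |As. As \<noteq> [] \<and> set As \<subseteq> sets M} \<subseteq> Pow {\<beta> \<in> lists (space M). \<beta> \<noteq> []}"
proof -
  have "xs \<in> lists (space M) \<and> xs \<noteq> []"
    if "As \<noteq> []" "set As \<subseteq> sets M" "xs \<in> listset As" for As xs
  proof -
    from that(3) have l: "list_all2 (\<in>) xs As" by (simp add: mem_listset)
    have "xs \<in> lists (space M)"
      using l that(2) by (induction rule: list_all2_induct) (auto dest: sets.sets_into_space)
    moreover have "xs \<noteq> []" using l that(1) by auto
    ultimately show ?thesis by auto
  qed
  then show ?thesis by blast
qed

lemma space_bag_space: "space (bag_space M) = {\<beta> \<in> lists (space M). \<beta> \<noteq> []}"
  unfolding bag_space_def by (rule space_measure_of[OF bag_generators_subset])

lemma listset_in_bag_space: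
  assumes "As \<noteq> []" "set As \<subseteq> sets M"
  shows "listset As \<in> sets (bag_space M)"
  unfolding bag_space_def sets_measure_of[OF bag_generators_subset]
  using assms by (intro sigma_sets.Basic) auto

text \<open>The bags of size \<open>n\<close> are the generator \<open>listset\<close> with
  \<open>n\<close> factors \<open>space M\<close>.\<close>

lemma measurable_bag_length [measurable]:
  "length \<in> measurable (bag_space M) (count_space UNIV)"
proof -
  have "length -` {n} \<inter> space (bag_space M) \<in> sets (bag_space M)" for n
  proof (cases "n = 0")
    case True
    then have "length -` {n} \<inter> space (bag_space M) = {}" by (auto simp: space_bag_space)
    then show ?thesis by simp
  next
    case False
    have "length -` {n} \<inter> space (bag_space M) = listset (replicate n (space M))"
      using False
      by (fastforce simp: space_bag_space mem_listset list_all2_conv_all_nth in_set_conv_nth)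
    then show ?thesis using False by (simp add: listset_in_bag_space)
  qed
  then show ?thesis by (simp add: measurable_count_space_eq_countable)
qed

text \<open>Access past the end of a list is unspecified and may leave \<open>space M\<close>. The
  default value makes access at a fixed position a total measurable map on bags of all
  sizes.\<close>

definition nth_or :: "'a \<Rightarrow> nat \<Rightarrow> 'a list \<Rightarrow> 'a" where
  "nth_or x0 i xs = (if i < length xs then xs ! i else x0)"

text \<open>Split by size: for each size above \<open>i\<close> the preimage of \<open>A\<close> is
  a box with factor \<open>A\<close> at position \<open>i\<close> and the whole space elsewhere.
  Bags too short for position \<open>i\<close> lie in the preimage all or none, depending on
  \<open>x0\<close>.\<close>

lemma measurable_nth_or:
  assumes x0: "x0 \<in> space M"
  shows "nth_or x0 i \<in> measurable (bag_space M) M"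
proof (rule measurableI)
  fix \<beta> assume "\<beta> \<in> space (bag_space M)"
  then show "nth_or x0 i \<beta> \<in> space M" using x0
    by (auto simp: nth_or_def space_bag_space subset_iff)
next
  fix A assume A: "A \<in> sets M"
  have A': "A \<subseteq> space M" using A by (rule sets.sets_into_space)
  let ?B = "{\<beta> \<in> space (bag_space M). length \<beta> \<le> i \<and> x0 \<in> A}"
  have "nth_or x0 i -` A \<inter> space (bag_space M) =
    (\<Union>n\<in>{i<..}. listset ((replicate n (space M))[i := A])) \<union> ?B" (is "?l = ?r")
  proof
    show "?l \<subseteq> ?r"
      by (auto simp: space_bag_space nth_or_def mem_listset list_all2_conv_all_nth subset_iff
          nth_list_update split: if_splits)
    show "?r \<subseteq> ?l"
    proof
      fix xs assume "xs \<in> ?r"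
      then consider n where "n > i" "xs \<in> listset ((replicate n (space M))[i := A])" | "xs \<in> ?B" by auto
      then show "xs \<in> ?l"
      proof cases
        case 1
        then have l: "length xs = n" and e: "\<And>j. j < n \<Longrightarrow> xs ! j \<in> (if j = i then A else space M)"
          by (auto simp: mem_listset list_all2_conv_all_nth nth_list_update)
        have "xs ! j \<in> space M" if "j < n" for j using e[OF that] A' by (auto split: if_splits)
        then have "set xs \<subseteq> space M" by (auto simp: in_set_conv_nth l)
        moreover have "xs ! i \<in> A" using e[of i] 1 by simp
        ultimately show ?thesis using l 1 by (auto simp: space_bag_space nth_or_def)
      qed (auto simp: nth_or_def)
    qed
  qed
  moreover have "listset ((replicate n (space M))[i := A]) \<in> sets (bag_space M)" if "n > i" for n
    using that A by (intro listset_in_bag_space) (auto dest!: set_update_subset_insert[THEN subsetD])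
  then have "(\<Union>n\<in>{i<..}. listset ((replicate n (space M))[i := A])) \<in> sets (bag_space M)"
    by (intro sets.countable_UN'') auto
  moreover have "?B \<in> sets (bag_space M)" by measurable
  ultimately show "nth_or x0 i -` A \<inter> space (bag_space M) \<in> sets (bag_space M)" by simp
qed

text \<open>A random position takes only countably many values, so fixed positions suffice.\<close>

lemma measurable_nth_or' [measurable (raw)]:
  assumes "x0 \<in> space M" and [measurable]: "f \<in> measurable N (count_space UNIV)"
    and g [measurable]: "g \<in> measurable N (bag_space M)"
  shows "(\<lambda>a. nth_or x0 (f a) (g a)) \<in> measurable N M"
proof (rule measurable_compose_countable[OF _ assms(2)])
  fix i show "(\<lambda>a. nth_or x0 i (g a)) \<in> measurable N M"
    using measurable_compose[OF g measurable_nth_or[OF assms(1), of i]] .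
qed

lemma bag_mean_nth_or:
  "bag_mean f \<beta> = (\<Sum>i<length \<beta>. f (nth_or x0 i \<beta>)) / real (length \<beta>)"
  unfolding bag_mean_def by (simp add: sum_list_sum_nth atLeast0LessThan nth_or_def)

text \<open>The parameter \<open>a\<close> is later the history of a run, on which the iterate
  depends; hence joint measurability. The size of the bag is handled as a countable case
  distinction.\<close>

lemma measurable_bag_mean_pair:
  assumes f: "(\<lambda>(a, x). f a x) \<in> borel_measurable (A \<Otimes>\<^sub>M M)"
  shows "(\<lambda>(a, \<beta>). bag_mean (f a) \<beta>) \<in> borel_measurable (A \<Otimes>\<^sub>M bag_space M)"
proof (cases "space M = {}")
  case True
  \<comment> \<open>Without an instance to serve as default there is no bag either.\<close>
  then have "space (A \<Otimes>\<^sub>M bag_space M) = {}"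
    by (auto simp: space_pair_measure space_bag_space)
  then show ?thesis by (simp add: measurable_def)
next
  case False
  then obtain x0 where x0: "x0 \<in> space M" by auto
  have [measurable]: "nth_or x0 i \<in> measurable (bag_space M) M" for i by (rule measurable_nth_or[OF x0])
  have 1: "(\<lambda>z. f (fst z) (nth_or x0 i (snd z))) \<in> borel_measurable (A \<Otimes>\<^sub>M bag_space M)" for i
    using measurable_compose[OF _ f, of "\<lambda>z. (fst z, nth_or x0 i (snd z))" "A \<Otimes>\<^sub>M bag_space M"]
    by simp
  have "(\<lambda>z. (\<Sum>i<length (snd z). f (fst z) (nth_or x0 i (snd z))) / real (length (snd z)))
      \<in> borel_measurable (A \<Otimes>\<^sub>M bag_space M)"
    by (rule measurable_compose_countable[where g = "\<lambda>z. length (snd z)"]) (use 1 in measurable)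
  then show ?thesis unfolding bag_mean_nth_or[of _ _ x0] by (simp add: case_prod_beta)
qed

lemma measurable_bag_mean:
  assumes "f \<in> borel_measurable M"
  shows "bag_mean f \<in> borel_measurable (bag_space M)"
proof -
  \<comment> \<open>A one-point parameter space reduces the claim to the joint version.\<close>
  have "(\<lambda>(a, \<beta>). bag_mean f \<beta>) \<in> borel_measurable (count_space {()} \<Otimes>\<^sub>M bag_space M)"
    by (rule measurable_bag_mean_pair[of "\<lambda>_. f"]) (use assms in measurable)
  from measurable_compose[OF _ this, of "\<lambda>\<beta>. ((), \<beta>)" "bag_space M"] show ?thesis by simp
qed

section \<open>Reproducing kernel Hilbert spaces\<close>

locale rkhs_space =
  fixes X :: "'x set" and K :: "'x \<Rightarrow> 'x \<Rightarrow> real" and H :: "('x \<Rightarrow> real) set"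
    and ip :: "('x \<Rightarrow> real) \<Rightarrow> ('x \<Rightarrow> real) \<Rightarrow> real"
  assumes rkhs: "rkhs X K H ip"
    and K_le_1: "\<And>x y. x \<in> X \<Longrightarrow> y \<in> X \<Longrightarrow> K x y \<le> 1"
begin

abbreviation feat :: "'x \<Rightarrow> 'x \<Rightarrow> real" where "feat \<equiv> feature X K"

lemma inner_product: "inner_product_on H ip" using rkhs by (simp add: rkhs_def)

lemma zero_mem [simp]: "(\<lambda>_. 0) \<in> H"
  and add_mem: "f \<in> H \<Longrightarrow> g \<in> H \<Longrightarrow> (\<lambda>x. f x + g x) \<in> H"
  and scale_mem: "f \<in> H \<Longrightarrow> (\<lambda>x. a * f x) \<in> H"
  and ip_sym: "f \<in> H \<Longrightarrow> g \<in> H \<Longrightarrow> ip f g = ip g f"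
  and ip_add: "f \<in> H \<Longrightarrow> g \<in> H \<Longrightarrow> h \<in> H \<Longrightarrow> ip (\<lambda>x. f x + g x) h = ip f h + ip g h"
  and ip_scale: "f \<in> H \<Longrightarrow> g \<in> H \<Longrightarrow> ip (\<lambda>x. a * f x) g = a * ip f g"
  and ip_nonneg: "f \<in> H \<Longrightarrow> 0 \<le> ip f f"
  using inner_product unfolding inner_product_on_def by blast+

lemma feat_mem [simp]: "x \<in> X \<Longrightarrow> feat x \<in> H"
  and reproducing: "f \<in> H \<Longrightarrow> x \<in> X \<Longrightarrow> ip f (feat x) = f x"
  using rkhs unfolding rkhs_def by blast+

lemma comb_mem: "f \<in> H \<Longrightarrow> g \<in> H \<Longrightarrow> (\<lambda>x. f x + a * g x) \<in> H"
  by (intro add_mem scale_mem)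

lemma diff_mem: "f \<in> H \<Longrightarrow> g \<in> H \<Longrightarrow> (\<lambda>x. f x - g x) \<in> H"
  using comb_mem[of f g "-1"] by simp

lemma ip_comb:
  assumes "f \<in> H" "g \<in> H"
  shows "ip (\<lambda>x. f x + a * g x) (\<lambda>x. f x + a * g x) = ip f f + 2 * a * ip f g + a\<^sup>2 * ip g g"
proof -
  have ag: "(\<lambda>x. a * g x) \<in> H" and s: "(\<lambda>x. f x + a * g x) \<in> H"
    using assms by (auto intro: scale_mem comb_mem)
  have 1: "ip (\<lambda>x. f x + a * g x) h = ip f h + a * ip g h" if "h \<in> H" for h
    using ip_add[OF assms(1) ag that] ip_scale[OF assms(2) that] by simp
  have "ip (\<lambda>x. f x + a * g x) (\<lambda>x. f x + a * g x) =
      ip (\<lambda>x. f x + a * g x) f + a * ip (\<lambda>x. f x + a * g x) g"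
    unfolding 1[OF s] using ip_sym[OF assms(1) s] ip_sym[OF assms(2) s] by simp
  then show ?thesis unfolding 1[OF assms(1)] 1[OF assms(2)] using ip_sym[OF assms]
    by (simp add: algebra_simps power2_eq_square)
qed

text \<open>The squared norm of \<open>f + a * g\<close> is a nonnegative polynomial of degree at
  most 2 in \<open>a\<close>.\<close>

lemma Cauchy_Schwarz:
  assumes "f \<in> H" "g \<in> H"
  shows "(ip f g)\<^sup>2 \<le> ip f f * ip g g"
proof -
  have q: "0 \<le> ip f f + 2 * a * ip f g + a\<^sup>2 * ip g g" for a
    using ip_nonneg[OF comb_mem[OF assms]] ip_comb[OF assms] by metis
  show ?thesis
  proof (cases "ip g g = 0")
    case True
    have "ip f g = 0"
    proof (rule ccontr)
      assume n: "ip f g \<noteq> 0"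
      \<comment> \<open>For \<open>ip g g = 0\<close> the polynomial is affine in \<open>a\<close>;
        this choice of \<open>a\<close> would give it the value -1.\<close>
      have "2 * (- (ip f f + 1) / (2 * ip f g)) * ip f g = - (ip f f + 1)" using n by simp
      then show False using q[of "- (ip f f + 1) / (2 * ip f g)"] True by simp
    qed
    then show ?thesis using True by simp
  next
    case False
    then have p: "0 < ip g g" using ip_nonneg[OF assms(2)] by simp
    \<comment> \<open>The minimizer of the quadratic.\<close>
    have "ip f f + 2 * (- ip f g / ip g g) * ip f g + (- ip f g / ip g g)\<^sup>2 * ip g g
        = ip f f - (ip f g)\<^sup>2 / ip g g"
      using p by (simp add: field_simps power2_eq_square)
    then have "(ip f g)\<^sup>2 / ip g g \<le> ip f f" using q[of "- ip f g / ip g g"] by simp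
    then show ?thesis using p by (simp add: field_simps)
  qed
qed

lemma abs_ip_le: "f \<in> H \<Longrightarrow> g \<in> H \<Longrightarrow> \<bar>ip f g\<bar> \<le> ip_norm ip f * ip_norm ip g"
  using real_sqrt_le_mono[OF Cauchy_Schwarz[of f g]] by (simp add: ip_norm_def real_sqrt_mult)

lemma K_diag: "x \<in> X \<Longrightarrow> ip (feat x) (feat x) = K x x"
  using reproducing[OF feat_mem, of x x] by (simp add: feature_def[of X K x, THEN fun_cong, of x])

lemma ip_norm_feat_le: "x \<in> X \<Longrightarrow> ip_norm ip (feat x) \<le> 1"
  unfolding ip_norm_def K_diag using K_le_1[of x x] by simp

lemma ip_norm_nonneg: "f \<in> H \<Longrightarrow> 0 \<le> ip_norm ip f"
  by (simp add: ip_norm_def ip_nonneg)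

lemma ip_norm_square: "f \<in> H \<Longrightarrow> (ip_norm ip f)\<^sup>2 = ip f f"
  by (simp add: ip_norm_def ip_nonneg)

text \<open>Evaluation is the inner product with a feature vector, whose norm is at most 1. Norm
  bounds on the iterates thus bound all their values.\<close>

lemma abs_eval_le:
  assumes "f \<in> H" "x \<in> X" shows "\<bar>f x\<bar> \<le> ip_norm ip f"
proof -
  have "\<bar>f x\<bar> \<le> ip_norm ip f * ip_norm ip (feat x)"
    using abs_ip_le[OF assms(1) feat_mem[OF assms(2)]] reproducing[OF assms] by simp
  also have "\<dots> \<le> ip_norm ip f * 1"
    by (intro mult_left_mono ip_norm_feat_le assms ip_norm_nonneg)
  finally show ?thesis by simp
qed

lemma ip_norm_comb_le:
  assumes "f \<in> H" "g \<in> H"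
  shows "ip_norm ip (\<lambda>x. f x + a * g x) \<le> ip_norm ip f + \<bar>a\<bar> * ip_norm ip g"
proof (rule power2_le_imp_le)
  have "(ip_norm ip (\<lambda>x. f x + a * g x))\<^sup>2 = ip f f + 2 * a * ip f g + a\<^sup>2 * ip g g"
    using ip_norm_square[OF comb_mem[OF assms]] ip_comb[OF assms] by metis
  also have "a * ip f g \<le> \<bar>a\<bar> * (ip_norm ip f * ip_norm ip g)"
    using abs_ip_le[OF assms] by (metis abs_ge_self abs_mult abs_ge_zero mult_left_mono order_trans)
  then have "ip f f + 2 * a * ip f g + a\<^sup>2 * ip g g \<le>
      (ip_norm ip f)\<^sup>2 + 2 * (\<bar>a\<bar> * (ip_norm ip f * ip_norm ip g)) + a\<^sup>2 * (ip_norm ip g)\<^sup>2"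
    using ip_norm_square[OF assms(1)] ip_norm_square[OF assms(2)] by simp
  also have "\<dots> = (ip_norm ip f + \<bar>a\<bar> * ip_norm ip g)\<^sup>2"
    by (simp add: power2_sum power_mult_distrib)
  finally show "(ip_norm ip (\<lambda>x. f x + a * g x))\<^sup>2 \<le> (ip_norm ip f + \<bar>a\<bar> * ip_norm ip g)\<^sup>2" .
qed (use assms in \<open>auto intro!: add_nonneg_nonneg mult_nonneg_nonneg ip_norm_nonneg\<close>)

lemma ip_norm_step_le:
  assumes "f \<in> H" "x \<in> X"
  shows "ip_norm ip (\<lambda>z. f z + a * feat x z) \<le> ip_norm ip f + \<bar>a\<bar>"
proof -
  have "\<bar>a\<bar> * ip_norm ip (feat x) \<le> \<bar>a\<bar> * 1" by (intro mult_left_mono ip_norm_feat_le assms) auto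
  then show ?thesis using ip_norm_comb_le[OF assms(1) feat_mem[OF assms(2)], of a] by simp
qed

text \<open>The potential of the analysis, later taken between an iterate and the approximating
  element \<open>v\<close>.\<close>

definition sqdist :: "('x \<Rightarrow> real) \<Rightarrow> ('x \<Rightarrow> real) \<Rightarrow> real" where
  "sqdist f v = ip (\<lambda>x. f x - v x) (\<lambda>x. f x - v x)"

lemma sqdist_nonneg: "f \<in> H \<Longrightarrow> v \<in> H \<Longrightarrow> 0 \<le> sqdist f v"
  unfolding sqdist_def by (intro ip_nonneg diff_mem)

text \<open>Expand the square: the cross term is a point evaluation by the reproducing property, and
  the last term carries the factor \<open>K x x\<close>, which is at most 1.\<close>

lemma sqdist_step_le:
  assumes "f \<in> H" "v \<in> H" "x \<in> X"
  shows "sqdist (\<lambda>z. f z + a * feat x z) v \<le> sqdist f v + 2 * a * (f x - v x) + a\<^sup>2"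
proof -
  have d: "(\<lambda>z. f z - v z) \<in> H" by (intro diff_mem assms)
  have "sqdist (\<lambda>z. f z + a * feat x z) v =
      ip (\<lambda>z. (f z - v z) + a * feat x z) (\<lambda>z. (f z - v z) + a * feat x z)"
    unfolding sqdist_def by (simp add: algebra_simps)
  also have "\<dots> = sqdist f v + 2 * a * (f x - v x) + a\<^sup>2 * K x x"
    unfolding ip_comb[OF d feat_mem[OF assms(3)]] reproducing[OF d assms(3)] K_diag[OF assms(3)]
    by (simp add: sqdist_def)
  also have "\<dots> \<le> sqdist f v + 2 * a * (f x - v x) + a\<^sup>2"
    using mult_left_mono[OF K_le_1[OF assms(3,3)], of "a\<^sup>2"] by simp
  finally show ?thesis .
qed

lemma abs_diff_le_sqdist:
  assumes "f \<in> H" "v \<in> H" "x \<in> X"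
  shows "\<bar>f x - v x\<bar> \<le> sqrt (sqdist f v)"
  using abs_eval_le[OF diff_mem[OF assms(1,2)] assms(3)] by (simp add: ip_norm_def sqdist_def)

lemma sqrt_sqdist_le:
  assumes "f \<in> H" "v \<in> H"
  shows "sqrt (sqdist f v) \<le> ip_norm ip f + ip_norm ip v"
  using ip_norm_comb_le[OF assms, of "-1"] by (simp add: ip_norm_def sqdist_def)

lemma sqdist_zero: "v \<in> H \<Longrightarrow> sqdist (\<lambda>_. 0) v = (ip_norm ip v)\<^sup>2"
  using ip_comb[of "\<lambda>_. 0" v "-1"] ip_scale[of "\<lambda>_. 0" v 0] ip_scale[of "\<lambda>_. 0" "\<lambda>_. 0" 0]
  by (simp add: sqdist_def ip_norm_square)

end

section \<open>Random coins and labeled bags\<close>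

abbreviation coin :: "real measure" where "coin \<equiv> uniform_measure lborel {0..<1}"

lemma prob_space_coin: "prob_space coin"
  by (rule prob_space_uniform_measure) auto

text \<open>The number that the command \<open>Rand\<close> writes. Because of \<open>frac\<close>
  it is a valid index for every real coin, so that no run gets stuck, not even one of probability
  zero.\<close>

definition coin_index :: "real \<Rightarrow> nat \<Rightarrow> nat" where
  "coin_index w n = nat \<lfloor>frac w * real n\<rfloor>"

lemma coin_index_less: "0 < n \<Longrightarrow> coin_index w n < n"
proof -
  assume n: "0 < n"
  have "frac w * real n < real n" using frac_lt_1[of w] n by simp
  moreover have "0 \<le> frac w * real n" by simp
  ultimately show ?thesis unfolding coin_index_def by linarith
qed

lemma measurable_coin_index [measurable]:
  assumes [measurable]: "f \<in> borel_measurable N" "g \<in> measurable N (count_space UNIV)"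
  shows "(\<lambda>a. coin_index (f a) (g a)) \<in> measurable N (count_space UNIV)"
  unfolding coin_index_def frac_def by measurable

lemma coin_index_eq_iff:
  assumes "0 < n" "0 \<le> w" "w < 1"
  shows "coin_index w n = i \<longleftrightarrow> w \<in> {real i / real n..<(real i + 1) / real n}"
proof -
  have f: "frac w = w" using assms by (simp add: frac_eq)
  have "nat \<lfloor>w * real n\<rfloor> = i \<longleftrightarrow> real i \<le> w * real n \<and> w * real n < real i + 1"
  proof -
    have "0 \<le> \<lfloor>w * real n\<rfloor>" using assms by simp
    then have "nat \<lfloor>w * real n\<rfloor> = i \<longleftrightarrow> \<lfloor>w * real n\<rfloor> = int i" by linarith
    then show ?thesis by (simp add: floor_eq_iff)
  qed
  then show ?thesis using assms by (simp add: coin_index_def f field_simps)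
qed

text \<open>The \<open>n\<close> outcomes cut the unit interval into pieces of length
  \<open>1 / n\<close>.\<close>

lemma integral_coin_index:
  fixes \<phi> :: "nat \<Rightarrow> real"
  assumes n: "0 < n"
  shows "(\<integral>w. \<phi> (coin_index w n) \<partial>coin) = (\<Sum>i<n. \<phi> i) / real n"
proof -
  interpret prob_space coin by (rule prob_space_coin)
  let ?I = "\<lambda>i. {real i / real n..<(real i + 1) / real n}"
  \<comment> \<open>The coin space contains all reals, whereas the description of the outcomes by
    intervals is valid only in the unit interval.\<close>
  have ae: "AE w in coin. w \<in> {0..<1}" by (rule AE_uniform_measureI) auto
  have "(\<integral>w. \<phi> (coin_index w n) \<partial>coin) = (\<integral>w. (\<Sum>i<n. \<phi> i * indicator (?I i) w) \<partial>coin)"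
  proof (rule integral_cong_AE)
    show "AE w in coin. \<phi> (coin_index w n) = (\<Sum>i<n. \<phi> i * indicator (?I i) w)"
      using ae
    proof eventually_elim
      case (elim w)
      have mem: "w \<in> ?I i \<longleftrightarrow> i = coin_index w n" for i
        using coin_index_eq_iff[OF n, of w i] elim by auto
      have "(\<Sum>i<n. \<phi> i * indicator (?I i) w) = (\<Sum>i<n. if i = coin_index w n then \<phi> i else 0)"
        unfolding indicator_def mem by (intro sum.cong refl) auto
      then show ?case using coin_index_less[OF n] by simp
    qed
  qed measurable
  also have "\<dots> = (\<Sum>i<n. \<phi> i * measure coin (?I i))"
    by (subst Bochner_Integration.integral_sum) (auto intro!: integrable_real_indicator simp: emeasure_eq_measure)
  also have "\<dots> = (\<Sum>i<n. \<phi> i * (1 / real n))"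
  proof (intro sum.cong refl arg_cong2[where f = "(*)"])
    fix i assume i: "i \<in> {..<n}"
    have "?I i \<subseteq> {0..<1}" using i n by (auto simp: field_simps)
    then have "{0..<1} \<inter> ?I i = ?I i" by auto
    moreover have "emeasure lborel (?I i) = ennreal (1 / real n)"
      using n by (simp add: divide_right_mono diff_divide_distrib[symmetric])
    ultimately show "measure coin (?I i) = 1 / real n"
      using divide_ennreal[of "1 / real n" 1] by (simp add: measure_def)
  qed
  finally show ?thesis by (simp add: sum_divide_distrib)
qed

context sequence_space
begin

lemma integral_S_Suc:
  fixes g :: "(nat \<Rightarrow> 'a) \<Rightarrow> real"
  assumes [measurable]: "g \<in> borel_measurable S"
  shows "integral\<^sup>L S g = (\<integral>z. g (case_nat (fst z) (snd z)) \<partial>(M \<Otimes>\<^sub>M S))"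
proof -
  have "integral\<^sup>L S g = integral\<^sup>L (distr (M \<Otimes>\<^sub>M S) S (\<lambda>(s, \<omega>). case_nat s \<omega>)) g"
    by (simp only: PiM_iter)
  then show ?thesis by (subst (asm) integral_distr) (auto simp: case_prod_beta)
qed

text \<open>Split off the first coordinate, which is independent of the others; the cross term
  vanishes because \<open>Z\<close> has mean 0.\<close>

lemma second_moment_sum:
  fixes Z :: "'a \<Rightarrow> real"
  assumes Z [measurable]: "Z \<in> borel_measurable M"
    and b: "\<And>x. x \<in> space M \<Longrightarrow> \<bar>Z x\<bar> \<le> b" and mean: "integral\<^sup>L M Z = 0"
  shows "(\<integral>\<omega>. (\<Sum>j<m. Z (\<omega> j))\<^sup>2 \<partial>S) = real m * (\<integral>x. (Z x)\<^sup>2 \<partial>M)"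
proof (induction m)
  case 0
  then show ?case by simp
next
  case (Suc m)
  interpret MS: pair_prob_space M S ..
  define Y where "Y \<omega> = (\<Sum>j<m. Z (\<omega> j))" for \<omega>
  have Y [measurable]: "Y \<in> borel_measurable S" unfolding Y_def by measurable
  have Yb: "\<bar>Y \<omega>\<bar> \<le> real m * b" if "\<omega> \<in> space S" for \<omega>
  proof -
    have "\<bar>Y \<omega>\<bar> \<le> (\<Sum>j<m. \<bar>Z (\<omega> j)\<bar>)" unfolding Y_def by (rule sum_abs)
    also have "\<dots> \<le> (\<Sum>j<m. b)" using that by (intro sum_mono b) (auto simp: space_PiM PiE_iff)
    finally show ?thesis by simp
  qed
  have b0: "0 \<le> b" using b M.not_empty by fastforce
  have [simp]: "integrable S Y" "integrable S (\<lambda>\<omega>. (Y \<omega>)\<^sup>2)"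
    by (rule P.integrable_const_bound[where B = "real m * b"], use Yb in auto)
      (rule P.integrable_const_bound[where B = "(real m * b)\<^sup>2"], use Yb b0 in \<open>auto intro!: AE_I2 power2_le_iff_abs_le[THEN iffD2]\<close>)
  have [simp]: "integrable M Z" "integrable M (\<lambda>\<omega>. (Z \<omega>)\<^sup>2)"
    by (rule M.integrable_const_bound[where B = "b"], use b in auto)
      (rule M.integrable_const_bound[where B = "b\<^sup>2"], use b b0 in \<open>auto intro!: AE_I2 power2_le_iff_abs_le[THEN iffD2]\<close>)
  have i: "integrable (M \<Otimes>\<^sub>M S) (\<lambda>z. (Z (fst z) + Y (snd z))\<^sup>2)"
  proof (rule MS.integrable_const_bound[where B = "(b + real m * b)\<^sup>2"])
    show "AE z in M \<Otimes>\<^sub>M S. norm ((Z (fst z) + Y (snd z))\<^sup>2) \<le> (b + real m * b)\<^sup>2"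
    proof (rule AE_I2)
      fix z assume "z \<in> space (M \<Otimes>\<^sub>M S)"
      then have "\<bar>Z (fst z) + Y (snd z)\<bar> \<le> b + real m * b"
        using b[of "fst z"] Yb[of "snd z"] by (auto simp: space_pair_measure)
      then show "norm ((Z (fst z) + Y (snd z))\<^sup>2) \<le> (b + real m * b)\<^sup>2"
        using b0 by (simp add: power2_le_iff_abs_le)
    qed
  qed measurable
  have "(\<integral>\<omega>. (\<Sum>j<Suc m. Z (\<omega> j))\<^sup>2 \<partial>S) = (\<integral>z. (Z (fst z) + Y (snd z))\<^sup>2 \<partial>(M \<Otimes>\<^sub>M S))"
    by (subst integral_S_Suc) (auto simp: Y_def sum.lessThan_Suc_shift simp del: sum.lessThan_Suc)
  also have "\<dots> = (\<integral>x. \<integral>\<omega>. (Z x + Y \<omega>)\<^sup>2 \<partial>S \<partial>M)"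
    using MS.integral_fst'[OF i] by simp
  also have "\<dots> = (\<integral>x. (Z x)\<^sup>2 + 2 * Z x * integral\<^sup>L S Y + (\<integral>\<omega>. (Y \<omega>)\<^sup>2 \<partial>S) \<partial>M)"
    by (intro Bochner_Integration.integral_cong refl) (simp add: power2_sum P.prob_space)
  also have "\<dots> = (\<integral>x. (Z x)\<^sup>2 \<partial>M) + (\<integral>\<omega>. (Y \<omega>)\<^sup>2 \<partial>S)"
    by (simp add: M.prob_space mean)
  finally show ?case using Suc by (simp add: Y_def algebra_simps)
qed

end

section \<open>Stochastic gradient steps\<close>

definition draw_inst :: "'x list \<Rightarrow> real \<Rightarrow> 'x" where
  "draw_inst \<beta> w = \<beta> ! coin_index w (length \<beta>)"

definition est :: "nat \<Rightarrow> ('x \<Rightarrow> real) \<Rightarrow> 'x list \<Rightarrow> (nat \<Rightarrow> real) \<Rightarrow> real" where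
  "est m f \<beta> W = (\<Sum>j<m. f (draw_inst \<beta> (W j))) / real m"

text \<open>Coins below \<open>m\<close> serve the estimate and coin \<open>m\<close> picks the
  instance, so one step consumes \<open>Suc m\<close> coins. With \<open>feature\<close> in place of
  \<open>K\<close> the result vanishes outside \<open>X\<close>, as elements of the RKHS do.\<close>

definition update :: "'x set \<Rightarrow> ('x \<Rightarrow> 'x \<Rightarrow> real) \<Rightarrow> (real \<Rightarrow> real) \<Rightarrow> nat \<Rightarrow> real \<Rightarrow>
    ('x \<Rightarrow> real) \<Rightarrow> 'x list \<times> bool \<Rightarrow> (nat \<Rightarrow> real) \<Rightarrow> 'x \<Rightarrow> real" where
  "update X K u m \<eta> f z W = (\<lambda>x. f x +
     \<eta> * (of_bool (snd z) - u (est m f (fst z) W)) * feature X K (draw_inst (fst z) (W m)) x)"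

lemma draw_inst_mem: "\<beta> \<in> space (bag_space M) \<Longrightarrow> draw_inst \<beta> w \<in> space M"
  using coin_index_less[of "length \<beta>" w] unfolding draw_inst_def space_bag_space
  by (auto simp: in_lists_conv_set)

text \<open>Bags are nonempty, so the drawn index is always valid and \<open>nth_or\<close> agrees
  with plain list access.\<close>

lemma measurable_draw_inst [measurable]:
  assumes b [measurable]: "b \<in> measurable N (bag_space M)" and [measurable]: "w \<in> borel_measurable N"
  shows "(\<lambda>a. draw_inst (b a) (w a)) \<in> measurable N M"
proof (cases "space M = {}")
  case True
  then have "space N = {}" using measurable_space[OF b] by (fastforce simp: space_bag_space)
  then show ?thesis by (simp add: measurable_def)
next
  case False
  then obtain x0 where x0: "x0 \<in> space M" by auto
  have "(\<lambda>a. nth_or x0 (coin_index (w a) (length (b a))) (b a)) \<in> measurable N M"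
    using x0 by measurable
  also have "?this \<longleftrightarrow> ?thesis"
  proof (rule measurable_cong)
    fix a assume "a \<in> space N"
    then have "length (b a) > 0" using measurable_space[OF b] by (auto simp: space_bag_space)
    then show "nth_or x0 (coin_index (w a) (length (b a))) (b a) = draw_inst (b a) (w a)"
      by (simp add: nth_or_def draw_inst_def coin_index_less)
  qed
  finally show ?thesis .
qed

lemma integral_draw_inst:
  fixes f :: "'x \<Rightarrow> real"
  assumes "\<beta> \<noteq> []"
  shows "(\<integral>w. f (draw_inst \<beta> w) \<partial>coin) = bag_mean f \<beta>"
  using integral_coin_index[of "length \<beta>" "\<lambda>i. f (\<beta> ! i)"] assms
  by (simp add: draw_inst_def bag_mean_def sum_list_sum_nth atLeast0LessThan)

lemma abs_bag_mean_le:
  assumes "\<beta> \<noteq> []" "\<And>x. x \<in> set \<beta> \<Longrightarrow> \<bar>f x\<bar> \<le> b"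
  shows "\<bar>bag_mean f \<beta>\<bar> \<le> b"
proof -
  have "\<bar>\<Sum>x\<leftarrow>\<beta>. f x\<bar> \<le> (\<Sum>x\<leftarrow>\<beta>. \<bar>f x\<bar>)" by (rule sum_list_abs[of "map f \<beta>", simplified map_map o_def])
  also have "\<dots> \<le> (\<Sum>x\<leftarrow>\<beta>. b)" by (intro sum_list_mono assms)
  finally show ?thesis using assms(1)
    by (simp add: bag_mean_def sum_list_triv field_simps)
qed

lemma bag_mean_diff: "bag_mean (\<lambda>x. f x - g x) \<beta> = bag_mean f \<beta> - bag_mean g \<beta>"
  by (simp add: bag_mean_def sum_list_subtractf diff_divide_distrib)

lemma measurable_est:
  assumes F: "(\<lambda>(a, x). F a x) \<in> borel_measurable (A \<Otimes>\<^sub>M M)"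
    and [measurable]: "b \<in> measurable A (bag_space M)" "\<And>j. (\<lambda>a. W a j) \<in> borel_measurable A"
  shows "(\<lambda>a. est m (F a) (b a) (W a)) \<in> borel_measurable A"
proof -
  have [measurable]: "(\<lambda>a. F a (draw_inst (b a) (W a j))) \<in> borel_measurable A" for j
    using measurable_compose[OF _ F, of "\<lambda>a. (a, draw_inst (b a) (W a j))" A] by simp
  show ?thesis unfolding est_def by measurable
qed

lemma measurable_update:
  assumes K: "(\<lambda>(x, y). K x y) \<in> borel_measurable (M \<Otimes>\<^sub>M M)"
    and [measurable]: "u \<in> borel_measurable borel"
    and F [measurable]: "(\<lambda>(a, x). F a x) \<in> borel_measurable (A \<Otimes>\<^sub>M M)"
    and [measurable]: "z \<in> measurable A (bag_space M \<Otimes>\<^sub>M count_space UNIV)"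
      "\<And>j. (\<lambda>a. W a j) \<in> borel_measurable A"
  shows "(\<lambda>(a, x). update (space M) K u m \<eta> (F a) (z a) (W a) x) \<in> borel_measurable (A \<Otimes>\<^sub>M M)"
proof -
  have [measurable]: "(\<lambda>a. est m (F a) (fst (z a)) (W a)) \<in> borel_measurable A"
    by (rule measurable_est[OF F]) measurable
  have [measurable]: "(\<lambda>q. F (fst q) (snd q)) \<in> borel_measurable (A \<Otimes>\<^sub>M M)"
    using F by (simp add: case_prod_beta)
  have "(\<lambda>q. K (draw_inst (fst (z (fst q))) (W (fst q) m)) (snd q)) \<in> borel_measurable (A \<Otimes>\<^sub>M M)"
    using measurable_compose[OF _ K, of "\<lambda>q. (draw_inst (fst (z (fst q))) (W (fst q) m), snd q)" "A \<Otimes>\<^sub>M M"]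
    by simp
  also have "?this \<longleftrightarrow> (\<lambda>q. feature (space M) K (draw_inst (fst (z (fst q))) (W (fst q) m)) (snd q))
      \<in> borel_measurable (A \<Otimes>\<^sub>M M)"
    by (intro measurable_cong) (auto simp: feature_def space_pair_measure)
  finally have [measurable]: "(\<lambda>q. feature (space M) K (draw_inst (fst (z (fst q))) (W (fst q) m)) (snd q))
      \<in> borel_measurable (A \<Otimes>\<^sub>M M)" .
  show ?thesis unfolding update_def case_prod_beta by measurable
qed

locale mil = rkhs_space "space M" K H ip
  for M :: "'x measure" and K H ip +
  fixes u :: "real \<Rightarrow> real" and L :: real and c :: "'x \<Rightarrow> real" and D :: "'x list measure"
    and v :: "'x \<Rightarrow> real" and e :: real
  assumes K_meas: "(\<lambda>(x, y). K x y) \<in> borel_measurable (M \<Otimes>\<^sub>M M)"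
    and mono_u: "mono u" and range_u: "range u \<subseteq> {0..1}"
    and L_pos: "0 < L" and lip: "L-lipschitz_on UNIV u"
    and c_meas [measurable]: "c \<in> borel_measurable M"
    and prob_D: "prob_space D" and sets_D [measurable_cong]: "sets D = sets (bag_space M)"
    and v_mem: "v \<in> H" and approx: "\<And>x. x \<in> space M \<Longrightarrow> \<bar>c x - v x\<bar> \<le> e"
begin

sublocale D: prob_space D by (rule prob_D)

lemma u_bounds [simp]: "0 \<le> u a" "u a \<le> 1"
  using subsetD[OF range_u rangeI[of u a]] by auto

lemma u_meas [measurable]: "u \<in> borel_measurable borel"
  by (rule borel_measurable_mono[OF mono_u])

lemma u_lip: "\<bar>u a - u b\<bar> \<le> L * \<bar>a - b\<bar>"
  using lipschitz_onD[OF lip, of a b] by (simp add: dist_real_def)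

text \<open>The regression function: the conditional probability of label 1 given the bag.\<close>

definition p :: "'x list \<Rightarrow> real" where "p \<beta> = u (bag_mean c \<beta>)"

lemma p_bounds [simp]: "0 \<le> p \<beta>" "p \<beta> \<le> 1" by (simp_all add: p_def)

lemma p_meas [measurable]: "p \<in> borel_measurable (bag_space M)"
  unfolding p_def using measurable_compose[OF measurable_bag_mean[OF c_meas] u_meas] by simp

lemma space_D: "space D = space (bag_space M)" by (rule sets_eq_imp_space_eq[OF sets_D])

abbreviation Q where "Q \<equiv> labeled_bag u c D"

lemma Q_density: "Q = density (D \<Otimes>\<^sub>M count_space UNIV)
    (\<lambda>z. ennreal (if snd z then p (fst z) else 1 - p (fst z)))"
  by (simp add: labeled_bag_def p_def case_prod_unfold cong: if_cong)

lemma sets_Q [measurable_cong]: "sets Q = sets (bag_space M \<Otimes>\<^sub>M count_space UNIV)"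
  unfolding Q_density sets_density by (intro sets_pair_measure_cong sets_D refl)

lemma space_Q: "space Q = space (bag_space M) \<times> UNIV"
  using sets_eq_imp_space_eq[OF sets_Q] by (simp add: space_pair_measure)

lemma prob_space_Q: "prob_space Q"
proof
  interpret b: finite_measure "count_space (UNIV :: bool set)" by (rule finite_measure_count_space) simp
  have "emeasure Q (space Q) = (\<integral>\<^sup>+z. ennreal (if snd z then p (fst z) else 1 - p (fst z))
      \<partial>(D \<Otimes>\<^sub>M count_space UNIV))"
    unfolding Q_density by (subst emeasure_density) (auto intro!: nn_integral_cong)
  also have "\<dots> = (\<integral>\<^sup>+\<beta>. \<integral>\<^sup>+y. ennreal (if y then p \<beta> else 1 - p \<beta>) \<partial>count_space UNIV \<partial>D)"
    by (subst b.nn_integral_fst[symmetric]) (auto cong: if_cong)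
  also have "\<dots> = (\<integral>\<^sup>+\<beta>. 1 \<partial>D)"
    by (intro nn_integral_cong) (simp add: nn_integral_count_space_finite UNIV_bool ennreal_plus[symmetric] del: ennreal_plus)
  finally show "emeasure Q (space Q) = 1" by (simp add: D.emeasure_space_1)
qed

sublocale Q: prob_space Q by (rule prob_space_Q)

text \<open>This is how the law of the labels enters the analysis: given the bag, the label averages
  to \<open>p\<close>. The bound \<open>b\<close> provides the integrability that Fubini's theorem
  asks for.\<close>

lemma integral_Q:
  fixes G :: "'x list \<times> bool \<Rightarrow> real"
  assumes [measurable]: "G \<in> borel_measurable Q" and b: "\<And>z. z \<in> space Q \<Longrightarrow> \<bar>G z\<bar> \<le> b"
  shows "integral\<^sup>L Q G = (\<integral>\<beta>. p \<beta> * G (\<beta>, True) + (1 - p \<beta>) * G (\<beta>, False) \<partial>D)"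
proof -
  interpret b: finite_measure "count_space (UNIV :: bool set)" by (rule finite_measure_count_space) simp
  interpret DB: pair_sigma_finite D "count_space (UNIV :: bool set)" ..
  interpret DBf: finite_measure "D \<Otimes>\<^sub>M count_space (UNIV :: bool set)"
    by (intro finite_measure_pair_measure b.finite_measure_axioms D.finite_measure_axioms)
  let ?g = "\<lambda>z. (if snd z then p (fst z) else 1 - p (fst z)) * G z"
  have i: "integrable (D \<Otimes>\<^sub>M count_space UNIV) ?g"
  proof (rule DBf.integrable_const_bound[where B = b])
    show "AE z in D \<Otimes>\<^sub>M count_space UNIV. norm (?g z) \<le> b"
    proof (rule AE_I2)
      fix z assume "z \<in> space (D \<Otimes>\<^sub>M count_space (UNIV :: bool set))"
      then have "\<bar>G z\<bar> \<le> b" by (intro b) (auto simp: space_Q space_pair_measure space_D)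
      moreover have "\<bar>if snd z then p (fst z) else 1 - p (fst z)\<bar> \<le> 1" by simp
      ultimately have "\<bar>if snd z then p (fst z) else 1 - p (fst z)\<bar> * \<bar>G z\<bar> \<le> 1 * b"
        by (intro mult_mono) auto
      then show "norm (?g z) \<le> b" by (simp add: abs_mult)
    qed
  qed measurable
  have "integral\<^sup>L Q G = integral\<^sup>L (D \<Otimes>\<^sub>M count_space UNIV) ?g"
    unfolding Q_density by (subst integral_density) (auto)
  also have "\<dots> = (\<integral>\<beta>. \<integral>y. ?g (\<beta>, y) \<partial>count_space UNIV \<partial>D)"
    using DB.integral_fst'[OF i] by simp
  also have "\<dots> = (\<integral>\<beta>. p \<beta> * G (\<beta>, True) + (1 - p \<beta>) * G (\<beta>, False) \<partial>D)"
    by (simp add: lebesgue_integral_count_space_finite UNIV_bool add.commute)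
  finally show ?thesis .
qed

end

section \<open>Expectation of a stochastic gradient with estimated bag means\<close>

lemma (in prob_space) expectation_abs_le_sqrt:
  fixes Y :: "'a \<Rightarrow> real"
  assumes [measurable]: "Y \<in> borel_measurable M" and b: "\<And>x. x \<in> space M \<Longrightarrow> \<bar>Y x\<bar> \<le> b"
  shows "expectation (\<lambda>x. \<bar>Y x\<bar>) \<le> sqrt (expectation (\<lambda>x. (Y x)\<^sup>2))"
proof -
  have i: "integrable M (\<lambda>x. \<bar>Y x\<bar>)"
    by (rule integrable_const_bound[where B = b]) (use b in auto)
  have "\<bar>Y x\<bar>\<^sup>2 \<le> b\<^sup>2" if "x \<in> space M" for x using b[OF that] by (intro power_mono) auto
  then have i2: "integrable M (\<lambda>x. \<bar>Y x\<bar>\<^sup>2)"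
    by (intro integrable_const_bound[where B = "b\<^sup>2"]) auto
  have "0 \<le> variance (\<lambda>x. \<bar>Y x\<bar>)" by (rule variance_positive)
  then have "(expectation (\<lambda>x. \<bar>Y x\<bar>))\<^sup>2 \<le> expectation (\<lambda>x. (Y x)\<^sup>2)"
    unfolding variance_eq[OF i i2] by simp
  then show ?thesis by (rule real_le_rsqrt)
qed

context mil
begin

sublocale coins: sequence_space coin
  by (intro sequence_space.intro product_prob_spaceI prob_space_coin)

abbreviation CS where "CS \<equiv> (\<Pi>\<^sub>M i\<in>(UNIV :: nat set). coin)"

lemma bag_subset: "\<beta> \<in> space (bag_space M) \<Longrightarrow> x \<in> set \<beta> \<Longrightarrow> x \<in> space M"
  and bag_not_Nil: "\<beta> \<in> space (bag_space M) \<Longrightarrow> \<beta> \<noteq> []"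
  by (auto simp: space_bag_space)

lemma draw_inst_meas_coin:
  assumes "\<beta> \<in> space (bag_space M)"
  shows "draw_inst \<beta> \<in> measurable borel M"
  using measurable_draw_inst[of "\<lambda>_. \<beta>" borel M "\<lambda>w. w"] assms by simp

text \<open>The Monte Carlo rate: the first absolute moment is at most the root of the second, and
  the second moment of \<open>m\<close> independent centred terms is \<open>m\<close> times that of
  one term.\<close>

lemma est_error:
  assumes f [measurable]: "f \<in> borel_measurable M" and b: "\<And>x. x \<in> space M \<Longrightarrow> \<bar>f x\<bar> \<le> \<rho>"
    and \<beta>: "\<beta> \<in> space (bag_space M)" and m: "0 < m"
  shows "(\<integral>\<omega>. \<bar>est m f \<beta> \<omega> - bag_mean f \<beta>\<bar> \<partial>CS) \<le> \<rho> / sqrt (real m)"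
proof -
  note [measurable] = draw_inst_meas_coin[OF \<beta>]
  define a where "a = bag_mean f \<beta>"
  define Z where "Z w = f (draw_inst \<beta> w) - a" for w
  have fb: "\<bar>f (draw_inst \<beta> w)\<bar> \<le> \<rho>" for w by (intro b draw_inst_mem \<beta>)
  have ab: "\<bar>a\<bar> \<le> \<rho>" unfolding a_def
    by (intro abs_bag_mean_le b bag_not_Nil[OF \<beta>] bag_subset[OF \<beta>])
  have \<rho>: "0 \<le> \<rho>" using ab by linarith
  have [measurable]: "Z \<in> borel_measurable coin" unfolding Z_def by simp
  have Zb: "\<bar>Z w\<bar> \<le> 2 * \<rho>" for w using fb[of w] ab by (simp add: Z_def)
  have i: "integrable coin (\<lambda>w. f (draw_inst \<beta> w))"
    by (rule coins.M.integrable_const_bound[where B = \<rho>]) (use fb in auto)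
  have fb2: "(f (draw_inst \<beta> w))\<^sup>2 \<le> \<rho>\<^sup>2" for w
    using power_mono[OF fb[of w], of 2] by simp
  have i2: "integrable coin (\<lambda>w. (f (draw_inst \<beta> w))\<^sup>2)"
    by (rule coins.M.integrable_const_bound[where B = "\<rho>\<^sup>2"]) (use fb2 in auto)
  have mean: "(\<integral>w. f (draw_inst \<beta> w) \<partial>coin) = a"
    unfolding a_def by (rule integral_draw_inst[OF bag_not_Nil[OF \<beta>]])
  have Z0: "integral\<^sup>L coin Z = 0"
    unfolding Z_def using i mean coins.M.prob_space by (simp add: Bochner_Integration.integral_diff)
  \<comment> \<open>A variance is at most the uncentred second moment; this gives
    \<open>\<rho>\<close> squared, where the bound on \<open>Z\<close> alone would give four times
    as much.\<close>
  have "(\<integral>w. (Z w)\<^sup>2 \<partial>coin) = (\<integral>w. (f (draw_inst \<beta> w))\<^sup>2 \<partial>coin) - a\<^sup>2"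
    using coins.M.variance_eq[OF i i2] unfolding mean Z_def .
  also have "\<dots> \<le> (\<integral>w. \<rho>\<^sup>2 \<partial>coin)"
    using integral_mono[OF i2, of "\<lambda>_. \<rho>\<^sup>2"] fb2 by simp (smt (verit) zero_le_power2)
  also have "\<dots> = \<rho>\<^sup>2" using coins.M.prob_space by simp
  finally have Z2: "(\<integral>w. (Z w)\<^sup>2 \<partial>coin) \<le> \<rho>\<^sup>2" .
  let ?Y = "\<lambda>\<omega>. \<Sum>j<m. Z (\<omega> j)"
  have "(\<integral>\<omega>. \<bar>?Y \<omega>\<bar> \<partial>CS) \<le> sqrt (\<integral>\<omega>. (?Y \<omega>)\<^sup>2 \<partial>CS)"
  proof (rule coins.P.expectation_abs_le_sqrt[where b = "real m * (2 * \<rho>)"])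
    show "\<bar>?Y \<omega>\<bar> \<le> real m * (2 * \<rho>)" for \<omega>
      using sum_bounded_above[of "{..<m}" "\<lambda>j. \<bar>Z (\<omega> j)\<bar>" "2 * \<rho>"] Zb
      by (intro order_trans[OF sum_abs]) simp
  qed measurable
  also have "\<dots> = sqrt (real m * (\<integral>w. (Z w)\<^sup>2 \<partial>coin))"
    by (subst coins.second_moment_sum[where b = "2 * \<rho>"]) (use Zb Z0 in auto)
  also have "\<dots> \<le> sqrt (real m * \<rho>\<^sup>2)"
    using Z2 by (intro real_sqrt_le_mono mult_left_mono) auto
  also have "\<dots> = sqrt (real m) * \<rho>" using \<rho> by (simp add: real_sqrt_mult)
  finally have Y: "(\<integral>\<omega>. \<bar>?Y \<omega>\<bar> \<partial>CS) \<le> sqrt (real m) * \<rho>" .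
  have "\<bar>est m f \<beta> \<omega> - a\<bar> = \<bar>?Y \<omega>\<bar> / real m" for \<omega>
  proof -
    have "est m f \<beta> \<omega> - a = ?Y \<omega> / real m"
      using m by (simp add: est_def Z_def sum_subtractf diff_divide_distrib)
    then show ?thesis by simp
  qed
  then have "(\<integral>\<omega>. \<bar>est m f \<beta> \<omega> - a\<bar> \<partial>CS) = (\<integral>\<omega>. \<bar>?Y \<omega>\<bar> \<partial>CS) / real m" by simp
  also have "\<dots> \<le> sqrt (real m) * \<rho> / real m" by (intro divide_right_mono Y) simp
  also have "\<dots> = \<rho> / sqrt (real m)"
    using m by (simp add: field_simps)
  finally show ?thesis by (simp add: a_def)
qed

definition err :: "('x \<Rightarrow> real) \<Rightarrow> real" where
  "err f = (\<integral>\<beta>. (u (bag_mean f \<beta>) - p \<beta>)\<^sup>2 \<partial>D)"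

text \<open>Monotonicity makes both factors on the left agree in sign, and the Lipschitz bound
  compares their sizes.\<close>

lemma mono_lipschitz_product: "(u a - u b)\<^sup>2 / L \<le> (u a - u b) * (a - b)"
proof -
  have "(u a - u b) * (a - b) = \<bar>u a - u b\<bar> * \<bar>a - b\<bar>"
    using monoD[OF mono_u, of a b] monoD[OF mono_u, of b a]
    by (cases "a \<le> b") (auto simp: algebra_simps)
  also have "\<bar>u a - u b\<bar> * \<bar>u a - u b\<bar> / L \<le> \<bar>u a - u b\<bar> * \<bar>a - b\<bar>"
    using mult_left_mono[OF u_lip[of a b], of "\<bar>u a - u b\<bar>"] L_pos by (simp add: field_simps)
  then have "(u a - u b)\<^sup>2 / L \<le> \<bar>u a - u b\<bar> * \<bar>a - b\<bar>" by (simp add: power2_eq_square)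
  finally show ?thesis .
qed

text \<open>Split \<open>f - g\<close> into \<open>f - c\<close> and \<open>c - g\<close>. The first
  part yields the negative squared error by \<open>mono_lipschitz_product\<close>; the second costs
  at most \<open>e\<close>, since the factor in front has absolute value at most 1.\<close>

lemma gradient_bag:
  assumes \<beta>: "\<beta> \<in> space (bag_space M)" and g: "\<And>x. x \<in> space M \<Longrightarrow> \<bar>c x - g x\<bar> \<le> e"
  shows "(p \<beta> - u (bag_mean f \<beta>)) * bag_mean (\<lambda>x. f x - g x) \<beta>
    \<le> e - (u (bag_mean f \<beta>) - p \<beta>)\<^sup>2 / L"
proof -
  let ?a = "bag_mean f \<beta>" and ?c = "bag_mean c \<beta>" and ?g = "bag_mean g \<beta>"
  have "\<bar>?c - ?g\<bar> \<le> e" unfolding bag_mean_diff[symmetric]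
    by (intro abs_bag_mean_le g bag_not_Nil[OF \<beta>] bag_subset[OF \<beta>])
  moreover have "\<bar>p \<beta> - u ?a\<bar> \<le> 1" using p_bounds[of \<beta>] u_bounds[of ?a] by linarith
  ultimately have "\<bar>p \<beta> - u ?a\<bar> * \<bar>?c - ?g\<bar> \<le> 1 * e" by (intro mult_mono) auto
  then have "(p \<beta> - u ?a) * (?c - ?g) \<le> e" by (simp add: abs_mult[symmetric])
  moreover have "(u ?a - p \<beta>)\<^sup>2 / L \<le> (u ?a - p \<beta>) * (?a - ?c)"
    unfolding p_def by (rule mono_lipschitz_product)
  ultimately show ?thesis by (simp add: bag_mean_diff algebra_simps)
qed

text \<open>The first-order term of \<open>sqdist_step_le\<close> without the factor
  \<open>2 * \<eta>\<close>, and with \<open>g\<close> in the place of \<open>v\<close>.\<close>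

definition grad :: "nat \<Rightarrow> ('x \<Rightarrow> real) \<Rightarrow> ('x \<Rightarrow> real) \<Rightarrow> ('x list \<times> bool) \<times> (nat \<Rightarrow> real) \<Rightarrow> real" where
  "grad m f g = (\<lambda>(z, \<omega>). (of_bool (snd z) - u (est m f (fst z) \<omega>)) *
     (f (draw_inst (fst z) (\<omega> m)) - g (draw_inst (fst z) (\<omega> m))))"

lemma grad_meas [measurable]:
  assumes f [measurable]: "f \<in> borel_measurable M" and [measurable]: "g \<in> borel_measurable M"
  shows "grad m f g \<in> borel_measurable (Q \<Otimes>\<^sub>M CS)"
proof -
  have [measurable]: "(\<lambda>q. est m f (fst (fst q)) (snd q)) \<in> borel_measurable (Q \<Otimes>\<^sub>M CS)"
    by (rule measurable_est[where M = M and F = "\<lambda>_. f"]) measurable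
  show ?thesis unfolding grad_def case_prod_beta by measurable
qed

text \<open>The residual of the label is at most 1 in absolute value, so the range is governed by
  the distance of \<open>f\<close> to \<open>g\<close> alone. In Hoeffding's lemma this turns into a
  variance proxy proportional to the squared distance.\<close>

lemma abs_grad_le:
  assumes "\<And>x. x \<in> space M \<Longrightarrow> \<bar>f x - g x\<bar> \<le> r" and "q \<in> space (Q \<Otimes>\<^sub>M CS)"
  shows "\<bar>grad m f g q\<bar> \<le> r"
proof -
  obtain \<beta> y \<omega> where q: "q = ((\<beta>, y), \<omega>)" by (metis surj_pair)
  have \<beta>: "\<beta> \<in> space (bag_space M)" using assms(2) by (simp add: q space_pair_measure space_Q)
  have "\<bar>of_bool y - u (est m f \<beta> \<omega>)\<bar> \<le> 1" using u_bounds by (cases y) simp_all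
  then have "\<bar>of_bool y - u (est m f \<beta> \<omega>)\<bar> * \<bar>f (draw_inst \<beta> (\<omega> m)) - g (draw_inst \<beta> (\<omega> m))\<bar> \<le> 1 * r"
    using \<beta> by (intro mult_mono assms draw_inst_mem) auto
  then show ?thesis by (simp add: grad_def q abs_mult)
qed

text \<open>Compare with the gradient \<open>G\<close> that uses the exact bag mean and averages
  over all instances. The link is Lipschitz, so replacing the estimate by the exact mean costs
  \<open>r * L\<close> times the mean estimation error; the rest is \<open>gradient_bag\<close>,
  averaged over labels and bags.\<close>

lemma expectation_grad_le:
  assumes f [measurable]: "f \<in> borel_measurable M" and g [measurable]: "g \<in> borel_measurable M"
    and r: "\<And>x. x \<in> space M \<Longrightarrow> \<bar>f x - g x\<bar> \<le> r"
    and \<rho>: "\<And>x. x \<in> space M \<Longrightarrow> \<bar>f x\<bar> \<le> \<rho>"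
    and gc: "\<And>x. x \<in> space M \<Longrightarrow> \<bar>c x - g x\<bar> \<le> e" and m: "0 < m"
  shows "integral\<^sup>L (Q \<Otimes>\<^sub>M CS) (grad m f g) \<le> e - err f / L + r * L * \<rho> / sqrt (real m)"
proof -
  interpret QC: pair_prob_space Q CS ..
  let ?d = "\<lambda>x. f x - g x" and ?\<tau> = "r * L * \<rho> / sqrt (real m)"
  define G where "G z = (of_bool (snd z) - u (bag_mean f (fst z))) * bag_mean ?d (fst z)" for z :: "'x list \<times> bool"
  \<comment> \<open>The distribution lives on nonempty bags, so an instance exists; it is what shows
    \<open>r\<close> to be nonnegative.\<close>
  obtain x0 where x0: "x0 \<in> space M"
    using D.not_empty by (auto simp: space_D space_bag_space neq_Nil_conv)
  have r0: "0 \<le> r" using r[OF x0] by linarith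
  note [measurable] = measurable_bag_mean[OF f] measurable_bag_mean[of ?d M]
  have [measurable]: "G \<in> borel_measurable Q" unfolding G_def by measurable
  have db: "\<bar>bag_mean ?d \<beta>\<bar> \<le> r" if "\<beta> \<in> space (bag_space M)" for \<beta>
    by (intro abs_bag_mean_le r bag_not_Nil[OF that] bag_subset[OF that])
  have Gb: "\<bar>G z\<bar> \<le> r" if "z \<in> space Q" for z
  proof -
    have "\<bar>of_bool (snd z) - u (bag_mean f (fst z))\<bar> \<le> 1" using u_bounds by (cases "snd z") simp_all
    then have "\<bar>of_bool (snd z) - u (bag_mean f (fst z))\<bar> * \<bar>bag_mean ?d (fst z)\<bar> \<le> 1 * r"
      using that by (intro mult_mono db) (auto simp: space_Q)
    then show ?thesis by (simp add: G_def abs_mult)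
  qed
  have iG: "integrable Q G" by (rule Q.integrable_const_bound[where B = r]) (use Gb in auto)
  have i: "integrable (Q \<Otimes>\<^sub>M CS) (grad m f g)"
    by (rule QC.integrable_const_bound[where B = r]) (use abs_grad_le[OF r] in auto)
  have inner: "(\<integral>\<omega>. grad m f g (z, \<omega>) \<partial>CS) \<le> G z + ?\<tau>" if z: "z \<in> space Q" for z
  proof -
    obtain \<beta> y where zz: "z = (\<beta>, y)" by (cases z)
    have \<beta>: "\<beta> \<in> space (bag_space M)" using z by (simp add: zz space_Q)
    note [measurable] = draw_inst_meas_coin[OF \<beta>]
    let ?a = "bag_mean f \<beta>"
    have ab: "\<bar>?a\<bar> \<le> \<rho>"
      by (intro abs_bag_mean_le \<rho> bag_not_Nil[OF \<beta>] bag_subset[OF \<beta>])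
    have eb: "\<bar>est m f \<beta> \<omega>\<bar> \<le> \<rho>" for \<omega>
    proof -
      have "\<bar>\<Sum>j<m. f (draw_inst \<beta> (\<omega> j))\<bar> \<le> (\<Sum>j<m. \<bar>f (draw_inst \<beta> (\<omega> j))\<bar>)" by (rule sum_abs)
      also have "\<dots> \<le> (\<Sum>j<m. \<rho>)" by (intro sum_mono \<rho> draw_inst_mem \<beta>)
      finally show ?thesis using m by (simp add: est_def field_simps)
    qed
    have [measurable]: "est m f \<beta> \<in> borel_measurable CS" unfolding est_def by measurable
    let ?x = "\<lambda>\<omega> :: nat \<Rightarrow> real. draw_inst \<beta> (\<omega> m)"
    have dm: "(\<integral>\<omega>. ?d (?x \<omega>) \<partial>CS) = bag_mean ?d \<beta>"
    proof -
      have "(\<integral>\<omega>. ?d (?x \<omega>) \<partial>CS) = (\<integral>w. ?d (draw_inst \<beta> w) \<partial>distr CS coin (\<lambda>\<omega>. \<omega> m))"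
        by (subst integral_distr) auto
      also have "distr CS coin (\<lambda>\<omega>. \<omega> m) = coin" using coins.PiM_component[of m] by simp
      also have "(\<integral>w. ?d (draw_inst \<beta> w) \<partial>coin) = bag_mean ?d \<beta>"
        by (rule integral_draw_inst[OF bag_not_Nil[OF \<beta>]])
      finally show ?thesis .
    qed
    have dbx: "\<bar>?d (?x \<omega>)\<bar> \<le> r" for \<omega> by (intro r draw_inst_mem \<beta>)
    have i1: "integrable CS (\<lambda>\<omega>. ?d (?x \<omega>))"
      by (rule coins.P.integrable_const_bound[where B = r]) (use dbx in auto)
    have i2: "integrable CS (\<lambda>\<omega>. \<bar>est m f \<beta> \<omega> - ?a\<bar>)"
    proof (rule coins.P.integrable_const_bound[where B = "2 * \<rho>"])
      show "AE \<omega> in CS. norm \<bar>est m f \<beta> \<omega> - ?a\<bar> \<le> 2 * \<rho>"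
        using eb ab by (intro AE_I2) (smt (verit) real_norm_def)
    qed measurable
    have i3: "integrable CS (\<lambda>\<omega>. grad m f g (z, \<omega>))"
    proof (rule coins.P.integrable_const_bound[where B = r])
      show "AE \<omega> in CS. norm (grad m f g (z, \<omega>)) \<le> r"
        using abs_grad_le[OF r] z by (intro AE_I2) (auto simp: space_pair_measure)
      show "(\<lambda>\<omega>. grad m f g (z, \<omega>)) \<in> borel_measurable CS"
        using measurable_compose[OF measurable_Pair1'[OF z] grad_meas[OF f g]] .
    qed
    have "(\<integral>\<omega>. grad m f g (z, \<omega>) \<partial>CS) \<le>
        (\<integral>\<omega>. (of_bool y - u ?a) * ?d (?x \<omega>) + r * L * \<bar>est m f \<beta> \<omega> - ?a\<bar> \<partial>CS)"
    proof (rule integral_mono[OF i3])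
      show "integrable CS (\<lambda>\<omega>. (of_bool y - u ?a) * ?d (?x \<omega>) + r * L * \<bar>est m f \<beta> \<omega> - ?a\<bar>)"
        by (intro Bochner_Integration.integrable_add integrable_mult_right i1 i2)
      fix \<omega>
      \<comment> \<open>The second summand is the whole effect of estimating the bag mean.\<close>
      have "grad m f g (z, \<omega>) = (of_bool y - u ?a) * ?d (?x \<omega>) + (u ?a - u (est m f \<beta> \<omega>)) * ?d (?x \<omega>)"
        by (simp add: grad_def zz algebra_simps)
      moreover have "(u ?a - u (est m f \<beta> \<omega>)) * ?d (?x \<omega>) \<le> (L * \<bar>?a - est m f \<beta> \<omega>\<bar>) * r"
      proof -
        have "\<bar>u ?a - u (est m f \<beta> \<omega>)\<bar> * \<bar>?d (?x \<omega>)\<bar> \<le> (L * \<bar>?a - est m f \<beta> \<omega>\<bar>) * r"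
          using L_pos by (intro mult_mono u_lip dbx) auto
        then show ?thesis by (simp add: abs_mult[symmetric])
      qed
      ultimately show "grad m f g (z, \<omega>) \<le> (of_bool y - u ?a) * ?d (?x \<omega>) + r * L * \<bar>est m f \<beta> \<omega> - ?a\<bar>"
        by (simp add: abs_minus_commute mult_ac)
    qed
    also have "\<dots> = (of_bool y - u ?a) * bag_mean ?d \<beta> + r * L * (\<integral>\<omega>. \<bar>est m f \<beta> \<omega> - ?a\<bar> \<partial>CS)"
      using i1 i2 dm by simp
    also have "\<dots> \<le> (of_bool y - u ?a) * bag_mean ?d \<beta> + r * L * (\<rho> / sqrt (real m))"
      using r0 L_pos by (intro add_left_mono mult_left_mono est_error[OF f \<rho> \<beta> m]) auto
    finally show ?thesis by (simp add: G_def zz)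
  qed
  have "integral\<^sup>L (Q \<Otimes>\<^sub>M CS) (grad m f g) = (\<integral>z. \<integral>\<omega>. grad m f g (z, \<omega>) \<partial>CS \<partial>Q)"
    using QC.integral_fst'[OF i] by simp
  also have "\<dots> \<le> (\<integral>z. G z + ?\<tau> \<partial>Q)"
    using QC.integrable_fst'[OF i] iG inner by (intro integral_mono) auto
  also have "\<dots> = integral\<^sup>L Q G + ?\<tau>"
    using iG Q.prob_space by simp
  also have "integral\<^sup>L Q G = (\<integral>\<beta>. p \<beta> * G (\<beta>, True) + (1 - p \<beta>) * G (\<beta>, False) \<partial>D)"
    by (rule integral_Q[where b = r]) (use Gb in auto)
  also have "\<dots> = (\<integral>\<beta>. (p \<beta> - u (bag_mean f \<beta>)) * bag_mean ?d \<beta> \<partial>D)"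
    by (intro Bochner_Integration.integral_cong refl) (simp add: G_def algebra_simps)
  also have "\<dots> \<le> (\<integral>\<beta>. e - (u (bag_mean f \<beta>) - p \<beta>)\<^sup>2 / L \<partial>D)"
  proof (rule integral_mono)
    have s: "\<bar>p \<beta> - u (bag_mean f \<beta>)\<bar> \<le> 1" for \<beta> using p_bounds[of \<beta>] u_bounds[of "bag_mean f \<beta>"] by linarith
    show "integrable D (\<lambda>\<beta>. (p \<beta> - u (bag_mean f \<beta>)) * bag_mean ?d \<beta>)"
    proof (rule D.integrable_const_bound[where B = r])
      show "AE \<beta> in D. norm ((p \<beta> - u (bag_mean f \<beta>)) * bag_mean ?d \<beta>) \<le> r"
        using mult_mono[OF s db] by (intro AE_I2) (auto simp: space_D abs_mult)
    qed measurable
    have "(u (bag_mean f \<beta>) - p \<beta>)\<^sup>2 \<le> 1" for \<beta>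
      using power_le_one[OF _ s[of \<beta>], of 2] by (simp add: power2_commute)
    then have "integrable D (\<lambda>\<beta>. (u (bag_mean f \<beta>) - p \<beta>)\<^sup>2)"
      by (intro D.integrable_const_bound[where B = 1]) auto
    then show "integrable D (\<lambda>\<beta>. e - (u (bag_mean f \<beta>) - p \<beta>)\<^sup>2 / L)" by simp
    show "(p \<beta> - u (bag_mean f \<beta>)) * bag_mean ?d \<beta> \<le> e - (u (bag_mean f \<beta>) - p \<beta>)\<^sup>2 / L"
      if "\<beta> \<in> space D" for \<beta>
      using gradient_bag[of \<beta> g f] that gc by (simp add: space_D)
  qed
  also have "\<dots> = e - err f / L"
  proof -
    have s: "\<bar>u (bag_mean f \<beta>) - p \<beta>\<bar> \<le> 1" for \<beta> using p_bounds[of \<beta>] u_bounds[of "bag_mean f \<beta>"] by linarith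
    have "(u (bag_mean f \<beta>) - p \<beta>)\<^sup>2 \<le> 1" for \<beta>
      using power_le_one[OF _ s[of \<beta>], of 2] by simp
    then have "integrable D (\<lambda>\<beta>. (u (bag_mean f \<beta>) - p \<beta>)\<^sup>2)"
      by (intro D.integrable_const_bound[where B = 1]) auto
    then show ?thesis using D.prob_space by (simp add: err_def)
  qed
  finally show ?thesis by simp
qed

end

lemma update_cong:
  "(\<And>j. j \<le> m \<Longrightarrow> W j = W' j) \<Longrightarrow> update X K u m \<eta> f z W = update X K u m \<eta> f z W'"
  unfolding update_def est_def by simp

text \<open>The initial function is a parameter because the analysis removes the first round, not
  the last: what follows that round is the same process started from the updated function. Round
  \<open>t\<close> reads the block of \<open>Suc m\<close> coins that begins at
  \<open>t * Suc m\<close>.\<close>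

primrec iterate :: "'x set \<Rightarrow> ('x \<Rightarrow> 'x \<Rightarrow> real) \<Rightarrow> (real \<Rightarrow> real) \<Rightarrow> nat \<Rightarrow> real \<Rightarrow>
    ('x \<Rightarrow> real) \<Rightarrow> (nat \<Rightarrow> 'x list \<times> bool) \<Rightarrow> (nat \<Rightarrow> real) \<Rightarrow> nat \<Rightarrow> 'x \<Rightarrow> real" where
  "iterate X K u m \<eta> f S W 0 = f"
| "iterate X K u m \<eta> f S W (Suc t) =
     update X K u m \<eta> (iterate X K u m \<eta> f S W t) (S t) (\<lambda>j. W (t * Suc m + j))"

lemma iterate_Suc_shift:
  "iterate X K u m \<eta> f S W (Suc t) =
   iterate X K u m \<eta> (update X K u m \<eta> f (S 0) W) (\<lambda>i. S (Suc i)) (\<lambda>i. W (i + Suc m)) t"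
  by (induction t) (simp_all add: add_ac)

text \<open>The first sample and the first \<open>Suc m\<close> coins affect only the first update;
  \<open>comb_seq\<close> splices that block of coins in front of a fresh stream.\<close>

lemma iterate_peel:
  "iterate X K u m \<eta> f (case_nat z S) (comb_seq (Suc m) \<omega> W) (Suc t) =
   iterate X K u m \<eta> (update X K u m \<eta> f z \<omega>) S W t"
proof -
  have "update X K u m \<eta> f z (comb_seq (Suc m) \<omega> W) = update X K u m \<eta> f z \<omega>"
    by (rule update_cong) (simp add: comb_seq_less)
  moreover have "(\<lambda>i. comb_seq (Suc m) \<omega> W (i + Suc m)) = W"
    by (rule ext) (rule comb_seq_add)
  ultimately show ?thesis unfolding iterate_Suc_shift by simp
qed

section \<open>Exponential moments of the squared distance\<close>

context mil
begin

lemma update_mem: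
  assumes "f \<in> H" "fst z \<in> space (bag_space M)"
  shows "update (space M) K u m \<eta> f z W \<in> H"
  unfolding update_def by (intro comb_mem assms feat_mem draw_inst_mem)

lemma abs_label_le: "\<bar>of_bool y - u a\<bar> \<le> 1"
  using u_bounds by (cases y) simp_all

lemma label_square_le: "(of_bool y - u a)\<^sup>2 \<le> 1"
  using power_le_one[OF abs_ge_zero abs_label_le[of y a], of 2] by simp

text \<open>Residual and feature vector both have size at most 1, so the norm grows by at most
  \<open>\<eta>\<close> per round. This is the a priori bound on the iterates.\<close>

lemma ip_norm_update_le:
  assumes "f \<in> H" "fst z \<in> space (bag_space M)" "0 \<le> \<eta>"
  shows "ip_norm ip (update (space M) K u m \<eta> f z W) \<le> ip_norm ip f + \<eta>"
proof -
  let ?a = "\<eta> * (of_bool (snd z) - u (est m f (fst z) W))"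
  have "\<bar>?a\<bar> \<le> \<eta> * 1" unfolding abs_mult using assms(3) by (intro mult_mono abs_label_le) auto
  then show ?thesis unfolding update_def
    using ip_norm_step_le[OF assms(1) draw_inst_mem[OF assms(2)], of ?a "W m"] by linarith
qed

text \<open>For \<open>r \<ge> 0\<close> this is the projection of \<open>c x\<close> onto the
  interval of radius \<open>r\<close> around \<open>f x\<close>. If the interval contains
  \<open>v x\<close>, the projection is no farther from \<open>c x\<close>, and no farther from
  \<open>v x\<close>, than these two are from each other.\<close>

definition clip :: "real \<Rightarrow> ('x \<Rightarrow> real) \<Rightarrow> 'x \<Rightarrow> real" where
  "clip r f x = max (f x - r) (min (f x + r) (c x))"

lemma clip_meas [measurable]:
  assumes [measurable]: "f \<in> borel_measurable M"
  shows "clip r f \<in> borel_measurable M"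
  unfolding clip_def by measurable

text \<open>The function \<open>v\<close> is not assumed to be measurable; the measurable function \<open>clip\<close> of \<open>c\<close>
  takes its place, and is as close to \<open>f\<close> as \<open>v\<close> is.\<close>

lemma clip_bounds:
  assumes "f \<in> H" "x \<in> space M"
  shows "\<bar>f x - clip (sqrt (sqdist f v)) f x\<bar> \<le> sqrt (sqdist f v)"
    "\<bar>c x - clip (sqrt (sqdist f v)) f x\<bar> \<le> e" "\<bar>clip (sqrt (sqdist f v)) f x - v x\<bar> \<le> e"
  using abs_diff_le_sqdist[OF assms(1) v_mem assms(2)] approx[OF assms(2)]
    sqdist_nonneg[OF assms(1) v_mem]
  unfolding clip_def by (auto simp: max_def min_def abs_le_iff)

text \<open>Passing from \<open>v\<close> to its measurable substitute in the cross term costs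
  \<open>2 * \<eta> * e\<close>. The same amount arises again in the expectation of
  \<open>grad\<close>, whence the \<open>4 * \<eta> * e\<close> further on.\<close>

lemma sqdist_update_le:
  assumes f: "f \<in> H" and \<beta>: "fst z \<in> space (bag_space M)" and \<eta>: "0 \<le> \<eta>"
  shows "sqdist (update (space M) K u m \<eta> f z W) v \<le>
    sqdist f v + 2 * \<eta> * grad m f (clip (sqrt (sqdist f v)) f) (z, W) + 2 * \<eta> * e + \<eta>\<^sup>2"
proof -
  let ?b = "of_bool (snd z) - u (est m f (fst z) W)"
  let ?x = "draw_inst (fst z) (W m)" and ?g = "clip (sqrt (sqdist f v)) f"
  have x: "?x \<in> space M" by (intro draw_inst_mem \<beta>)
  have "sqdist (update (space M) K u m \<eta> f z W) v \<le>
      sqdist f v + 2 * (\<eta> * ?b) * (f ?x - v ?x) + (\<eta> * ?b)\<^sup>2"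
    unfolding update_def by (rule sqdist_step_le[OF f v_mem x])
  also have "(\<eta> * ?b)\<^sup>2 \<le> \<eta>\<^sup>2 * 1"
    unfolding power_mult_distrib by (intro mult_left_mono label_square_le) simp
  also have "2 * (\<eta> * ?b) * (f ?x - v ?x) =
      2 * \<eta> * (?b * (f ?x - ?g ?x)) + 2 * \<eta> * (?b * (?g ?x - v ?x))"
    by (simp add: algebra_simps)
  also have "?b * (?g ?x - v ?x) \<le> 1 * e"
  proof -
    have "\<bar>?b\<bar> * \<bar>?g ?x - v ?x\<bar> \<le> 1 * e"
      by (intro mult_mono abs_label_le clip_bounds(3)[OF f x]) auto
    then show ?thesis using abs_ge_self[of "?b * (?g ?x - v ?x)"] by (simp only: abs_mult)
  qed
  finally show ?thesis using \<eta> by (simp add: grad_def mult_left_mono)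
qed

text \<open>Conditionally on the past, the only randomness in the exponent is
  \<open>2 * \<eta> * l\<close> times a variable with values in \<open>{- r..r}\<close>, to which
  Hoeffding's lemma applies; its mean is bounded by \<open>expectation_grad_le\<close>. The number
  \<open>a\<close> stands for what earlier steps have put into the exponent.\<close>

lemma potential_step:
  assumes f: "f \<in> H" and fm [measurable]: "f \<in> borel_measurable M"
    and \<rho>: "ip_norm ip f \<le> \<rho>" and B: "ip_norm ip v \<le> B"
    and \<eta>: "0 < \<eta>" and l: "0 < l" and m: "0 < m"
  shows "(\<integral>\<^sup>+q. ennreal (exp (a + l * sqdist (update (space M) K u m \<eta> f (fst q) (snd q)) v)) \<partial>(Q \<Otimes>\<^sub>M CS))
    \<le> ennreal (exp (a + l * sqdist f v + 2 * \<eta>\<^sup>2 * l\<^sup>2 * sqdist f v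
        + l * (4 * \<eta> * e + \<eta>\<^sup>2 + 2 * \<eta> * ((B + \<rho>) * L * \<rho> / sqrt (real m)))
        - 2 * \<eta> * l * err f / L))"
proof -
  interpret QC: pair_prob_space Q CS ..
  define r where "r = sqrt (sqdist f v)"
  define g where "g = clip r f"
  have [measurable]: "g \<in> borel_measurable M" unfolding g_def by measurable
  have r2: "r\<^sup>2 = sqdist f v" unfolding r_def by (simp add: sqdist_nonneg f v_mem)
  have r0: "0 \<le> r" unfolding r_def by (simp add: sqdist_nonneg f v_mem)
  have rB: "r \<le> B + \<rho>" unfolding r_def using sqrt_sqdist_le[OF f v_mem] B \<rho> by linarith
  have \<rho>0: "0 \<le> \<rho>" using \<rho> ip_norm_nonneg[OF f] by linarith
  note gb = clip_bounds[OF f, folded r_def, folded g_def]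
  let ?X = "grad m f g" and ?t = "(B + \<rho>) * L * \<rho> / sqrt (real m)"
  define \<mu> where "\<mu> = integral\<^sup>L (Q \<Otimes>\<^sub>M CS) ?X"
  have "\<mu> \<le> e - err f / L + r * L * \<rho> / sqrt (real m)"
    unfolding \<mu>_def by (rule expectation_grad_le) (use gb m order_trans[OF abs_eval_le[OF f] \<rho>] in auto)
  \<comment> \<open>The crude bound on \<open>r\<close> is confined to the estimation error, which
    \<open>m\<close> can make small; the variance term keeps the exact \<open>r\<close>.\<close>
  also have "r * L * \<rho> / sqrt (real m) \<le> ?t"
    using rB L_pos \<rho>0 by (intro divide_right_mono mult_right_mono) auto
  finally have \<mu>: "\<mu> \<le> e - err f / L + ?t" by simp
  interpret I: interval_bounded_random_variable "Q \<Otimes>\<^sub>M CS" ?X "- r" r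
  proof (unfold_locales)
    show "AE x in Q \<Otimes>\<^sub>M CS. grad m f g x \<in> {- r..r}"
      using abs_grad_le[OF gb(1)] by (intro AE_I2) (auto simp: abs_le_iff minus_le_iff)
  qed measurable
  define A where "A = a + l * (sqdist f v + 2 * \<eta> * e + \<eta>\<^sup>2) + 2 * \<eta> * l * \<mu>"
  have "(\<integral>\<^sup>+q. ennreal (exp (a + l * sqdist (update (space M) K u m \<eta> f (fst q) (snd q)) v)) \<partial>(Q \<Otimes>\<^sub>M CS))
      \<le> (\<integral>\<^sup>+q. ennreal (exp A) * ennreal (exp (2 * \<eta> * l * (?X q - \<mu>))) \<partial>(Q \<Otimes>\<^sub>M CS))"
  proof (rule nn_integral_mono)
    fix q assume "q \<in> space (Q \<Otimes>\<^sub>M CS)"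
    then have "fst (fst q) \<in> space (bag_space M)" by (auto simp: space_pair_measure space_Q)
    from sqdist_update_le[OF f this, of \<eta> m "snd q"] \<eta>
    have "sqdist (update (space M) K u m \<eta> f (fst q) (snd q)) v \<le>
        sqdist f v + 2 * \<eta> * ?X q + 2 * \<eta> * e + \<eta>\<^sup>2"
      by (simp add: g_def r_def)
    then have "a + l * sqdist (update (space M) K u m \<eta> f (fst q) (snd q)) v \<le>
        a + l * (sqdist f v + 2 * \<eta> * ?X q + 2 * \<eta> * e + \<eta>\<^sup>2)"
      using l by (intro add_left_mono mult_left_mono) auto
    also have "\<dots> = A + 2 * \<eta> * l * (?X q - \<mu>)" by (simp add: A_def algebra_simps)
    finally show "ennreal (exp (a + l * sqdist (update (space M) K u m \<eta> f (fst q) (snd q)) v))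
      \<le> ennreal (exp A) * ennreal (exp (2 * \<eta> * l * (?X q - \<mu>)))"
      by (simp add: ennreal_mult[symmetric] exp_add[symmetric] ennreal_leI)
  qed
  also have "\<dots> = ennreal (exp A) * (\<integral>\<^sup>+q. ennreal (exp (2 * \<eta> * l * (?X q - \<mu>))) \<partial>(Q \<Otimes>\<^sub>M CS))"
    by (rule nn_integral_cmult) measurable
  \<comment> \<open>An interval of length \<open>2 * r\<close> gives the exponent \<open>(2 * \<eta>
    * l)^2 * (2 * r)^2 / 8 = 2 * \<eta>^2 * l^2 * r^2\<close>.\<close>
  also have "\<dots> \<le> ennreal (exp A) * ennreal (exp ((2 * \<eta> * l)\<^sup>2 * (r - - r)\<^sup>2 / 8))"
    unfolding \<mu>_def using \<eta> l by (intro mult_left_mono I.Hoeffdings_lemma_nn_integral) auto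
  also have "\<dots> = ennreal (exp (A + 2 * \<eta>\<^sup>2 * l\<^sup>2 * sqdist f v))"
    unfolding r2[symmetric]
    by (simp add: ennreal_mult[symmetric] exp_add[symmetric] power2_eq_square algebra_simps)
  also have "\<dots> \<le> ennreal (exp (a + l * sqdist f v + 2 * \<eta>\<^sup>2 * l\<^sup>2 * sqdist f v
        + l * (4 * \<eta> * e + \<eta>\<^sup>2 + 2 * \<eta> * ?t) - 2 * \<eta> * l * err f / L))"
  proof (intro ennreal_leI exp_le_cancel_iff[THEN iffD2])
    have "2 * \<eta> * l * \<mu> \<le> 2 * \<eta> * l * (e - err f / L + ?t)"
      using \<mu> \<eta> l by (intro mult_left_mono) auto
    then show "A + 2 * \<eta>\<^sup>2 * l\<^sup>2 * sqdist f v \<le> a + l * sqdist f v + 2 * \<eta>\<^sup>2 * l\<^sup>2 * sqdist f v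
        + l * (4 * \<eta> * e + \<eta>\<^sup>2 + 2 * \<eta> * ?t) - 2 * \<eta> * l * err f / L"
      by (simp add: A_def algebra_simps)
  qed
  finally show ?thesis .
qed

sublocale samples: sequence_space Q
  by (intro sequence_space.intro product_prob_spaceI prob_space_Q)

abbreviation QS where "QS \<equiv> (\<Pi>\<^sub>M i\<in>(UNIV :: nat set). Q)"

lemma run_space_eq: "run_space u c D = QS \<Otimes>\<^sub>M CS"
  by (simp add: run_space_def)

sublocale run: pair_prob_space QS CS ..

text \<open>The law of a run is that of its first sample and first \<open>k\<close> coins, followed
  by an independent fresh run. Nonnegativity allows the exchange of integrals without integrability
  conditions.\<close>

lemma nn_integral_peel:
  assumes F [measurable]: "F \<in> borel_measurable (QS \<Otimes>\<^sub>M CS)"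
  shows "integral\<^sup>N (QS \<Otimes>\<^sub>M CS) F = (\<integral>\<^sup>+q. \<integral>\<^sup>+s. F (case_nat (fst q) (fst s), comb_seq k (snd q) (snd s))
    \<partial>(QS \<Otimes>\<^sub>M CS) \<partial>(Q \<Otimes>\<^sub>M CS))"
proof -
  interpret SC: pair_sigma_finite CS QS ..
  have c: "integral\<^sup>N CS G = (\<integral>\<^sup>+\<omega>. \<integral>\<^sup>+W. G (comb_seq k \<omega> W) \<partial>CS \<partial>CS)"
    if [measurable]: "G \<in> borel_measurable CS" for G
  proof -
    have "integral\<^sup>N CS G = integral\<^sup>N (distr (CS \<Otimes>\<^sub>M CS) CS (\<lambda>(\<omega>, W). comb_seq k \<omega> W)) G"
      by (simp only: coins.PiM_comb_seq)
    also have "\<dots> = (\<integral>\<^sup>+z. G (comb_seq k (fst z) (snd z)) \<partial>(CS \<Otimes>\<^sub>M CS))"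
      by (subst nn_integral_distr) (auto simp: case_prod_beta)
    also have "\<dots> = (\<integral>\<^sup>+\<omega>. \<integral>\<^sup>+W. G (comb_seq k \<omega> W) \<partial>CS \<partial>CS)"
      by (subst coins.P.nn_integral_fst[symmetric]) auto
    finally show ?thesis .
  qed
  have s: "integral\<^sup>N QS G = (\<integral>\<^sup>+z. \<integral>\<^sup>+S. G (case_nat z S) \<partial>QS \<partial>Q)"
    if [measurable]: "G \<in> borel_measurable QS" for G
  proof -
    have "integral\<^sup>N QS G = integral\<^sup>N (distr (Q \<Otimes>\<^sub>M QS) QS (\<lambda>(z, S). case_nat z S)) G"
      by (simp only: samples.PiM_iter)
    also have "\<dots> = (\<integral>\<^sup>+z. G (case_nat (fst z) (snd z)) \<partial>(Q \<Otimes>\<^sub>M QS))"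
      by (subst nn_integral_distr) (auto simp: case_prod_beta)
    also have "\<dots> = (\<integral>\<^sup>+z. \<integral>\<^sup>+S. G (case_nat z S) \<partial>QS \<partial>Q)"
      by (subst samples.P.nn_integral_fst[symmetric]) auto
    finally show ?thesis .
  qed
  have "integral\<^sup>N (QS \<Otimes>\<^sub>M CS) F = (\<integral>\<^sup>+S. \<integral>\<^sup>+W. F (S, W) \<partial>CS \<partial>QS)"
    by (subst coins.P.nn_integral_fst[symmetric]) auto
  also have "\<dots> = (\<integral>\<^sup>+S. \<integral>\<^sup>+\<omega>. \<integral>\<^sup>+W. F (S, comb_seq k \<omega> W) \<partial>CS \<partial>CS \<partial>QS)"
    by (intro nn_integral_cong c) measurable
  also have "\<dots> = (\<integral>\<^sup>+z. \<integral>\<^sup>+S. \<integral>\<^sup>+\<omega>. \<integral>\<^sup>+W. F (case_nat z S, comb_seq k \<omega> W) \<partial>CS \<partial>CS \<partial>QS \<partial>Q)"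
    by (rule s) measurable
  also have "\<dots> = (\<integral>\<^sup>+z. \<integral>\<^sup>+\<omega>. \<integral>\<^sup>+S. \<integral>\<^sup>+W. F (case_nat z S, comb_seq k \<omega> W) \<partial>CS \<partial>QS \<partial>CS \<partial>Q)"
    by (intro nn_integral_cong SC.Fubini') measurable
  also have "\<dots> = (\<integral>\<^sup>+z. \<integral>\<^sup>+\<omega>. \<integral>\<^sup>+s. F (case_nat z (fst s), comb_seq k \<omega> (snd s)) \<partial>(QS \<Otimes>\<^sub>M CS) \<partial>CS \<partial>Q)"
    by (intro nn_integral_cong) (subst coins.P.nn_integral_fst[symmetric], auto)
  also have "\<dots> = (\<integral>\<^sup>+q. \<integral>\<^sup>+s. F (case_nat (fst q) (fst s), comb_seq k (snd q) (snd s))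
    \<partial>(QS \<Otimes>\<^sub>M CS) \<partial>(Q \<Otimes>\<^sub>M CS))"
    by (subst coins.P.nn_integral_fst[symmetric]) auto
  finally show ?thesis .
qed

lemma err_meas:
  assumes F: "(\<lambda>(a, x). F a x) \<in> borel_measurable (A \<Otimes>\<^sub>M M)"
  shows "(\<lambda>a. err (F a)) \<in> borel_measurable A"
proof -
  have [measurable]: "(\<lambda>q. bag_mean (F (fst q)) (snd q)) \<in> borel_measurable (A \<Otimes>\<^sub>M bag_space M)"
    using measurable_bag_mean_pair[OF F] by (simp add: case_prod_beta)
  have "(\<lambda>(a, \<beta>). (u (bag_mean (F a) \<beta>) - p \<beta>)\<^sup>2) \<in> borel_measurable (A \<Otimes>\<^sub>M D)"
    unfolding case_prod_beta by measurable
  then show ?thesis unfolding err_def by (rule D.borel_measurable_lebesgue_integral)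
qed

lemma iterate_meas:
  assumes f [measurable]: "f \<in> borel_measurable M"
  shows "(\<lambda>(a, x). iterate (space M) K u m \<eta> f (fst a) (snd a) t x) \<in> borel_measurable ((QS \<Otimes>\<^sub>M CS) \<Otimes>\<^sub>M M)"
proof (induction t)
  case 0
  then show ?case by simp
next
  case (Suc t)
  show ?case unfolding iterate.simps
    by (rule measurable_update[OF K_meas u_meas Suc.IH]) measurable
qed

lemma iterate_err_meas [measurable]:
  assumes f [measurable]: "f \<in> borel_measurable M"
  shows "(\<lambda>a. err (iterate (space M) K u m \<eta> f (fst a) (snd a) t)) \<in> borel_measurable (QS \<Otimes>\<^sub>M CS)"
  by (rule err_meas[OF iterate_meas[OF f]])

lemma err_nonneg: "f \<in> borel_measurable M \<Longrightarrow> 0 \<le> err f"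
  unfolding err_def by (intro Bochner_Integration.integral_nonneg) simp

text \<open>The exponential potential absorbs one sample at a time: its rate \<open>\<Lambda> (1 + j / N)\<close>, with
  \<open>j\<close> samples to go, increases just enough to pay for the variance term of Hoeffding's lemma.\<close>

lemma exponential_regret:
  assumes B: "ip_norm ip v \<le> B" and \<eta>: "0 < \<eta>" and m: "0 < m" and N: "0 < N" and jN: "j \<le> N"
    and e0: "0 \<le> e"
  defines "\<Lambda> \<equiv> 1 / (8 * real N * \<eta>\<^sup>2)" and "\<rho> \<equiv> \<eta> * (real N - 1)"
  defines "b \<equiv> 4 * \<eta> * e + \<eta>\<^sup>2 + 2 * \<eta> * ((B + \<rho>) * L * \<rho> / sqrt (real m))"
  assumes "f \<in> H" "f \<in> borel_measurable M" "ip_norm ip f \<le> \<eta> * (real N - real j)"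
  shows "(\<integral>\<^sup>+a. ennreal (exp (2 * \<Lambda> * \<eta> / L *
      (\<Sum>i<j. err (iterate (space M) K u m \<eta> f (fst a) (snd a) i)))) \<partial>(QS \<Otimes>\<^sub>M CS))
    \<le> ennreal (exp (\<Lambda> * (1 + real j / real N) * sqdist f v + real j * (2 * \<Lambda> * b)))"
  using jN assms(10-12)
proof (induction j arbitrary: f)
  case 0
  have "0 \<le> \<Lambda> * sqdist f v" unfolding \<Lambda>_def using sqdist_nonneg[OF 0(2) v_mem] by simp
  then have "ennreal 1 \<le> ennreal (exp (\<Lambda> * sqdist f v))" by (intro ennreal_leI) simp
  then show ?case by (simp add: run.emeasure_space_1)
next
  case (Suc j)
  note [measurable] = Suc.prems(3)
  have jN: "real j + 1 \<le> real N" using Suc.prems(1) by linarith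
  define l where "l = \<Lambda> * (1 + real j / real N)"
  define k where "k = 2 * \<Lambda> * \<eta> / L"
  have \<Lambda>: "0 < \<Lambda>" unfolding \<Lambda>_def using N \<eta> by simp
  have l1: "\<Lambda> \<le> l" and l0: "0 < l" using \<Lambda> by (auto simp: l_def algebra_simps add_pos_nonneg)
  have "real j / real N \<le> 1" using jN N by simp
  then have "\<Lambda> * (1 + real j / real N) \<le> \<Lambda> * 2" using \<Lambda> by (intro mult_left_mono) auto
  then have l2: "l \<le> 2 * \<Lambda>" by (simp add: l_def)
  have \<rho>0: "0 \<le> \<rho>" unfolding \<rho>_def using \<eta> N by (intro mult_nonneg_nonneg) auto
  have B0: "0 \<le> B" using B ip_norm_nonneg[OF v_mem] by linarith
  have b0: "0 \<le> b" unfolding b_def using \<eta> e0 \<rho>0 B0 L_pos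
    by (intro add_nonneg_nonneg mult_nonneg_nonneg divide_nonneg_nonneg) auto
  have "\<eta> * (real N - real (Suc j)) \<le> \<rho>" unfolding \<rho>_def using \<eta> by (intro mult_left_mono) auto
  then have \<rho>: "ip_norm ip f \<le> \<rho>" using Suc.prems by linarith
  let ?U = "\<lambda>q. update (space M) K u m \<eta> f (fst q) (snd q)"
  let ?it = "\<lambda>f a. iterate (space M) K u m \<eta> f (fst a) (snd a)"
  have "(\<integral>\<^sup>+a. ennreal (exp (k * (\<Sum>i<Suc j. err (?it f a i)))) \<partial>(QS \<Otimes>\<^sub>M CS))
      = (\<integral>\<^sup>+q. \<integral>\<^sup>+s. ennreal (exp (k * (\<Sum>i<Suc j. err (iterate (space M) K u m \<eta> f
          (case_nat (fst q) (fst s)) (comb_seq (Suc m) (snd q) (snd s)) i))))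
        \<partial>(QS \<Otimes>\<^sub>M CS) \<partial>(Q \<Otimes>\<^sub>M CS))"
    by (subst nn_integral_peel[where k = "Suc m"]) measurable
  also have "\<dots> = (\<integral>\<^sup>+q. \<integral>\<^sup>+s. ennreal (exp (k * (err f + (\<Sum>i<j. err (?it (?U q) s i)))))
        \<partial>(QS \<Otimes>\<^sub>M CS) \<partial>(Q \<Otimes>\<^sub>M CS))"
    by (simp only: sum.lessThan_Suc_shift iterate_peel iterate.simps(1))
  also have "\<dots> \<le> (\<integral>\<^sup>+q. ennreal (exp (k * err f)) *
      ennreal (exp (l * sqdist (?U q) v + real j * (2 * \<Lambda> * b))) \<partial>(Q \<Otimes>\<^sub>M CS))"
  proof (rule nn_integral_mono)
    fix q assume "q \<in> space (Q \<Otimes>\<^sub>M CS)"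
    then have \<beta>: "fst (fst q) \<in> space (bag_space M)" by (auto simp: space_pair_measure space_Q)
    have Um [measurable]: "?U q \<in> borel_measurable M"
    proof -
      have "(\<lambda>(a, x). update (space M) K u m \<eta> f (fst q) (snd q) x)
          \<in> borel_measurable (count_space {()} \<Otimes>\<^sub>M M)"
        using \<beta> by (intro measurable_update[OF K_meas u_meas]) (auto simp: space_pair_measure mem_Times_iff)
      from measurable_compose[OF _ this, of "\<lambda>x. ((), x)" M] show ?thesis by simp
    qed
    have "(\<integral>\<^sup>+s. ennreal (exp (k * (err f + (\<Sum>i<j. err (?it (?U q) s i))))) \<partial>(QS \<Otimes>\<^sub>M CS))
      = (\<integral>\<^sup>+s. ennreal (exp (k * err f)) * ennreal (exp (k * (\<Sum>i<j. err (?it (?U q) s i)))) \<partial>(QS \<Otimes>\<^sub>M CS))"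
      by (simp add: ennreal_mult[symmetric] exp_add[symmetric] distrib_left)
    also have "\<dots> = ennreal (exp (k * err f)) *
        (\<integral>\<^sup>+s. ennreal (exp (k * (\<Sum>i<j. err (?it (?U q) s i)))) \<partial>(QS \<Otimes>\<^sub>M CS))"
      by (rule nn_integral_cmult) measurable
    also have "\<dots> \<le> ennreal (exp (k * err f)) *
        ennreal (exp (l * sqdist (?U q) v + real j * (2 * \<Lambda> * b)))"
      unfolding k_def l_def
    proof (intro mult_left_mono Suc.IH)
      show "ip_norm ip (?U q) \<le> \<eta> * (real N - real j)"
        using ip_norm_update_le[OF Suc.prems(2) \<beta>, of \<eta> m "snd q"] \<eta> Suc.prems(4)
        by (simp add: algebra_simps)
    qed (use Suc.prems update_mem \<beta> Um in auto)
    finally show "(\<integral>\<^sup>+s. ennreal (exp (k * (err f + (\<Sum>i<j. err (?it (?U q) s i))))) \<partial>(QS \<Otimes>\<^sub>M CS))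
      \<le> ennreal (exp (k * err f)) * ennreal (exp (l * sqdist (?U q) v + real j * (2 * \<Lambda> * b)))" .
  qed
  also have "\<dots> = (\<integral>\<^sup>+q. ennreal (exp (k * err f + real j * (2 * \<Lambda> * b) + l * sqdist (?U q) v))
      \<partial>(Q \<Otimes>\<^sub>M CS))"
    by (simp add: ennreal_mult[symmetric] exp_add[symmetric] algebra_simps)
  also have "\<dots> \<le> ennreal (exp (k * err f + real j * (2 * \<Lambda> * b) + l * sqdist f v
      + 2 * \<eta>\<^sup>2 * l\<^sup>2 * sqdist f v + l * b - 2 * \<eta> * l * err f / L))"
    unfolding b_def by (intro potential_step Suc.prems \<rho> B \<eta> l0 m)
  also have "\<dots> \<le> ennreal (exp (\<Lambda> * (1 + real (Suc j) / real N) * sqdist f v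
      + real (Suc j) * (2 * \<Lambda> * b)))"
  proof (intro ennreal_leI exp_le_cancel_iff[THEN iffD2])
    \<comment> \<open>The current rate \<open>l\<close> is at least \<open>\<Lambda>\<close>, so the
      decrease of the potential covers the error of the current hypothesis.\<close>
    have "k * err f \<le> 2 * \<eta> * l * err f / L"
      using mult_right_mono[OF l1, of "2 * \<eta> * err f / L"] \<eta> L_pos err_nonneg[OF Suc.prems(3)]
      by (simp add: k_def mult_ac)
    moreover have "l * b \<le> 2 * \<Lambda> * b" using l2 b0 by (rule mult_right_mono)
    moreover have "2 * \<eta>\<^sup>2 * l\<^sup>2 * sqdist f v \<le> \<Lambda> / real N * sqdist f v"
    proof (rule mult_right_mono[OF _ sqdist_nonneg[OF Suc.prems(2) v_mem]])
      \<comment> \<open>The rate never exceeds \<open>2 * \<Lambda>\<close>, so the variance factor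
        is at most \<open>8 * \<eta>^2 * \<Lambda>^2\<close>. The value of \<open>\<Lambda>\<close>
        is chosen to make this equal to \<open>\<Lambda> / N\<close>, the increase of the rate per
        round.\<close>
      have "2 * \<eta>\<^sup>2 * l\<^sup>2 \<le> 2 * \<eta>\<^sup>2 * (2 * \<Lambda>)\<^sup>2"
        using l0 l2 by (intro mult_left_mono power_mono) auto
      also have "\<dots> = \<Lambda> / real N"
        using \<eta> N by (simp add: \<Lambda>_def power2_eq_square field_simps)
      finally show "2 * \<eta>\<^sup>2 * l\<^sup>2 \<le> \<Lambda> / real N" .
    qed
    moreover have "\<Lambda> * (1 + real (Suc j) / real N) * sqdist f v = l * sqdist f v + \<Lambda> / real N * sqdist f v"
      by (simp add: l_def add_divide_distrib algebra_simps)
    ultimately show "k * err f + real j * (2 * \<Lambda> * b) + l * sqdist f v + 2 * \<eta>\<^sup>2 * l\<^sup>2 * sqdist f v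
        + l * b - 2 * \<eta> * l * err f / L
      \<le> \<Lambda> * (1 + real (Suc j) / real N) * sqdist f v + real (Suc j) * (2 * \<Lambda> * b)"
      by (simp add: algebra_simps)
  qed
  finally show ?case unfolding k_def .
qed

text \<open>Chernoff's method with \<open>exponential_regret\<close> for all \<open>N\<close>
  rounds. There the rate is \<open>2 * \<Lambda> = 1 / (4 * N * \<eta>^2)\<close>, which explains
  the first two terms of the exponent; the last one is the threshold \<open>N * \<epsilon>\<close>
  multiplied by \<open>2 * \<Lambda> * \<eta> / L\<close>.\<close>

lemma regret_tail:
  fixes \<epsilon> :: real
  assumes B: "ip_norm ip v \<le> B" and \<eta>: "0 < \<eta>" and m: "0 < m" and N: "0 < N" and e0: "0 \<le> e"
  defines "\<rho> \<equiv> \<eta> * (real N - 1)"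
  defines "b \<equiv> 4 * \<eta> * e + \<eta>\<^sup>2 + 2 * \<eta> * ((B + \<rho>) * L * \<rho> / sqrt (real m))"
  defines "E \<equiv> {a \<in> space (QS \<Otimes>\<^sub>M CS).
    (\<Sum>i<N. err (iterate (space M) K u m \<eta> (\<lambda>_. 0) (fst a) (snd a) i)) \<le> real N * \<epsilon>}"
  shows "E \<in> sets (QS \<Otimes>\<^sub>M CS)"
    and "1 - exp (B\<^sup>2 / (4 * real N * \<eta>\<^sup>2) + b / (4 * \<eta>\<^sup>2) - \<epsilon> / (4 * \<eta> * L)) \<le> measure (QS \<Otimes>\<^sub>M CS) E"
proof -
  define \<Lambda> where "\<Lambda> = 1 / (8 * real N * \<eta>\<^sup>2)"
  let ?sum = "\<lambda>a. \<Sum>i<N. err (iterate (space M) K u m \<eta> (\<lambda>_. 0) (fst a) (snd a) i)"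
  let ?x = "B\<^sup>2 / (4 * real N * \<eta>\<^sup>2) + b / (4 * \<eta>\<^sup>2)"
  let ?k = "2 * \<Lambda> * \<eta> / L"
  have k: "0 < ?k" unfolding \<Lambda>_def using N \<eta> L_pos by simp
  have kN: "?k * (real N * \<epsilon>) = \<epsilon> / (4 * \<eta> * L)"
    using N \<eta> L_pos by (simp add: \<Lambda>_def power2_eq_square field_simps)
  have [measurable]: "?sum \<in> borel_measurable (QS \<Otimes>\<^sub>M CS)" by measurable
  show E: "E \<in> sets (QS \<Otimes>\<^sub>M CS)" unfolding E_def by measurable
  have "(\<integral>\<^sup>+a. ennreal (exp (?k * ?sum a)) \<partial>(QS \<Otimes>\<^sub>M CS))
      \<le> ennreal (exp (\<Lambda> * (1 + real N / real N) * sqdist (\<lambda>_. 0) v + real N * (2 * \<Lambda> * b)))"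
    unfolding \<Lambda>_def b_def \<rho>_def
    by (rule exponential_regret) (use assms ip_norm_nonneg ip_scale[of "\<lambda>_. 0" "\<lambda>_. 0" 0] in \<open>auto simp: ip_norm_def\<close>)
  also have "\<dots> \<le> ennreal (exp ?x)"
  proof (intro ennreal_leI exp_le_cancel_iff[THEN iffD2])
    have "sqdist (\<lambda>_. 0) v \<le> B\<^sup>2"
      unfolding sqdist_zero[OF v_mem] using B ip_norm_nonneg[OF v_mem] by (intro power_mono)
    then have "2 * \<Lambda> * sqdist (\<lambda>_. 0) v \<le> 2 * \<Lambda> * B\<^sup>2" by (intro mult_left_mono) (auto simp: \<Lambda>_def)
    then show "\<Lambda> * (1 + real N / real N) * sqdist (\<lambda>_. 0) v + real N * (2 * \<Lambda> * b) \<le> ?x"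
      using N \<eta> by (simp add: \<Lambda>_def field_simps)
  qed
  finally have I: "(\<integral>\<^sup>+a. ennreal (exp (?k * ?sum a)) \<partial>(QS \<Otimes>\<^sub>M CS)) \<le> ennreal (exp ?x)" .
  have "emeasure (QS \<Otimes>\<^sub>M CS) (space (QS \<Otimes>\<^sub>M CS) - E)
      \<le> (\<integral>\<^sup>+a. ennreal (exp (- (?k * (real N * \<epsilon>)))) * ennreal (exp (?k * ?sum a)) \<partial>(QS \<Otimes>\<^sub>M CS))"
  proof (subst nn_integral_indicator[symmetric])
    show "space (QS \<Otimes>\<^sub>M CS) - E \<in> sets (QS \<Otimes>\<^sub>M CS)" using E by auto
    show "(\<integral>\<^sup>+a. indicator (space (QS \<Otimes>\<^sub>M CS) - E) a \<partial>(QS \<Otimes>\<^sub>M CS))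
      \<le> (\<integral>\<^sup>+a. ennreal (exp (- (?k * (real N * \<epsilon>)))) * ennreal (exp (?k * ?sum a)) \<partial>(QS \<Otimes>\<^sub>M CS))"
    proof (rule nn_integral_mono)
      fix a assume a: "a \<in> space (QS \<Otimes>\<^sub>M CS)"
      show "indicator (space (QS \<Otimes>\<^sub>M CS) - E) a
        \<le> ennreal (exp (- (?k * (real N * \<epsilon>)))) * ennreal (exp (?k * ?sum a))"
      proof (cases "a \<in> E")
        case False
        then have "real N * \<epsilon> \<le> ?sum a" using a by (simp add: E_def)
        then have "?k * (real N * \<epsilon>) \<le> ?k * ?sum a" using k by (intro mult_left_mono) auto
        then have "ennreal 1 \<le> ennreal (exp (- (?k * (real N * \<epsilon>)) + ?k * ?sum a))"
          by (intro ennreal_leI) simp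
        then show ?thesis using a False by (simp add: ennreal_mult[symmetric] exp_add[symmetric])
      qed simp
    qed
  qed
  also have "\<dots> = ennreal (exp (- (?k * (real N * \<epsilon>)))) * (\<integral>\<^sup>+a. ennreal (exp (?k * ?sum a)) \<partial>(QS \<Otimes>\<^sub>M CS))"
    by (rule nn_integral_cmult) measurable
  also have "\<dots> \<le> ennreal (exp (- (?k * (real N * \<epsilon>)))) * ennreal (exp ?x)"
    by (intro mult_left_mono I) simp
  also have "\<dots> = ennreal (exp (?x - \<epsilon> / (4 * \<eta> * L)))"
    unfolding kN by (simp add: ennreal_mult[symmetric] exp_add[symmetric])
  finally have "measure (QS \<Otimes>\<^sub>M CS) (space (QS \<Otimes>\<^sub>M CS) - E) \<le> exp (?x - \<epsilon> / (4 * \<eta> * L))"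
    by (simp add: run.emeasure_eq_measure)
  then show "1 - exp (?x - \<epsilon> / (4 * \<eta> * L)) \<le> measure (QS \<Otimes>\<^sub>M CS) E"
    using run.prob_compl[OF E] by simp
qed

end

section \<open>The program\<close>

text \<open>A total-correctness triple with a time budget. The budget is an upper bound, so that
  branches and rounds of different cost can share one.\<close>

definition halts :: "'x oracles \<Rightarrow> (nat \<Rightarrow> 'x list \<times> bool) \<Rightarrow> (nat \<Rightarrow> real) \<Rightarrow>
    com \<Rightarrow> 'x state \<Rightarrow> nat \<Rightarrow> ('x state \<Rightarrow> bool) \<Rightarrow> bool" where
  "halts Or S W p s T P \<longleftrightarrow> (\<exists>t s'. exec Or S W p s t s' \<and> t \<le> T \<and> P s')"

lemma halts_mono:
  "halts Or S W p s T P \<Longrightarrow> T \<le> T' \<Longrightarrow> (\<And>s'. P s' \<Longrightarrow> P' s') \<Longrightarrow> halts Or S W p s T' P'"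
  unfolding halts_def by (meson order_trans)

lemma halts_Seq:
  assumes "halts Or S W p s Tp P" "\<And>s'. P s' \<Longrightarrow> halts Or S W q s' Tq P'" "Tp + Tq \<le> T"
  shows "halts Or S W (Seq p q) s T P'"
proof -
  obtain t s' where 1: "exec Or S W p s t s'" "t \<le> Tp" "P s'" using assms(1) by (auto simp: halts_def)
  obtain t' s'' where 2: "exec Or S W q s' t' s''" "t' \<le> Tq" "P' s''"
    using assms(2)[OF 1(3)] by (auto simp: halts_def)
  from exec.Seq[OF 1(1) 2(1)] 1 2 assms(3) show ?thesis unfolding halts_def
    by (intro exI[of _ "t + t'"] exI[of _ s'']) auto
qed

text \<open>The number \<open>n\<close> of iterations is known in advance. Each iteration pays 1 for
  its test, and the final failing test accounts for the last 1.\<close>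

lemma halts_While:
  assumes "I 0 s"
    and body: "\<And>i s. i < n \<Longrightarrow> I i s \<Longrightarrow> bval (nmem s) (rmem s) b \<and> halts Or S W p s Tb (I (Suc i))"
    and exit: "\<And>s. I n s \<Longrightarrow> \<not> bval (nmem s) (rmem s) b"
    and T: "n * Suc Tb + 1 \<le> T"
  shows "halts Or S W (While b p) s T (I n)"
proof -
  have "halts Or S W (While b p) s (k * Suc Tb + 1) (I n)" if "I i s" "i + k = n" for i k s
    using that
  proof (induction k arbitrary: i s)
    case 0
    then show ?case using exec.WhileFalse exit unfolding halts_def by fastforce
  next
    case (Suc k)
    from body[of i s] Suc.prems obtain t s' where
      b: "bval (nmem s) (rmem s) b" and 1: "exec Or S W p s t s'" "t \<le> Tb" "I (Suc i) s'"
      by (auto simp: halts_def)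
    from Suc.IH[OF 1(3)] Suc.prems obtain t' s'' where
      2: "exec Or S W (While b p) s' t' s''" "t' \<le> k * Suc Tb + 1" "I n s''"
      by (auto simp: halts_def)
    from exec.WhileTrue[OF b 1(1) 2(1)] 1 2 show ?case unfolding halts_def
      by (intro exI[of _ "1 + t + t'"] exI[of _ s'']) auto
  qed
  from this[of 0 s n] assms(1) T show ?thesis by (auto intro: halts_mono)
qed

lemma halts_basic:
  "1 \<le> T \<Longrightarrow> P (s\<lparr>nmem := (nmem s)(nval (nmem s) a := nval (nmem s) e)\<rparr>) \<Longrightarrow>
    halts Or S W (NSet a e) s T P"
  "1 \<le> T \<Longrightarrow> P (s\<lparr>rmem := (rmem s)(nval (nmem s) a := rval (nmem s) (rmem s) r)\<rparr>) \<Longrightarrow>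
    halts Or S W (RSet a r) s T P"
  "1 \<le> T \<Longrightarrow> P (s\<lparr>seen := seen s @ [S (length (seen s))]\<rparr>) \<Longrightarrow> halts Or S W Draw s T P"
  "1 \<le> T \<Longrightarrow> nval (nmem s) i < length (seen s) \<Longrightarrow>
    P (s\<lparr>nmem := (nmem s)(nval (nmem s) a := of_bool (snd (seen s ! nval (nmem s) i)))\<rparr>) \<Longrightarrow>
    halts Or S W (GetLabel a i) s T P"
  "1 \<le> T \<Longrightarrow> nval (nmem s) i < length (seen s) \<Longrightarrow>
    P (s\<lparr>nmem := (nmem s)(nval (nmem s) a := length (fst (seen s ! nval (nmem s) i)))\<rparr>) \<Longrightarrow>
    halts Or S W (GetSize a i) s T P"
  "1 \<le> T \<Longrightarrow> P (s\<lparr>nmem := (nmem s)(nval (nmem s) a := coin_index (W (coins s)) (nval (nmem s) k)),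
      coins := Suc (coins s)\<rparr>) \<Longrightarrow>
    halts Or S W (Rand a k) s T P"
  "1 + kernel_time Or \<le> T \<Longrightarrow> nval (nmem s) i < length (seen s) \<Longrightarrow>
    nval (nmem s) j < length (fst (seen s ! nval (nmem s) i)) \<Longrightarrow>
    nval (nmem s) i' < length (seen s) \<Longrightarrow>
    nval (nmem s) j' < length (fst (seen s ! nval (nmem s) i')) \<Longrightarrow>
    P (s\<lparr>rmem := (rmem s)(nval (nmem s) a :=
          kernel Or (fst (seen s ! nval (nmem s) i) ! nval (nmem s) j)
                    (fst (seen s ! nval (nmem s) i') ! nval (nmem s) j'))\<rparr>) \<Longrightarrow>
    halts Or S W (Kernel a i j i' j') s T P"
  "1 \<le> T \<Longrightarrow> P (s\<lparr>rmem := (rmem s)(nval (nmem s) a := link Or (rval (nmem s) (rmem s) r))\<rparr>) \<Longrightarrow>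
    halts Or S W (Link a r) s T P"
  unfolding halts_def coin_index_def by (blast intro: exec.intros)+

text \<open>Symbolic execution: the rest of the program becomes the postcondition of the first
  command, so straight-line code runs from the exact resulting state without intermediate
  assertions.\<close>

lemma halts_Seq_basic:
  "halts Or S W p s 1 (\<lambda>s'. halts Or S W q s' (T - 1) P) \<Longrightarrow> 1 \<le> T \<Longrightarrow> halts Or S W (Seq p q) s T P"
  by (rule halts_Seq[where Tq = "T - 1"]) auto

lemma halts_Seq_Kernel:
  "halts Or S W (Kernel a i j i' j') s (1 + kernel_time Or) (\<lambda>s'. halts Or S W q s' (T - (1 + kernel_time Or)) P) \<Longrightarrow>
   1 + kernel_time Or \<le> T \<Longrightarrow> halts Or S W (Seq (Kernel a i j i' j') q) s T P"
  by (rule halts_Seq[where Tq = "T - (1 + kernel_time Or)"]) auto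

text \<open>The rules are instantiated command by command so that repeated application stops at a
  loop, where an invariant has to be supplied.\<close>

lemmas halts_straight =
  halts_Seq_Kernel
  halts_Seq_basic[where p = "NSet a e" for a e] halts_Seq_basic[where p = "RSet a e" for a e]
  halts_Seq_basic[where p = "Draw"] halts_Seq_basic[where p = "GetLabel a e" for a e]
  halts_Seq_basic[where p = "GetSize a e" for a e] halts_Seq_basic[where p = "Rand a e" for a e]
  halts_Seq_basic[where p = "Link a e" for a e]
  halts_basic

abbreviation NV :: "nat \<Rightarrow> nexp" where "NV i \<equiv> NMem (NConst i)"
abbreviation RV :: "nat \<Rightarrow> rexp" where "RV i \<equiv> RMem (NConst i)"
abbreviation incr :: "nat \<Rightarrow> com" where "incr i \<equiv> NSet (NConst i) (NAdd (NV i) (NConst 1))"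
abbreviation RC :: "nat \<Rightarrow> rexp" where "RC i \<equiv> RNat (NConst i)"
abbreviation cell :: "nat \<Rightarrow> nexp" where "cell i \<equiv> NAdd (NConst 10) (NV i)"

text \<open>
  Memory layout. Natural numbers: 0 holds the number \<open>k\<close> of halvings of 1 needed to reach \<open>\<delta>\<close>,
  1 the number \<open>N\<close> of averaged hypotheses, 2 the number \<open>m\<close> of coins per estimate, 3 the current
  round, 4 and 5 are loop counters, 6 is a bag size, 7 a position, 8 a label; \<open>10 + t\<close> is the
  position of the instance chosen in round \<open>t\<close>. Reals: 0 to 4 hold the inputs
  \<open>n\<close>, \<open>B\<close>, \<open>L\<close>, \<open>\<epsilon>\<close>, \<open>\<delta>\<close>, 5 the step size, 6 to 9 are accumulators, and \<open>10 + t\<close> is the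
  coefficient of the kernel section added in round \<open>t\<close>.
\<close>

definition eval_loop :: com where
  "eval_loop = While (NLess (NV 5) (NV 3))
     (Seq (Kernel (NConst 7) (NV 5) (NMem (cell 5)) (NV 3) (NV 7))
     (Seq (RSet (NConst 6) (RAdd (RV 6) (RMul (RMem (cell 5)) (RV 7))))
       (incr 5)))"

definition estimate_loop :: com where
  "estimate_loop = While (NLess (NV 4) (NV 2))
     (Seq (Rand (NConst 7) (NV 6))
     (Seq (NSet (NConst 5) (NConst 0))
     (Seq eval_loop
       (incr 4))))"

text \<open>The guard allows \<open>N - 1\<close> rounds: the first of the \<open>N\<close>
  hypotheses is the zero function and requires no data.\<close>

definition train_loop :: com where
  "train_loop = While (NLess (NAdd (NV 3) (NConst 1)) (NV 1))
     (Seq Draw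
     (Seq (GetSize (NConst 6) (NV 3))
     (Seq (RSet (NConst 6) (RC 0))
     (Seq (NSet (NConst 4) (NConst 0))
     (Seq estimate_loop
     (Seq (Rand (cell 3) (NV 6))
     (Seq (GetLabel (NConst 8) (NV 3))
     (Seq (Link (NConst 7) (RDiv (RV 6) (RNat (NV 2))))
     (Seq (RSet (cell 3) (RMul (RV 5) (RSub (RNat (NV 8)) (RV 7))))
       (incr 3))))))))))"

definition mean_loop :: com where
  "mean_loop = While (NLess (NV 5) (NV 6))
     (Seq (Kernel (NConst 7) (NV 4) (NMem (cell 4)) (NV 3) (NV 5))
     (Seq (RSet (NConst 9) (RAdd (RV 9) (RV 7)))
       (incr 5)))"

text \<open>The bag means of successive iterates differ by a coefficient times the mean of one
  kernel section, so all \<open>N\<close> of them together cost only one kernel evaluation per round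
  and instance.\<close>

definition average_loop :: com where
  "average_loop = While (NLess (NV 4) (NV 3))
     (Seq (Link (NConst 7) (RV 6))
     (Seq (RSet (NConst 8) (RAdd (RV 8) (RV 7)))
     (Seq (RSet (NConst 9) (RC 0))
     (Seq (NSet (NConst 5) (NConst 0))
     (Seq mean_loop
     (Seq (RSet (NConst 6) (RAdd (RV 6) (RMul (RMem (cell 4)) (RDiv (RV 9) (RNat (NV 6))))))
       (incr 4)))))))"

text \<open>After training, cell 3 holds the number of drawn bags, which is also the number of the
  bag appended for prediction. The loop adds up the predictions below \<open>N - 1\<close>; the
  \<open>Link\<close> after it supplies the last one.\<close>

definition predict :: com where
  "predict =
     Seq (GetSize (NConst 6) (NV 3))
     (Seq (RSet (NConst 6) (RC 0))
     (Seq (RSet (NConst 8) (RC 0))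
     (Seq (NSet (NConst 4) (NConst 0))
     (Seq average_loop
     (Seq (Link (NConst 7) (RV 6))
     (Seq (RSet (NConst 8) (RAdd (RV 8) (RV 7)))
       (RSet (NConst 0) (RDiv (RV 8) (RNat (NV 1))))))))))"

lemma sampling_free_predict: "sampling_free predict"
  by (simp add: predict_def average_loop_def mean_loop_def)

text \<open>A single run: both streams are fixed and nothing is random. What is shown about the
  program therefore holds on every run, not only on a good event.\<close>

locale run_context =
  fixes X :: "'x set" and K :: "'x \<Rightarrow> 'x \<Rightarrow> real" and u :: "real \<Rightarrow> real" and \<kappa> :: nat
    and S :: "nat \<Rightarrow> 'x list \<times> bool" and W :: "nat \<Rightarrow> real" and m :: nat and \<eta> :: real and N :: nat
  assumes bags: "\<And>i. fst (S i) \<noteq> []" "\<And>i. set (fst (S i)) \<subseteq> X" and m_pos: "0 < m" and N_pos: "0 < N"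
begin

abbreviation "Or \<equiv> \<lparr>kernel = K, kernel_time = \<kappa>, link = u\<rparr>"

abbreviation hyp :: "nat \<Rightarrow> 'x \<Rightarrow> real" where
  "hyp \<equiv> iterate X K u m \<eta> (\<lambda>_. 0) S W"

abbreviation coin_at :: "nat \<Rightarrow> nat \<Rightarrow> real" where
  "coin_at t j \<equiv> W (t * Suc m + j)"

definition pos :: "nat \<Rightarrow> nat" where
  "pos t = coin_index (coin_at t m) (length (fst (S t)))"

definition pt :: "nat \<Rightarrow> 'x" where
  "pt t = fst (S t) ! pos t"

definition coef :: "nat \<Rightarrow> real" where
  "coef t = \<eta> * (of_bool (snd (S t)) - u (est m (hyp t) (fst (S t)) (coin_at t)))"

lemma pos_less: "pos t < length (fst (S t))"
  unfolding pos_def using bags by (intro coin_index_less) simp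

text \<open>The finite representation of an iterate in memory. Instances cannot be copied, only
  addressed, so round \<open>t\<close> leaves behind a coefficient and a position in bag
  \<open>t\<close>.\<close>

lemma hyp_eq: "hyp t x = (\<Sum>i<t. coef i * feature X K (pt i) x)"
  by (induction t) (simp_all add: update_def coef_def pt_def pos_def draw_inst_def)

lemma hyp_eq': "x \<in> X \<Longrightarrow> hyp t x = (\<Sum>i<t. coef i * K (pt i) x)"
  by (simp add: hyp_eq feature_def)

definition core :: "nat \<Rightarrow> 'x state \<Rightarrow> bool" where
  "core t s \<longleftrightarrow> nmem s 1 = N \<and> nmem s 2 = m \<and> nmem s 3 = t \<and> rmem s 5 = \<eta> \<and>
     (\<forall>i<t. nmem s (10 + i) = pos i \<and> rmem s (10 + i) = coef i)"

definition inst :: "nat \<Rightarrow> nat \<Rightarrow> 'x" where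
  "inst t j = draw_inst (fst (S t)) (coin_at t j)"

lemma inst_mem: "inst t j \<in> X"
  unfolding inst_def draw_inst_def using bags(2)[of t] coin_index_less[of "length (fst (S t))"] bags(1)[of t]
  by (auto simp: subset_iff)

definition estimating :: "nat \<Rightarrow> nat \<Rightarrow> 'x state \<Rightarrow> bool" where
  "estimating t j s \<longleftrightarrow> core t s \<and> nmem s 6 = length (fst (S t)) \<and> nmem s 4 = j \<and>
     seen s = map S [0..<Suc t] \<and> coins s = t * Suc m + j \<and>
     rmem s 6 = (\<Sum>i<j. hyp t (inst t i))"

text \<open>Coin \<open>j\<close> of the round has already been consumed, hence the
  \<open>Suc\<close>. The accumulator holds \<open>j\<close> finished values and a partial kernel
  expansion of the next one.\<close>

definition evaluating :: "nat \<Rightarrow> nat \<Rightarrow> nat \<Rightarrow> 'x state \<Rightarrow> bool" where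
  "evaluating t j i s \<longleftrightarrow> core t s \<and> nmem s 6 = length (fst (S t)) \<and> nmem s 4 = j \<and>
     seen s = map S [0..<Suc t] \<and> coins s = Suc (t * Suc m + j) \<and> nmem s 5 = i \<and>
     nmem s 7 = coin_index (coin_at t j) (length (fst (S t))) \<and>
     rmem s 6 = (\<Sum>i<j. hyp t (inst t i)) + (\<Sum>i'<i. coef i' * K (pt i') (inst t j))"

lemma seen_nth: "i < t \<Longrightarrow> map S [0..<t] ! i = S i"
  by simp

lemma eval_loop_halts:
  assumes "evaluating t j 0 s"
  shows "halts Or S W eval_loop s (t * (\<kappa> + 4) + 1) (evaluating t j t)"
  unfolding eval_loop_def
proof (rule halts_While[where Tb = "\<kappa> + 3" and I = "evaluating t j" and n = t])
  fix i s assume i: "i < t" and s: "evaluating t j i s"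
  have l: "coin_index (coin_at t j) (length (fst (S t))) < length (fst (S t))"
    using bags by (intro coin_index_less) simp
  have a: "nmem s (10 + i) = pos i" "rmem s (10 + i) = coef i"
    using s i by (auto simp: evaluating_def core_def)
  show "bval (nmem s) (rmem s) (NLess (NV 5) (NV 3)) \<and>
    halts Or S W (Seq (Kernel (NConst 7) (NV 5) (NMem (cell 5)) (NV 3) (NV 7))
     (Seq (RSet (NConst 6) (RAdd (RV 6) (RMul (RMem (cell 5)) (RV 7)))) (incr 5)))
     s (\<kappa> + 3) (evaluating t j (Suc i))"
    by (intro conjI halts_straight)
      (use s i l a pos_less[of i] in \<open>simp_all add: evaluating_def core_def seen_nth pt_def inst_def
        draw_inst_def del: upt_Suc\<close>)
qed (use assms in \<open>auto simp: evaluating_def core_def\<close>)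

lemma estimate_loop_halts:
  assumes "estimating t 0 s"
  shows "halts Or S W estimate_loop s (m * (t * (\<kappa> + 4) + 5) + 1) (estimating t m)"
  unfolding estimate_loop_def
proof (rule halts_While[where Tb = "t * (\<kappa> + 4) + 4" and I = "estimating t" and n = m])
  fix j s assume j: "j < m" and s: "estimating t j s"
  have 2: "halts Or S W (incr 4) s' 1 (estimating t (Suc j))" if "evaluating t j t s'" for s'
    by (intro halts_straight)
      (use that in \<open>simp_all add: estimating_def evaluating_def core_def hyp_eq'[OF inst_mem]\<close>)
  show "bval (nmem s) (rmem s) (NLess (NV 4) (NV 2)) \<and>
    halts Or S W (Seq (Rand (NConst 7) (NV 6)) (Seq (NSet (NConst 5) (NConst 0)) (Seq eval_loop (incr 4))))
      s (t * (\<kappa> + 4) + 4) (estimating t (Suc j))"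
  proof
    show "bval (nmem s) (rmem s) (NLess (NV 4) (NV 2))" using s j by (simp add: estimating_def core_def)
    show "halts Or S W (Seq (Rand (NConst 7) (NV 6)) (Seq (NSet (NConst 5) (NConst 0)) (Seq eval_loop (incr 4))))
      s (t * (\<kappa> + 4) + 4) (estimating t (Suc j))"
      by (intro halts_straight halts_Seq[OF eval_loop_halts 2]) (use s in \<open>simp_all add: estimating_def evaluating_def core_def\<close>, simp)
  qed
qed (use assms in \<open>auto simp: estimating_def core_def\<close>)

definition training :: "nat \<Rightarrow> 'x state \<Rightarrow> bool" where
  "training t s \<longleftrightarrow> core t s \<and> seen s = map S [0..<t] \<and> coins s = t * Suc m"

lemma train_loop_halts:
  assumes "training 0 s"
  shows "halts Or S W train_loop s (N * (m * (N * (\<kappa> + 4) + 5) + 11) + 1) (training (N - 1))"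
  unfolding train_loop_def
proof (rule halts_While[where Tb = "m * (N * (\<kappa> + 4) + 5) + 10" and I = training and n = "N - 1"])
  fix t s assume t: "t < N - 1" and s: "training t s"
  \<comment> \<open>The cost of a round grows with \<open>t\<close>, while the loop rule takes one
    bound for all rounds.\<close>
  have T: "m * (t * (\<kappa> + 4) + 5) \<le> m * (N * (\<kappa> + 4) + 5)"
    using t by (intro mult_le_mono add_le_mono) auto
  have 2: "halts Or S W (Seq (Rand (cell 3) (NV 6)) (Seq (GetLabel (NConst 8) (NV 3))
      (Seq (Link (NConst 7) (RDiv (RV 6) (RNat (NV 2))))
      (Seq (RSet (cell 3) (RMul (RV 5) (RSub (RNat (NV 8)) (RV 7)))) (incr 3))))) s' 5 (training (Suc t))"
    if "estimating t m s'" for s'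
    by (intro halts_straight)
      (use that in \<open>simp_all add: estimating_def training_def core_def seen_nth pos_def coef_def est_def
        inst_def less_Suc_eq_le le_less all_conj_distrib disj_imp nth_append\<close>)
  show "bval (nmem s) (rmem s) (NLess (NAdd (NV 3) (NConst 1)) (NV 1)) \<and>
    halts Or S W (Seq Draw (Seq (GetSize (NConst 6) (NV 3)) (Seq (RSet (NConst 6) (RC 0))
     (Seq (NSet (NConst 4) (NConst 0)) (Seq estimate_loop (Seq (Rand (cell 3) (NV 6))
     (Seq (GetLabel (NConst 8) (NV 3)) (Seq (Link (NConst 7) (RDiv (RV 6) (RNat (NV 2))))
     (Seq (RSet (cell 3) (RMul (RV 5) (RSub (RNat (NV 8)) (RV 7)))) (incr 3))))))))))
      s (m * (N * (\<kappa> + 4) + 5) + 10) (training (Suc t))"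
  proof
    show "bval (nmem s) (rmem s) (NLess (NAdd (NV 3) (NConst 1)) (NV 1))"
      using s t by (simp add: training_def core_def)
    show "halts Or S W (Seq Draw (Seq (GetSize (NConst 6) (NV 3)) (Seq (RSet (NConst 6) (RC 0))
     (Seq (NSet (NConst 4) (NConst 0)) (Seq estimate_loop (Seq (Rand (cell 3) (NV 6))
     (Seq (GetLabel (NConst 8) (NV 3)) (Seq (Link (NConst 7) (RDiv (RV 6) (RNat (NV 2))))
     (Seq (RSet (cell 3) (RMul (RV 5) (RSub (RNat (NV 8)) (RV 7)))) (incr 3))))))))))
      s (m * (N * (\<kappa> + 4) + 5) + 10) (training (Suc t))"
      by (intro halts_straight halts_Seq[OF estimate_loop_halts 2]) (use s T in \<open>simp_all add: estimating_def training_def core_def nth_append\<close>)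
  qed
next
  have "(N - 1) * Suc (m * (N * (\<kappa> + 4) + 5) + 10) \<le> N * (m * (N * (\<kappa> + 4) + 5) + 11)"
    by (intro mult_le_mono) auto
  then show "(N - 1) * Suc (m * (N * (\<kappa> + 4) + 5) + 10) + 1 \<le> N * (m * (N * (\<kappa> + 4) + 5) + 11) + 1"
    by simp
qed (use assms N_pos in \<open>auto simp: training_def core_def\<close>)

definition averaging :: "'x list \<Rightarrow> nat \<Rightarrow> 'x state \<Rightarrow> bool" where
  "averaging \<beta> t s \<longleftrightarrow> core (N - 1) s \<and> seen s = map S [0..<N - 1] @ [(\<beta>, False)] \<and>
     nmem s 6 = length \<beta> \<and> nmem s 4 = t \<and>
     rmem s 6 = bag_mean (hyp t) \<beta> \<and> rmem s 8 = (\<Sum>i<t. u (bag_mean (hyp i) \<beta>))"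

definition summing :: "'x list \<Rightarrow> nat \<Rightarrow> nat \<Rightarrow> 'x state \<Rightarrow> bool" where
  "summing \<beta> t j s \<longleftrightarrow> core (N - 1) s \<and> seen s = map S [0..<N - 1] @ [(\<beta>, False)] \<and>
     nmem s 6 = length \<beta> \<and> nmem s 4 = t \<and> nmem s 5 = j \<and>
     rmem s 6 = bag_mean (hyp t) \<beta> \<and> rmem s 8 = (\<Sum>i<Suc t. u (bag_mean (hyp i) \<beta>)) \<and>
     rmem s 9 = (\<Sum>i<j. K (pt t) (\<beta> ! i))"

lemma mean_loop_halts:
  assumes "summing \<beta> t 0 s" and t: "t < N - 1"
  shows "halts Or S W mean_loop s (length \<beta> * (\<kappa> + 4) + 1) (summing \<beta> t (length \<beta>))"
  unfolding mean_loop_def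
proof (rule halts_While[where Tb = "\<kappa> + 3" and I = "summing \<beta> t" and n = "length \<beta>"])
  fix j s assume j: "j < length \<beta>" and s: "summing \<beta> t j s"
  have "nmem s (10 + t) = pos t" using s t by (auto simp: summing_def core_def)
  then show "bval (nmem s) (rmem s) (NLess (NV 5) (NV 6)) \<and>
    halts Or S W (Seq (Kernel (NConst 7) (NV 4) (NMem (cell 4)) (NV 3) (NV 5))
     (Seq (RSet (NConst 9) (RAdd (RV 9) (RV 7))) (incr 5))) s (\<kappa> + 3) (summing \<beta> t (Suc j))"
    by (intro conjI halts_straight)
      (use s t j pos_less[of t] in \<open>simp_all add: summing_def core_def nth_append pt_def\<close>)
qed (use assms in \<open>auto simp: summing_def core_def\<close>)

lemma bag_mean_hyp_Suc:
  assumes "set \<beta> \<subseteq> X"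
  shows "bag_mean (hyp (Suc t)) \<beta> =
    bag_mean (hyp t) \<beta> + coef t * ((\<Sum>i<length \<beta>. K (pt t) (\<beta> ! i)) / real (length \<beta>))"
proof -
  have "hyp (Suc t) x = hyp t x + coef t * K (pt t) x" if "x \<in> X" for x
    using hyp_eq'[OF that, of t] hyp_eq'[OF that, of "Suc t"] by simp
  then have "(\<Sum>i<length \<beta>. hyp (Suc t) (\<beta> ! i)) =
      (\<Sum>i<length \<beta>. hyp t (\<beta> ! i)) + coef t * (\<Sum>i<length \<beta>. K (pt t) (\<beta> ! i))"
    using assms by (simp add: sum.distrib sum_distrib_left subset_iff del: iterate.simps)
  then show ?thesis
    by (simp add: bag_mean_def sum_list_sum_nth atLeast0LessThan add_divide_distrib del: iterate.simps)
qed

lemma average_loop_halts: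
  assumes "averaging \<beta> 0 s" and \<beta>: "set \<beta> \<subseteq> X"
  shows "halts Or S W average_loop s (N * (length \<beta> * (\<kappa> + 4) + 8) + 1) (averaging \<beta> (N - 1))"
  unfolding average_loop_def
proof (rule halts_While[where Tb = "length \<beta> * (\<kappa> + 4) + 7" and I = "averaging \<beta>" and n = "N - 1"])
  fix t s assume t: "t < N - 1" and s: "averaging \<beta> t s"
  have 2: "halts Or S W (Seq (RSet (NConst 6) (RAdd (RV 6) (RMul (RMem (cell 4)) (RDiv (RV 9) (RNat (NV 6))))))
       (incr 4)) s' 2 (averaging \<beta> (Suc t))" if "summing \<beta> t (length \<beta>) s'" for s'
    by (intro halts_straight)
      (use that t in \<open>simp_all add: summing_def averaging_def core_def bag_mean_hyp_Suc[OF \<beta>] del: iterate.simps\<close>)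
  show "bval (nmem s) (rmem s) (NLess (NV 4) (NV 3)) \<and>
    halts Or S W (Seq (Link (NConst 7) (RV 6)) (Seq (RSet (NConst 8) (RAdd (RV 8) (RV 7)))
     (Seq (RSet (NConst 9) (RC 0)) (Seq (NSet (NConst 5) (NConst 0)) (Seq mean_loop
     (Seq (RSet (NConst 6) (RAdd (RV 6) (RMul (RMem (cell 4)) (RDiv (RV 9) (RNat (NV 6)))))) (incr 4)))))))
     s (length \<beta> * (\<kappa> + 4) + 7) (averaging \<beta> (Suc t))"
  proof
    show "bval (nmem s) (rmem s) (NLess (NV 4) (NV 3))" using s t by (simp add: averaging_def core_def)
    show "halts Or S W (Seq (Link (NConst 7) (RV 6)) (Seq (RSet (NConst 8) (RAdd (RV 8) (RV 7)))
     (Seq (RSet (NConst 9) (RC 0)) (Seq (NSet (NConst 5) (NConst 0)) (Seq mean_loop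
     (Seq (RSet (NConst 6) (RAdd (RV 6) (RMul (RMem (cell 4)) (RDiv (RV 9) (RNat (NV 6)))))) (incr 4)))))))
     s (length \<beta> * (\<kappa> + 4) + 7) (averaging \<beta> (Suc t))"
      by (intro halts_straight halts_Seq[OF mean_loop_halts[OF _ t] 2]) (use s in \<open>simp_all add: averaging_def summing_def core_def\<close>, simp)
  qed
next
  have "(N - 1) * Suc (length \<beta> * (\<kappa> + 4) + 7) \<le> N * (length \<beta> * (\<kappa> + 4) + 8)"
    by (intro mult_le_mono) auto
  then show "(N - 1) * Suc (length \<beta> * (\<kappa> + 4) + 7) + 1 \<le> N * (length \<beta> * (\<kappa> + 4) + 8) + 1"
    by simp
qed (use assms N_pos in \<open>auto simp: averaging_def core_def\<close>)

definition average_hyp :: "'x list \<Rightarrow> real" where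
  "average_hyp \<beta> = (\<Sum>i<N. u (bag_mean (hyp i) \<beta>)) / real N"

lemma predict_halts:
  assumes s: "training (N - 1) s" and \<beta>: "set \<beta> \<subseteq> X" "\<beta> \<noteq> []"
  shows "halts Or S W predict (s\<lparr>seen := seen s @ [(\<beta>, False)]\<rparr>) (N * (length \<beta> * (\<kappa> + 4) + 8) + 8)
    (\<lambda>s'. rmem s' 0 = average_hyp \<beta>)"
proof -
  have NN: "(\<Sum>i<N. f i) = (\<Sum>i<N - 1. f i) + f (N - 1)" for f :: "nat \<Rightarrow> real"
    using N_pos by (cases N) simp_all
  have 2: "halts Or S W (Seq (Link (NConst 7) (RV 6)) (Seq (RSet (NConst 8) (RAdd (RV 8) (RV 7)))
       (RSet (NConst 0) (RDiv (RV 8) (RNat (NV 1)))))) s' 3 (\<lambda>s'. rmem s' 0 = average_hyp \<beta>)"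
    if "averaging \<beta> (N - 1) s'" for s'
    by (intro halts_straight)
      (use that in \<open>simp_all add: averaging_def core_def average_hyp_def NN\<close>)
  show ?thesis unfolding predict_def
    by (intro halts_straight halts_Seq[OF average_loop_halts[OF _ \<beta>(1)] 2]) (use s in \<open>simp_all add: averaging_def training_def core_def nth_append bag_mean_def\<close>)
qed

end

section \<open>Numerical parameters and the loops that search for them\<close>

definition halvings :: "real \<Rightarrow> nat" where
  "halvings \<delta> = (LEAST k. (1 / 2) ^ k \<le> \<delta>)"

text \<open>The constant 16 makes the threshold term \<open>\<epsilon> / (4 * \<eta> * L)\<close> of
  the tail bound equal to \<open>4 * k\<close>.\<close>

definition step_size :: "real \<Rightarrow> real \<Rightarrow> nat \<Rightarrow> real" where
  "step_size L \<epsilon> k = \<epsilon> / (16 * L * real k)"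

text \<open>The search starts at 1, as the average has to contain a hypothesis. The condition says
  that \<open>N\<close> is at least \<open>64 * (B * L / \<epsilon>)^2 * k\<close>, in the
  division-free form that the loop tests.\<close>

definition rounds :: "real \<Rightarrow> real \<Rightarrow> real \<Rightarrow> nat \<Rightarrow> nat" where
  "rounds B L \<epsilon> k = Suc (LEAST i. 64 * (B * B * (L * L) * real k) \<le> real (Suc i) * (\<epsilon> * \<epsilon>))"

text \<open>The root of \<open>m\<close> is to be at least this number. Then
  \<open>(B + \<rho>) * L * (N - 1) / sqrt m\<close> is at most 1, where
  \<open>\<rho> = \<eta> * (N - 1)\<close> bounds the norms of the iterates.\<close>

definition coins_target :: "real \<Rightarrow> real \<Rightarrow> real \<Rightarrow> nat \<Rightarrow> real" where
  "coins_target B L \<eta> N = real N * (L * (B + \<eta> * (real N - 1)))"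

definition coins_per_estimate :: "real \<Rightarrow> nat" where
  "coins_per_estimate y = Suc (LEAST i. y * y \<le> real (Suc i))"

lemma halvings_least:
  assumes "0 < \<delta>"
  shows "(1 / 2) ^ halvings \<delta> \<le> \<delta>" "i < halvings \<delta> \<Longrightarrow> \<delta> < (1 / 2) ^ i"
proof -
  have "\<exists>k. (1 / 2 :: real) ^ k \<le> \<delta>" using real_arch_pow_inv[OF assms, of "1 / 2"] by (auto intro: less_imp_le)
  then show "(1 / 2) ^ halvings \<delta> \<le> \<delta>" unfolding halvings_def by (rule LeastI_ex)
  show "i < halvings \<delta> \<Longrightarrow> \<delta> < (1 / 2) ^ i" unfolding halvings_def using not_less_Least by fastforce
qed

lemma rounds_least:
  assumes "0 < \<epsilon>"
  shows "64 * (B * B * (L * L) * real k) \<le> real (rounds B L \<epsilon> k) * (\<epsilon> * \<epsilon>)"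
    "Suc i < rounds B L \<epsilon> k \<Longrightarrow> real (Suc i) * (\<epsilon> * \<epsilon>) < 64 * (B * B * (L * L) * real k)"
proof -
  obtain i0 where "64 * (B * B * (L * L) * real k) < real i0 * (\<epsilon> * \<epsilon>)"
    using ex_less_of_nat_mult[of "\<epsilon> * \<epsilon>"] assms by auto
  also have "\<dots> \<le> real (Suc i0) * (\<epsilon> * \<epsilon>)" by (intro mult_right_mono) auto
  finally have "\<exists>i. 64 * (B * B * (L * L) * real k) \<le> real (Suc i) * (\<epsilon> * \<epsilon>)" by (auto intro: less_imp_le)
  then show "64 * (B * B * (L * L) * real k) \<le> real (rounds B L \<epsilon> k) * (\<epsilon> * \<epsilon>)"
    unfolding rounds_def by (rule LeastI_ex)
  show "Suc i < rounds B L \<epsilon> k \<Longrightarrow> real (Suc i) * (\<epsilon> * \<epsilon>) < 64 * (B * B * (L * L) * real k)"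
    unfolding rounds_def by (auto dest!: not_less_Least simp del: of_nat_Suc)
qed

lemma coins_per_estimate_least:
  "y * y \<le> real (coins_per_estimate y)" "Suc i < coins_per_estimate y \<Longrightarrow> real (Suc i) < y * y"
proof -
  obtain i0 where "y * y \<le> real i0" using real_arch_simple by blast
  then have "y * y \<le> real (Suc i0)" by simp
  then have "\<exists>i. y * y \<le> real (Suc i)" by blast
  then show "y * y \<le> real (coins_per_estimate y)" unfolding coins_per_estimate_def by (rule LeastI_ex)
  show "Suc i < coins_per_estimate y \<Longrightarrow> real (Suc i) < y * y"
    unfolding coins_per_estimate_def by (auto dest!: not_less_Least simp del: of_nat_Suc)
qed

definition halving_loop :: com where
  "halving_loop = While (RLess (RV 4) (RV 6)) (Seq (RSet (NConst 6) (RDiv (RV 6) (RC 2))) (incr 0))"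

definition rounds_loop :: com where
  "rounds_loop = While (RLess (RMul (RNat (NV 1)) (RMul (RV 3) (RV 3)))
     (RMul (RC 64) (RMul (RMul (RMul (RV 1) (RV 1)) (RMul (RV 2) (RV 2))) (RNat (NV 0))))) (incr 1)"

definition coins_loop :: com where
  "coins_loop = While (RLess (RNat (NV 2)) (RV 6)) (incr 2)"

definition train :: com where
  "train =
     Seq (RSet (NConst 6) (RC 1))
     (Seq halving_loop
     (Seq (RSet (NConst 5) (RDiv (RV 3) (RMul (RMul (RC 16) (RV 2)) (RNat (NV 0)))))
     (Seq (NSet (NConst 1) (NConst 1))
     (Seq rounds_loop
     (Seq (RSet (NConst 6) (RMul (RNat (NV 1)) (RMul (RV 2)
        (RAdd (RV 1) (RMul (RV 5) (RSub (RNat (NV 1)) (RC 1)))))))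
     (Seq (RSet (NConst 6) (RMul (RV 6) (RV 6)))
     (Seq (NSet (NConst 2) (NConst 1))
     (Seq coins_loop
       train_loop))))))))"

text \<open>The training loop does not initialize its round counter, so the search for the
  parameters must leave cell 3 at 0.\<close>

definition fresh :: "'x state \<Rightarrow> bool" where
  "fresh s \<longleftrightarrow> nmem s 3 = 0 \<and> seen s = [] \<and> coins s = 0"

definition inputs :: "real \<Rightarrow> real \<Rightarrow> real \<Rightarrow> real \<Rightarrow> 'x state \<Rightarrow> bool" where
  "inputs B L \<epsilon> \<delta> s \<longleftrightarrow> fresh s \<and> rmem s 1 = B \<and> rmem s 2 = L \<and> rmem s 3 = \<epsilon> \<and> rmem s 4 = \<delta>"

lemma halving_loop_halts:
  fixes s :: "'x state"
  assumes "inputs B L \<epsilon> \<delta> s" "rmem s 6 = 1" "nmem s 0 = 0" "0 < \<delta>"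
  shows "halts Or S W halving_loop s (3 * halvings \<delta> + 1)
    (\<lambda>s. inputs B L \<epsilon> \<delta> s \<and> nmem s 0 = halvings \<delta>)"
proof -
  let ?I = "\<lambda>i (s :: 'x state). inputs B L \<epsilon> \<delta> s \<and> rmem s 6 = (1 / 2) ^ i \<and> nmem s 0 = i"
  have "halts Or S W halving_loop s (3 * halvings \<delta> + 1) (?I (halvings \<delta>))"
    unfolding halving_loop_def
  proof (rule halts_While[where Tb = 2 and I = ?I])
    fix i s assume i: "i < halvings \<delta>" and s: "?I i s"
    show "bval (nmem s) (rmem s) (RLess (RV 4) (RV 6)) \<and>
      halts Or S W (Seq (RSet (NConst 6) (RDiv (RV 6) (RC 2))) (incr 0)) s 2 (?I (Suc i))"
      by (intro conjI halts_straight)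
        (use s halvings_least(2)[OF assms(4) i] in \<open>simp_all add: inputs_def fresh_def\<close>)
  qed (use assms halvings_least(1)[OF assms(4)] in \<open>auto simp: inputs_def\<close>)
  then show ?thesis by (rule halts_mono) auto
qed

lemma rounds_loop_halts:
  fixes s :: "'x state"
  assumes "inputs B L \<epsilon> \<delta> s" "nmem s 0 = k" "rmem s 5 = \<eta>" "nmem s 1 = 1" "0 < \<epsilon>"
  shows "halts Or S W rounds_loop s (2 * rounds B L \<epsilon> k)
    (\<lambda>s. inputs B L \<epsilon> \<delta> s \<and> rmem s 5 = \<eta> \<and> nmem s 1 = rounds B L \<epsilon> k)"
proof -
  let ?I = "\<lambda>i (s :: 'x state). inputs B L \<epsilon> \<delta> s \<and> rmem s 5 = \<eta> \<and> nmem s 0 = k \<and> nmem s 1 = Suc i"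
  obtain n where n: "rounds B L \<epsilon> k = Suc n" by (simp add: rounds_def)
  note least = rounds_least[OF assms(5), where B = B and L = L and k = k, unfolded n]
  have "halts Or S W rounds_loop s (2 * n + 1) (?I n)"
    unfolding rounds_loop_def
  proof (rule halts_While[where Tb = 1 and I = ?I])
    fix i s assume i: "i < n" and s: "?I i s"
    have "real (Suc i) * (\<epsilon> * \<epsilon>) < 64 * (B * B * (L * L) * real k)" using least(2) i by simp
    then show "bval (nmem s) (rmem s) (RLess (RMul (RNat (NV 1)) (RMul (RV 3) (RV 3)))
       (RMul (RC 64) (RMul (RMul (RMul (RV 1) (RV 1)) (RMul (RV 2) (RV 2))) (RNat (NV 0))))) \<and>
       halts Or S W (incr 1) s 1 (?I (Suc i))"
      by (intro conjI halts_straight) (use s in \<open>simp_all add: inputs_def fresh_def\<close>)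
  qed (use assms least(1) in \<open>auto simp: inputs_def\<close>)
  then show ?thesis by (rule halts_mono) (auto simp: n)
qed

lemma coins_loop_halts:
  fixes s :: "'x state"
  assumes "fresh s" "rmem s 6 = y * y" "rmem s 5 = \<eta>" "nmem s 1 = N" "nmem s 2 = 1"
  shows "halts Or S W coins_loop s (2 * coins_per_estimate y)
    (\<lambda>s. fresh s \<and> rmem s 5 = \<eta> \<and> nmem s 1 = N \<and> nmem s 2 = coins_per_estimate y)"
proof -
  let ?I = "\<lambda>i (s :: 'x state). fresh s \<and> rmem s 5 = \<eta> \<and> rmem s 6 = y * y \<and> nmem s 1 = N \<and> nmem s 2 = Suc i"
  obtain n where n: "coins_per_estimate y = Suc n" by (simp add: coins_per_estimate_def)
  note least = coins_per_estimate_least[where y = y, unfolded n]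
  have "halts Or S W coins_loop s (2 * n + 1) (?I n)"
    unfolding coins_loop_def
  proof (rule halts_While[where Tb = 1 and I = ?I])
    fix i s assume i: "i < n" and s: "?I i s"
    have "real (Suc i) < y * y" using least(2) i by simp
    then show "bval (nmem s) (rmem s) (RLess (RNat (NV 2)) (RV 6)) \<and> halts Or S W (incr 2) s 1 (?I (Suc i))"
      by (intro conjI halts_straight) (use s in \<open>simp_all add: fresh_def\<close>)
  qed (use assms least(1) in auto)
  then show ?thesis by (rule halts_mono) (auto simp: n)
qed

lemma train_halts:
  assumes "0 < \<epsilon>" "0 < \<delta>" and k: "k = halvings \<delta>" and \<eta>: "\<eta> = step_size L \<epsilon> k"
    and N: "N = rounds B L \<epsilon> k" and y: "y = coins_target B L \<eta> N" and m: "m = coins_per_estimate y"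
    and bags: "\<And>i. fst (S i) \<noteq> []" "\<And>i. set (fst (S i)) \<subseteq> X"
  shows "halts \<lparr>kernel = K, kernel_time = \<kappa>, link = u\<rparr> S W train (initial_state [a, B, L, \<epsilon>, \<delta>])
    (3 * k + 2 * N + 2 * m + N * (m * (N * (\<kappa> + 4) + 5) + 11) + 8)
    (run_context.training X K u S W m \<eta> N (N - 1))"
proof -
  interpret run_context X K u \<kappa> S W m \<eta> N
    by unfold_locales (use bags in \<open>auto simp: N m rounds_def coins_per_estimate_def\<close>)
  let ?T = "N * (m * (N * (\<kappa> + 4) + 5) + 11) + 1"
  have 4: "halts Or S W train_loop s ?T (training (N - 1))"
    if "fresh s \<and> rmem s 5 = \<eta> \<and> nmem s 1 = N \<and> nmem s 2 = coins_per_estimate y" for s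
    by (rule train_loop_halts) (use that in \<open>simp add: training_def core_def fresh_def flip: m\<close>)
  have 3: "halts Or S W (Seq (RSet (NConst 6) (RMul (RNat (NV 1)) (RMul (RV 2)
        (RAdd (RV 1) (RMul (RV 5) (RSub (RNat (NV 1)) (RC 1)))))))
     (Seq (RSet (NConst 6) (RMul (RV 6) (RV 6)))
     (Seq (NSet (NConst 2) (NConst 1))
     (Seq coins_loop train_loop)))) s (3 + (2 * m + ?T)) (training (N - 1))"
    if "inputs B L \<epsilon> \<delta> s \<and> rmem s 5 = \<eta> \<and> nmem s 1 = rounds B L \<epsilon> k" for s
    by (intro halts_straight halts_Seq[OF coins_loop_halts[where y = y] 4])
      (use that in \<open>simp_all add: inputs_def fresh_def y coins_target_def N m\<close>)
  have 2: "halts Or S W (Seq (RSet (NConst 5) (RDiv (RV 3) (RMul (RMul (RC 16) (RV 2)) (RNat (NV 0)))))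
     (Seq (NSet (NConst 1) (NConst 1))
     (Seq rounds_loop
     (Seq (RSet (NConst 6) (RMul (RNat (NV 1)) (RMul (RV 2)
        (RAdd (RV 1) (RMul (RV 5) (RSub (RNat (NV 1)) (RC 1)))))))
     (Seq (RSet (NConst 6) (RMul (RV 6) (RV 6)))
     (Seq (NSet (NConst 2) (NConst 1))
     (Seq coins_loop train_loop)))))))
     s (2 + (2 * N + (3 + (2 * m + ?T)))) (training (N - 1))"
    if "inputs B L \<epsilon> \<delta> s \<and> nmem s 0 = halvings \<delta>" for s
    by (intro halts_straight halts_Seq[OF rounds_loop_halts[where B = B and L = L and \<epsilon> = \<epsilon> and \<delta> = \<delta> and k = k and \<eta> = \<eta>] 3])
      (use that assms(1) in \<open>simp_all add: inputs_def fresh_def k \<eta> N step_size_def\<close>)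
  have "halts Or S W train (initial_state [a, B, L, \<epsilon>, \<delta>])
      (1 + (3 * k + 1 + (2 + (2 * N + (3 + (2 * m + ?T)))))) (training (N - 1))"
    unfolding train_def
    by (intro halts_straight halts_Seq[OF halving_loop_halts[where B = B and L = L and \<epsilon> = \<epsilon> and \<delta> = \<delta>] 2])
      (use assms(2) in \<open>simp_all add: inputs_def fresh_def initial_state_def k\<close>)
  then show ?thesis by (rule halts_mono) auto
qed

section \<open>Bounds on the parameters\<close>

lemma halvings_pos: "0 < \<delta> \<Longrightarrow> \<delta> < 1 \<Longrightarrow> 0 < halvings \<delta>"
  using halvings_least(1)[of \<delta>] by (cases "halvings \<delta>") auto

text \<open>One halving fewer still leaves more than \<open>\<delta>\<close>; take logarithms and
  use \<open>ln 2 \<ge> 1 / 2\<close>. The summand 1 is the loss from rounding up.\<close>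

lemma halvings_le:
  assumes "0 < \<delta>" "\<delta> < 1"
  shows "real (halvings \<delta>) \<le> 1 + 2 * ln (1 / \<delta>)"
proof -
  obtain i where i: "halvings \<delta> = Suc i" using halvings_pos[OF assms] by (auto simp: gr0_conv_Suc)
  have "\<delta> < (1 / 2) ^ i" using halvings_least(2)[OF assms(1), of i] i by simp
  then have "2 ^ i < 1 / \<delta>" using assms by (simp add: field_simps power_divide)
  then have "ln (2 ^ i) < ln (1 / \<delta>)" using assms by (subst ln_less_cancel_iff) auto
  then have "real i * ln 2 < ln (1 / \<delta>)" by (simp add: ln_realpow)
  moreover have "real i * (1 / 2) \<le> real i * ln 2" using ln2_ge_two_thirds by (intro mult_left_mono) auto
  ultimately show ?thesis by (simp add: i)
qed

text \<open>Minimality of the search. The quantity on the left is the number of bags drawn, and its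
  bound has no additive constant, so it vanishes for \<open>B = 0\<close>.\<close>

lemma rounds_le:
  assumes "0 < \<epsilon>"
  shows "real (rounds B L \<epsilon> k) - 1 \<le> 64 * (B * L / \<epsilon>)\<^sup>2 * real k"
proof (cases "rounds B L \<epsilon> k = 1")
  case False
  then obtain i where i: "rounds B L \<epsilon> k = Suc (Suc i)"
    by (metis One_nat_def not0_implies_Suc nat.distinct(1) rounds_def)
  have "real (Suc i) * (\<epsilon> * \<epsilon>) < 64 * (B * B * (L * L) * real k)"
    using rounds_least(2)[OF assms, of i B L k] i by simp
  then have "real (Suc i) < 64 * (B * B * (L * L) * real k) / (\<epsilon> * \<epsilon>)"
    using assms by (simp add: pos_less_divide_eq)
  then show ?thesis by (simp add: i power2_eq_square mult_ac)
qed simp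

lemma coins_per_estimate_le: "real (coins_per_estimate y) \<le> 1 + y * y"
proof (cases "coins_per_estimate y = 1")
  case False
  then obtain i where i: "coins_per_estimate y = Suc (Suc i)"
    by (metis One_nat_def not0_implies_Suc nat.distinct(1) coins_per_estimate_def)
  then show ?thesis using coins_per_estimate_least(2)[of i y] by simp
qed simp

text \<open>The factor \<open>k\<close> in the number of rounds cancels against the one in the step
  size: the norm bound on the iterates is free of \<open>\<delta>\<close>.\<close>

lemma step_rounds_le:
  assumes "0 < \<epsilon>" "0 < L" "0 < k"
  shows "L * (step_size L \<epsilon> k * (real (rounds B L \<epsilon> k) - 1)) \<le> 4 * (B\<^sup>2 * L\<^sup>2 * (1 / \<epsilon>))"
proof -
  have "L * (step_size L \<epsilon> k * (real (rounds B L \<epsilon> k) - 1))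
      = \<epsilon> / (16 * real k) * (real (rounds B L \<epsilon> k) - 1)"
    using assms by (simp add: step_size_def field_simps)
  also have "\<dots> \<le> \<epsilon> / (16 * real k) * (64 * (B * L / \<epsilon>)\<^sup>2 * real k)"
    using assms by (intro mult_left_mono rounds_le) auto
  also have "\<dots> = 4 * (B\<^sup>2 * L\<^sup>2 * (1 / \<epsilon>))"
    using assms by (simp add: power2_eq_square field_simps)
  finally show ?thesis .
qed

text \<open>The coefficients are natural numbers, so \<open>poly q 1\<close> is their sum and every
  monomial may be raised to the top degree.\<close>

lemma poly_le_power:
  fixes q :: "nat poly"
  assumes "real n \<le> Z" "1 \<le> Z"
  shows "real (poly q n) \<le> real (poly q 1) * Z ^ degree q"
proof -
  have "real (poly q n) = (\<Sum>i\<le>degree q. real (coeff q i) * real n ^ i)"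
    by (simp add: poly_altdef)
  also have "\<dots> \<le> (\<Sum>i\<le>degree q. real (coeff q i) * Z ^ degree q)"
  proof (intro sum_mono mult_left_mono)
    fix i assume i: "i \<in> {..degree q}"
    have "real n ^ i \<le> Z ^ i" using assms by (intro power_mono) auto
    also have "\<dots> \<le> Z ^ degree q" using i assms by (intro power_increasing) auto
    finally show "real n ^ i \<le> Z ^ degree q" .
  qed simp
  finally show ?thesis by (simp add: poly_altdef sum_distrib_right)
qed

text \<open>All parameters are replaced by a common bound \<open>V\<close>. The dominant term
  \<open>N * m * N * \<kappa>\<close> accounts for the fourth power, and \<open>12 \<le> V\<close>
  absorbs the additive constants. The second bound is for prediction, per instance of the
  bag.\<close>

lemma time_le:
  fixes V k N m \<kappa> :: real
  assumes "12 \<le> V" "0 \<le> k" "k \<le> V" "0 \<le> N" "N \<le> V" "0 \<le> m" "m \<le> V" "0 \<le> \<kappa>" "\<kappa> \<le> V"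
  shows "3 * k + 2 * N + 2 * m + N * (m * (N * (\<kappa> + 4) + 5) + 11) + 8 \<le> 12 * V ^ 4"
    and "N * (\<kappa> + 12) + 8 \<le> 12 * V ^ 4"
proof -
  have V: "V \<le> V ^ 2" "V ^ 2 \<le> V ^ 3" "V ^ 3 \<le> V ^ 4" "V \<le> V ^ 4"
    using assms(1) power_increasing[of 1 2 V] power_increasing[of 2 3 V] power_increasing[of 3 4 V]
      power_increasing[of 1 4 V] by auto
  have VV: "V * (2 * V) = 2 * V ^ 2" by (simp add: power2_eq_square)
  have 1: "N * (\<kappa> + 12) \<le> 2 * V ^ 2" unfolding VV[symmetric] using assms by (intro mult_mono) auto
  have "N * (\<kappa> + 4) \<le> 2 * V ^ 2" unfolding VV[symmetric] using assms by (intro mult_mono) auto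
  then have "N * (\<kappa> + 4) + 5 \<le> 3 * V ^ 2" using V(1) assms(1) by linarith
  then have "m * (N * (\<kappa> + 4) + 5) \<le> V * (3 * V ^ 2)" using assms by (intro mult_mono) auto
  also have "V * (3 * V ^ 2) = 3 * V ^ 3" by (simp add: power2_eq_square power3_eq_cube)
  finally have "m * (N * (\<kappa> + 4) + 5) + 11 \<le> 4 * V ^ 3" using V assms(1) by linarith
  then have "N * (m * (N * (\<kappa> + 4) + 5) + 11) \<le> V * (4 * V ^ 3)"
    using assms by (intro mult_mono) auto
  then have 2: "N * (m * (N * (\<kappa> + 4) + 5) + 11) \<le> 4 * V ^ 4"
    by (simp add: power3_eq_cube power4_eq_xxxx)
  have "3 * k + 2 * N + 2 * m + 8 \<le> 3 * V + 2 * V + 2 * V + V"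
    using assms by (intro add_mono mult_left_mono) auto
  also have "\<dots> \<le> 8 * V ^ 4" using V by simp
  finally show "3 * k + 2 * N + 2 * m + N * (m * (N * (\<kappa> + 4) + 5) + 11) + 8 \<le> 12 * V ^ 4"
    using 2 by simp
  have "2 * V ^ 2 + 8 \<le> 3 * V ^ 2" using V(1) assms(1) by linarith
  also have "\<dots> \<le> 12 * V ^ 4" using V assms(1) by linarith
  finally show "N * (\<kappa> + 12) + 8 \<le> 12 * V ^ 4" using 1 by simp
qed

text \<open>Counting powers of \<open>Z\<close>: \<open>N\<close> is about
  \<open>(B * L / \<epsilon>)^2 * k\<close>, of degree 7; the coin target is \<open>N\<close> times
  a factor of degree 5; and \<open>m\<close> is about the square of the target, which gives degree
  24 and \<open>645^2 = 416025\<close>.\<close>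

lemma parameters_le:
  assumes "0 \<le> B" "0 < L" "0 < \<epsilon>" "0 < \<delta>" "\<delta> < 1"
    and Z: "1 \<le> Z" "B \<le> Z" "L \<le> Z" "1 / \<epsilon> \<le> Z" "1 + 2 * ln (1 / \<delta>) \<le> 2 * Z"
    and k: "k = halvings \<delta>" and N: "N = rounds B L \<epsilon> k"
    and m: "m = coins_per_estimate (coins_target B L (step_size L \<epsilon> k) N)"
  shows "real k \<le> 2 * Z" "real N \<le> 129 * Z ^ 7" "real m \<le> 416026 * Z ^ 24"
proof -
  have pw: "Z ^ i \<le> Z ^ j" if "i \<le> j" for i j using that Z(1) by (rule power_increasing)
  show k2: "real k \<le> 2 * Z" unfolding k using halvings_le[OF assms(4,5)] Z(5) by linarith
  have k0: "0 < k" unfolding k using assms(4,5) by (rule halvings_pos)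
  have "(B * L / \<epsilon>)\<^sup>2 = B ^ 2 * L ^ 2 * (1 / \<epsilon>) ^ 2" by (simp add: power2_eq_square)
  also have "\<dots> \<le> Z ^ 2 * Z ^ 2 * Z ^ 2" using assms(1-3) Z by (intro mult_mono power_mono) auto
  finally have "(B * L / \<epsilon>)\<^sup>2 * real k \<le> (Z ^ 2 * Z ^ 2 * Z ^ 2) * (2 * Z)"
    using k2 Z(1) by (intro mult_mono) auto
  also have "\<dots> = 2 * Z ^ 7" by (simp add: eval_nat_numeral)
  finally have "real N - 1 \<le> 128 * Z ^ 7"
    using rounds_le[OF assms(3), of B L k] by (simp add: N)
  moreover have "1 \<le> Z ^ 7" using pw[of 0 7] by simp
  ultimately show N2: "real N \<le> 129 * Z ^ 7" by simp
  let ?y = "coins_target B L (step_size L \<epsilon> k) N"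
  have "B\<^sup>2 * L\<^sup>2 * (1 / \<epsilon>) \<le> Z ^ 2 * Z ^ 2 * Z"
    using assms(1-3) Z by (intro mult_mono power_mono) auto
  also have "\<dots> = Z ^ 5" by (simp add: eval_nat_numeral)
  finally have "L * (step_size L \<epsilon> k * (real N - 1)) \<le> 4 * Z ^ 5"
    using step_rounds_le[OF assms(3,2) k0, of B] by (simp add: N)
  moreover have "L * B \<le> Z * Z" using assms(1,2) Z by (intro mult_mono) auto
  then have "L * B \<le> Z ^ 5" using pw[of 2 5] by (simp add: power2_eq_square)
  ultimately have 1: "L * (B + step_size L \<epsilon> k * (real N - 1)) \<le> 5 * Z ^ 5"
    by (simp add: distrib_left)
  have s0: "0 \<le> step_size L \<epsilon> k" using assms by (simp add: step_size_def)
  have N0: "1 \<le> real N" by (simp add: N rounds_def)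
  have 0: "0 \<le> L * (B + step_size L \<epsilon> k * (real N - 1))"
    using assms s0 N0 by (intro mult_nonneg_nonneg add_nonneg_nonneg) auto
  have "?y \<le> (129 * Z ^ 7) * (5 * Z ^ 5)"
    unfolding coins_target_def using Z(1) by (intro mult_mono[OF N2 1 _ 0]) auto
  also have "\<dots> = 645 * Z ^ 12" by (simp add: eval_nat_numeral)
  finally have y: "?y \<le> 645 * Z ^ 12" .
  have y0: "0 \<le> ?y" unfolding coins_target_def by (rule mult_nonneg_nonneg[OF _ 0]) simp
  have "?y * ?y \<le> (645 * Z ^ 12) * (645 * Z ^ 12)" using y y0 Z(1) by (intro mult_mono) auto
  also have "\<dots> = 416025 * Z ^ 24" by (simp add: eval_nat_numeral)
  finally have "real m \<le> 1 + 416025 * Z ^ 24" using coins_per_estimate_le[of ?y] by (simp add: m)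
  moreover have "1 \<le> Z ^ 24" using pw[of 0 24] by simp
  ultimately show "real m \<le> 416026 * Z ^ 24" by simp
qed

section \<open>The learning theorem\<close>

context mil
begin

text \<open>The squared error is convex in the prediction, and predictions are what is
  averaged.\<close>

lemma average_error:
  assumes f: "\<And>i. i < N \<Longrightarrow> f i \<in> borel_measurable M" and N: "0 < N"
    and sum: "(\<Sum>i<N. err (f i)) \<le> real N * \<epsilon>"
  defines "h \<equiv> \<lambda>\<beta>. (\<Sum>i<N. u (bag_mean (f i) \<beta>)) / real N"
  shows "h \<in> borel_measurable D" "(\<integral>\<^sup>+\<beta>. ennreal ((h \<beta> - u (bag_mean c \<beta>))\<^sup>2) \<partial>D) \<le> ennreal \<epsilon>"
proof -
  have [measurable]: "(\<lambda>\<beta>. u (bag_mean (f i) \<beta>)) \<in> borel_measurable (bag_space M)" if "i < N" for i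
    using measurable_compose[OF measurable_bag_mean[OF f[OF that]] u_meas] .
  show h [measurable]: "h \<in> borel_measurable D" unfolding h_def by measurable
  have [measurable]: "p \<in> borel_measurable D" by measurable
  have d: "(u a - p \<beta>)\<^sup>2 \<le> 1" for a \<beta>
  proof -
    have "\<bar>u a - p \<beta>\<bar> \<le> 1" using u_bounds[of a] p_bounds[of \<beta>] by linarith
    from power_le_one[OF abs_ge_zero this, of 2] show ?thesis by simp
  qed
  have i: "integrable D (\<lambda>\<beta>. (u (bag_mean (f i) \<beta>) - p \<beta>)\<^sup>2)" if "i < N" for i
    by (rule D.integrable_const_bound[where B = 1]) (use d that in auto)
  have conv: "(h \<beta> - p \<beta>)\<^sup>2 \<le> (\<Sum>i<N. (u (bag_mean (f i) \<beta>) - p \<beta>)\<^sup>2) / real N" for \<beta>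
  proof -
    have "h \<beta> - p \<beta> = (\<Sum>i<N. u (bag_mean (f i) \<beta>) - p \<beta>) / real N"
      using N by (simp add: h_def sum_subtractf diff_divide_distrib)
    then have "(h \<beta> - p \<beta>)\<^sup>2 = (\<Sum>i<N. u (bag_mean (f i) \<beta>) - p \<beta>)\<^sup>2 / (real N)\<^sup>2"
      by (simp add: power_divide)
    \<comment> \<open>Cauchy-Schwarz against the constant 1.\<close>
    also have "\<dots> \<le> ((\<Sum>i<N. (u (bag_mean (f i) \<beta>) - p \<beta>)\<^sup>2) * real N) / (real N)\<^sup>2"
      using sum_squared_le_sum_of_squares[of "\<lambda>i. u (bag_mean (f i) \<beta>) - p \<beta>" "{..<N}"]
      by (intro divide_right_mono) auto
    finally show ?thesis using N by (simp add: power2_eq_square)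
  qed
  have "(\<integral>\<^sup>+\<beta>. ennreal ((h \<beta> - u (bag_mean c \<beta>))\<^sup>2) \<partial>D)
      \<le> (\<integral>\<^sup>+\<beta>. ennreal ((\<Sum>i<N. (u (bag_mean (f i) \<beta>) - p \<beta>)\<^sup>2) / real N) \<partial>D)"
    using conv by (intro nn_integral_mono ennreal_leI) (simp add: p_def)
  also have "\<dots> = ennreal (\<integral>\<beta>. (\<Sum>i<N. (u (bag_mean (f i) \<beta>) - p \<beta>)\<^sup>2) / real N \<partial>D)"
  proof (rule nn_integral_eq_integral)
    show "integrable D (\<lambda>\<beta>. (\<Sum>i<N. (u (bag_mean (f i) \<beta>) - p \<beta>)\<^sup>2) / real N)"
      by (intro integrable_divide Bochner_Integration.integrable_sum i) simp
  qed (auto intro!: divide_nonneg_nonneg sum_nonneg)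
  also have "(\<integral>\<beta>. (\<Sum>i<N. (u (bag_mean (f i) \<beta>) - p \<beta>)\<^sup>2) / real N \<partial>D) = (\<Sum>i<N. err (f i)) / real N"
    using i by (simp add: err_def Bochner_Integration.integral_sum)
  also have "ennreal \<dots> \<le> ennreal \<epsilon>"
    using sum N by (intro ennreal_leI) (simp add: field_simps)
  finally show "(\<integral>\<^sup>+\<beta>. ennreal ((h \<beta> - u (bag_mean c \<beta>))\<^sup>2) \<partial>D) \<le> ennreal \<epsilon>" .
qed

text \<open>The budget in units of \<open>k\<close>: the initial distance costs at most
  \<open>k\<close> by the choice of \<open>N\<close>, the approximation error at most
  \<open>k\<close> because \<open>e \<le> \<epsilon> / (16 * L)\<close>, the squared step 1/4 and
  the estimation of bag means 1/2. Against this stands the gain \<open>4 * k\<close>, and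
  \<open>k \<ge> 1\<close> covers the remaining 3/4.\<close>

lemma failure_exponent_le:
  assumes B: "0 \<le> B" and \<epsilon>: "0 < \<epsilon>" and k: "0 < k" and e: "0 \<le> e" "e \<le> \<epsilon> / (16 * L)"
    and \<eta>: "\<eta> = step_size L \<epsilon> k" and N: "N = rounds B L \<epsilon> k"
    and m: "m = coins_per_estimate (coins_target B L \<eta> N)"
  defines "\<rho> \<equiv> \<eta> * (real N - 1)"
  defines "b \<equiv> 4 * \<eta> * e + \<eta>\<^sup>2 + 2 * \<eta> * ((B + \<rho>) * L * \<rho> / sqrt (real m))"
  shows "B\<^sup>2 / (4 * real N * \<eta>\<^sup>2) + b / (4 * \<eta>\<^sup>2) - \<epsilon> / (4 * \<eta> * L) \<le> - real k"
proof -
  have \<eta>0: "0 < \<eta>" unfolding \<eta> step_size_def using \<epsilon> k L_pos by simp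
  have N1: "1 \<le> real N" by (simp add: N rounds_def)
  have m1: "0 < real m" by (simp add: m coins_per_estimate_def)
  have k1: "1 \<le> real k" using k by simp
  have \<rho>0: "0 \<le> \<rho>" unfolding \<rho>_def using \<eta>0 N1 by simp
  have \<eta>k: "16 * \<eta> * L * real k = \<epsilon>" unfolding \<eta> step_size_def using L_pos k by simp
  have "B\<^sup>2 / (4 * real N * \<eta>\<^sup>2) = (64 * (B * B * (L * L) * real k)) * real k / (real N * (\<epsilon> * \<epsilon>))"
    unfolding \<eta>k[symmetric] using \<eta>0 L_pos N1 k1 by (simp add: field_simps power2_eq_square)
  also have "\<dots> \<le> (real N * (\<epsilon> * \<epsilon>)) * real k / (real N * (\<epsilon> * \<epsilon>))"
    using rounds_least(1)[OF \<epsilon>, of B L k] \<epsilon> by (intro divide_right_mono mult_right_mono) (auto simp: N)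
  also have "\<dots> = real k" using N1 \<epsilon> by simp
  finally have 1: "B\<^sup>2 / (4 * real N * \<eta>\<^sup>2) \<le> real k" .
  have 2: "\<epsilon> / (4 * \<eta> * L) = 4 * real k"
    unfolding \<eta>k[symmetric] using \<eta>0 L_pos by simp
  have "e / \<eta> \<le> \<epsilon> / (16 * L) / \<eta>" using e \<eta>0 by (intro divide_right_mono) auto
  also have "\<dots> = real k" unfolding \<eta>k[symmetric] using \<eta>0 L_pos by simp
  finally have 3: "e / \<eta> \<le> real k" .
  let ?y = "coins_target B L \<eta> N"
  have y0: "0 \<le> ?y" unfolding coins_target_def \<rho>_def[symmetric] using L_pos B \<rho>0 by simp
  have "?y = sqrt (?y * ?y)" using y0 by simp
  also have "\<dots> \<le> sqrt (real m)"
    using coins_per_estimate_least(1)[of ?y] by (intro real_sqrt_le_mono) (simp add: m)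
  finally have "?y \<le> sqrt (real m)" .
  moreover have "(B + \<rho>) * L * (real N - 1) \<le> ?y"
  proof -
    have "(B + \<rho>) * L * (real N - 1) \<le> (B + \<rho>) * L * real N"
      using B \<rho>0 L_pos by (intro mult_left_mono) auto
    then show ?thesis by (simp add: coins_target_def \<rho>_def mult_ac)
  qed
  ultimately have 4: "(B + \<rho>) * L * (real N - 1) / sqrt (real m) \<le> 1" using m1 by simp
  have "2 * \<eta> * (x * (\<eta> * n) / s) / (4 * \<eta>\<^sup>2) = (x * n / s) / 2" for x n s
    using \<eta>0 by (simp add: power2_eq_square mult.commute)
  from this[of "(B + \<rho>) * L" "real N - 1"]
  have "2 * \<eta> * ((B + \<rho>) * L * \<rho> / sqrt (real m)) / (4 * \<eta>\<^sup>2) =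
      ((B + \<rho>) * L * (real N - 1) / sqrt (real m)) / 2"
    by (simp only: \<rho>_def)
  also have "\<dots> \<le> 1 / 2" by (rule divide_right_mono[OF 4]) simp
  finally have "b / (4 * \<eta>\<^sup>2) \<le> e / \<eta> + 1 / 4 + 1 / 2"
    unfolding b_def using \<eta>0 by (simp add: add_divide_distrib power2_eq_square)
  then have "b / (4 * \<eta>\<^sup>2) \<le> real k + 3 / 4" using 3 by linarith
  then show ?thesis using 1 2 k1 by linarith
qed

text \<open>The analysis of the program applies to each pair of streams separately; it meets the
  probabilistic analysis in the iterates, which both describe by \<open>iterate\<close>. The good
  event is that of \<open>regret_tail\<close>.\<close>

lemma learning:
  assumes B: "ip_norm ip v \<le> B" and \<epsilon>: "0 < \<epsilon>" and \<delta>: "0 < \<delta>" "\<delta> < 1"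
    and e: "0 \<le> e" "e \<le> \<epsilon> / (16 * L)"
    and k: "k = halvings \<delta>" and \<eta>: "\<eta> = step_size L \<epsilon> k" and N: "N = rounds B L \<epsilon> k"
    and m: "m = coins_per_estimate (coins_target B L \<eta> N)"
    and M': "real N - 1 \<le> M'"
    and T: "real (3 * k + 2 * N + 2 * m + N * (m * (N * (\<kappa> + 4) + 5) + 11) + 8) \<le> T"
      "real (N * (\<kappa> + 12) + 8) \<le> T"
  defines "Or \<equiv> \<lparr>kernel = K, kernel_time = \<kappa>, link = u\<rparr>"
  shows "\<exists>E\<in>sets (run_space u c D). measure (run_space u c D) E \<ge> 1 - \<delta> \<and>
    (\<forall>(S, W)\<in>space (run_space u c D). \<exists>t s h.
      exec Or S W train (initial_state [a, B, L, \<epsilon>, \<delta>]) t s \<and> real t \<le> T \<and>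
      real (length (seen s)) \<le> M' \<and> represents_hypothesis Or S W M predict s T h \<and>
      ((S, W) \<in> E \<longrightarrow> h \<in> borel_measurable D \<and>
        (\<integral>\<^sup>+\<beta>. ennreal ((h \<beta> - u (bag_mean c \<beta>))\<^sup>2) \<partial>D) \<le> ennreal \<epsilon>))"
proof -
  have k0: "0 < k" unfolding k by (rule halvings_pos[OF \<delta>])
  have \<eta>0: "0 < \<eta>" unfolding \<eta> step_size_def using \<epsilon> k0 L_pos by simp
  have N0: "0 < N" by (simp add: N rounds_def)
  have m0: "0 < m" by (simp add: m coins_per_estimate_def)
  have B0: "0 \<le> B" using B ip_norm_nonneg[OF v_mem] by linarith
  define E where "E = {a \<in> space (QS \<Otimes>\<^sub>M CS).
    (\<Sum>i<N. err (iterate (space M) K u m \<eta> (\<lambda>_. 0) (fst a) (snd a) i)) \<le> real N * \<epsilon>}"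
  note tail = regret_tail[OF B \<eta>0 m0 N0 e(1), of \<epsilon>, folded E_def]
  have "exp (B\<^sup>2 / (4 * real N * \<eta>\<^sup>2) + (4 * \<eta> * e + \<eta>\<^sup>2 + 2 * \<eta> *
      ((B + \<eta> * (real N - 1)) * L * (\<eta> * (real N - 1)) / sqrt (real m))) / (4 * \<eta>\<^sup>2) - \<epsilon> / (4 * \<eta> * L))
      \<le> exp (- real k)"
    using failure_exponent_le[OF B0 \<epsilon> k0 e \<eta> N m] by simp
  also have "\<dots> = exp (- 1) ^ k" by (simp add: exp_of_nat_mult[symmetric])
  \<comment> \<open>The tail bound decays in base \<open>exp 1\<close>, the program counts halvings;
    \<open>2 \<le> exp 1\<close> connects the two.\<close>
  also have "\<dots> \<le> (1 / 2) ^ k"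
  proof (rule power_mono)
    show "exp (- 1) \<le> (1 / 2 :: real)" using exp_ge_add_one_self[of 1] by (simp add: exp_minus field_simps)
  qed simp
  also have "\<dots> \<le> \<delta>" unfolding k by (rule halvings_least(1)[OF \<delta>(1)])
  finally have prob: "1 - \<delta> \<le> measure (QS \<Otimes>\<^sub>M CS) E" using tail(2) by linarith
  show ?thesis
    unfolding run_space_eq
  proof (intro bexI[OF _ tail(1)] conjI prob ballI, clarify)
    fix S :: "nat \<Rightarrow> 'x list \<times> bool" and W assume SW: "(S, W) \<in> space (QS \<Otimes>\<^sub>M CS)"
    have "fst (S i) \<in> space (bag_space M)" for i
    proof -
      have "S i \<in> space Q" using SW by (auto simp: space_pair_measure space_PiM PiE_iff)
      then show ?thesis by (auto simp: space_Q)
    qed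
    then have bags: "fst (S i) \<noteq> []" "set (fst (S i)) \<subseteq> space M" for i
      by (auto simp: space_bag_space)
    interpret rc: run_context "space M" K u \<kappa> S W m \<eta> N
      by unfold_locales (use bags m0 N0 in auto)
    obtain t s where ts: "exec Or S W train (initial_state [a, B, L, \<epsilon>, \<delta>]) t s"
      "t \<le> 3 * k + 2 * N + 2 * m + N * (m * (N * (\<kappa> + 4) + 5) + 11) + 8" "rc.training (N - 1) s"
      using train_halts[where S = S and K = K and \<kappa> = \<kappa> and u = u and W = W and a = a, OF \<epsilon> \<delta>(1) k \<eta> N refl m bags] unfolding halts_def Or_def by blast
    have "real t \<le> T" using ts(2) T(1) by linarith
    moreover have "real (length (seen s)) \<le> M'" using ts(3) M' N0 by (simp add: rc.training_def of_nat_diff)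
    moreover have "represents_hypothesis Or S W M predict s T rc.average_hyp"
      unfolding represents_hypothesis_def
    proof
      fix \<beta> assume "\<beta> \<in> space (bag_space M)"
      then have \<beta>: "set \<beta> \<subseteq> space M" "\<beta> \<noteq> []" by (auto simp: space_bag_space)
      obtain t' s' where t': "exec Or S W predict (s\<lparr>seen := seen s @ [(\<beta>, False)]\<rparr>) t' s'"
        "t' \<le> N * (length \<beta> * (\<kappa> + 4) + 8) + 8" "rmem s' 0 = rc.average_hyp \<beta>"
        using rc.predict_halts[OF ts(3) \<beta>] unfolding halts_def Or_def by blast
      have l: "1 \<le> length \<beta>" using \<beta>(2) by (simp add: Suc_le_eq)
      have "t' \<le> (N * (\<kappa> + 12) + 8) * length \<beta>"
      proof -
        \<comment> \<open>The budget is proportional to the size of the bag. A bag is nonempty, so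
          fixed costs may be charged to every instance.\<close>
        have "N * (length \<beta> * (\<kappa> + 4) + 8) + 8 \<le> N * (length \<beta> * (\<kappa> + 4) + 8 * length \<beta>) + 8 * length \<beta>"
          using l by (intro add_le_mono mult_le_mono) auto
        also have "\<dots> = (N * (\<kappa> + 12) + 8) * length \<beta>" by (simp add: algebra_simps)
        finally show ?thesis using t'(2) by linarith
      qed
      then have "real t' \<le> real (N * (\<kappa> + 12) + 8) * real (length \<beta>)"
        by (metis of_nat_le_iff of_nat_mult)
      also have "\<dots> \<le> T * real (length \<beta>)" by (intro mult_right_mono T) simp
      finally show "\<exists>t s'. exec Or S W predict (s\<lparr>seen := seen s @ [(\<beta>, False)]\<rparr>) t s' \<and>
        rmem s' 0 = rc.average_hyp \<beta> \<and> real t \<le> T * real (length \<beta>)" using t' by blast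
    qed
    moreover have "rc.average_hyp \<in> borel_measurable D \<and>
        (\<integral>\<^sup>+\<beta>. ennreal ((rc.average_hyp \<beta> - u (bag_mean c \<beta>))\<^sup>2) \<partial>D) \<le> ennreal \<epsilon>" if "(S, W) \<in> E"
    proof -
      have "(\<Sum>i<N. err (rc.hyp i)) \<le> real N * \<epsilon>" using that by (simp add: E_def)
      moreover have "rc.hyp i \<in> borel_measurable M" for i
        using measurable_compose[OF measurable_Pair1'[OF SW] iterate_meas[of "\<lambda>_. 0" m \<eta> i]] by simp
      ultimately show ?thesis
        using average_error[of N rc.hyp \<epsilon>] N0 unfolding rc.average_hyp_def[abs_def] by blast
    qed
    ultimately show "\<exists>t s h. exec Or S W train (initial_state [a, B, L, \<epsilon>, \<delta>]) t s \<and> real t \<le> T \<and>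
      real (length (seen s)) \<le> M' \<and> represents_hypothesis Or S W M predict s T h \<and>
      ((S, W) \<in> E \<longrightarrow> h \<in> borel_measurable D \<and>
        (\<integral>\<^sup>+\<beta>. ennreal ((h \<beta> - u (bag_mean c \<beta>))\<^sup>2) \<partial>D) \<le> ennreal \<epsilon>)"
      using ts(1) by blast
  qed
qed

end

text \<open>Provides the explicit constants behind the existential ones of \<open>theorem9\<close>:
  those for time depend on \<open>q\<close> alone, the one for the number of bags on
  \<open>\<delta>0\<close> alone.\<close>

lemma train_predict_learns:
  fixes q :: "nat poly" and X :: "(nat \<Rightarrow> real) set" and \<delta>0 :: real
  assumes \<delta>0: "0 < \<delta>0 \<and> \<delta>0 < 1" and X: "X \<subseteq> space (\<Pi>\<^sub>M i\<in>{..<n}. borel)"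
    and \<C>: "\<C> \<subseteq> borel_measurable (instance_space n X)"
    and u: "mono u" "range u \<subseteq> {0..1}" "0 < L" "L-lipschitz_on UNIV u"
    and rkhs: "rkhs X K H ip" and K1: "\<forall>x\<in>X. \<forall>y\<in>X. K x y \<le> 1"
    and K: "(\<lambda>(x, y). K x y) \<in> borel_measurable (instance_space n X \<Otimes>\<^sub>M instance_space n X)"
    and \<kappa>: "\<kappa> \<le> poly q n" and \<epsilon>: "0 < \<epsilon>" and \<delta>: "0 < \<delta>" "\<delta> \<le> \<delta>0" and B: "0 \<le> B" and C: "16 \<le> C"
    and approx: "\<forall>c\<in>\<C>. uniformly_approximated X K H ip (\<epsilon> / (C * L)) B c"
  shows "probabilistic_MIL (train, predict) [real n, B, L, \<epsilon>, \<delta>] K \<kappa> (instance_space n X) \<C> u \<epsilon> \<delta>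
    (64 * (2 + 1 / ln (1 / \<delta>0)) * (B * L / \<epsilon>)\<^sup>2 * ln (1 / \<delta>))
    (12 * (416038 + real (poly q 1)) ^ 4 *
      (1 + real n + B + L + 1 / \<epsilon> + ln (1 / \<delta>)) ^ ((24 + degree q) * 4))"
proof -
  define c1 where "c1 = 2 + 1 / ln (1 / \<delta>0)"
  \<comment> \<open>The sum of 416026, the coefficient in the bound for \<open>m\<close>, of 12 and
    of the coefficient in the bound for \<open>\<kappa>\<close>. Then \<open>G * Z ^ d\<close>
    dominates \<open>k\<close>, \<open>N\<close>, \<open>m\<close>, \<open>\<kappa>\<close> and 12
    at once.\<close>
  define G :: real where "G = 416038 + real (poly q 1)"
  define d where "d = 24 + degree q"
  define Z where "Z = 1 + real n + B + L + 1 / \<epsilon> + ln (1 / \<delta>)"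
  define k where "k = halvings \<delta>"
  define \<eta> where "\<eta> = step_size L \<epsilon> k"
  define N where "N = rounds B L \<epsilon> k"
  define m where "m = coins_per_estimate (coins_target B L \<eta> N)"
  define V where "V = G * Z ^ d"
  let ?M = "instance_space n X"
  have sp: "space ?M = X" using X by (auto simp: instance_space_def space_restrict_space)
  have \<delta>1: "\<delta> < 1" using \<delta> \<delta>0 by linarith
  have ln0: "0 < ln (1 / \<delta>0)" using \<delta>0 by simp
  have ln1: "ln (1 / \<delta>0) \<le> ln (1 / \<delta>)" using \<delta> \<delta>0 by (simp add: ln_div)
  have eps0: "0 < 1 / \<epsilon>" using \<epsilon> by simp
  have Z: "1 \<le> Z" "B \<le> Z" "L \<le> Z" "1 / \<epsilon> \<le> Z" "1 + 2 * ln (1 / \<delta>) \<le> 2 * Z" "real n \<le> Z"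
    using B u(3) eps0 ln0 ln1 unfolding Z_def by (simp_all add: distrib_left)
  note par = parameters_le[OF B u(3) \<epsilon> \<delta>(1) \<delta>1 Z(1-5) k_def N_def m_def[unfolded \<eta>_def]]
  have pw: "Z ^ i \<le> Z ^ d" if "i \<le> d" for i using that Z(1) by (rule power_increasing)
  have V: "a * Z ^ i \<le> V" if "i \<le> d" "a \<le> G" "0 \<le> a" for a i
    unfolding V_def using that pw[of i] Z(1) by (intro mult_mono) auto
  have kV: "real k \<le> V" using par(1) V[of 1 2] by (simp add: d_def G_def)
  have NV: "real N \<le> V" using par(2) V[of 7 129] by (simp add: d_def G_def)
  have mV: "real m \<le> V" using par(3) V[of 24 416026] by (simp add: d_def G_def)
  have \<kappa>V: "real \<kappa> \<le> V"
  proof -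
    have "real \<kappa> \<le> real (poly q n)" using \<kappa> by simp
    also have "\<dots> \<le> real (poly q 1) * Z ^ degree q" by (rule poly_le_power[OF Z(6,1)])
    also have "\<dots> \<le> V" by (rule V) (simp_all add: d_def G_def)
    finally show ?thesis .
  qed
  have V12: "12 \<le> V" using V[of 0 12] by (simp add: G_def)
  note time = time_le[OF V12 of_nat_0_le_iff kV of_nat_0_le_iff NV of_nat_0_le_iff mV
    of_nat_0_le_iff \<kappa>V]
  have V4: "12 * V ^ 4 = 12 * G ^ 4 * Z ^ (d * 4)"
    by (simp add: V_def power_mult_distrib power_mult)
  have samples: "real N - 1 \<le> 64 * c1 * (B * L / \<epsilon>)\<^sup>2 * ln (1 / \<delta>)"
  proof -
    \<comment> \<open>The rounding loss 1 in the bound for \<open>k\<close> is absorbed into a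
      multiple of \<open>ln (1 / \<delta>)\<close>, which stays away from 0 because
      \<open>\<delta> \<le> \<delta>0 < 1\<close>.\<close>
    have "1 \<le> 1 / ln (1 / \<delta>0) * ln (1 / \<delta>)" using ln0 ln1 by simp
    then have "real k \<le> c1 * ln (1 / \<delta>)"
      using halvings_le[OF \<delta>(1) \<delta>1] by (simp add: c1_def k_def distrib_right)
    then have "64 * (B * L / \<epsilon>)\<^sup>2 * real k \<le> 64 * (B * L / \<epsilon>)\<^sup>2 * (c1 * ln (1 / \<delta>))"
      by (intro mult_left_mono) auto
    then show ?thesis using rounds_le[OF \<epsilon>, of B L k] by (simp add: N_def mult_ac)
  qed
  show ?thesis
    unfolding G_def[symmetric] d_def[symmetric] c1_def[symmetric] probabilistic_MIL_def Z_def[symmetric] V4[symmetric] fst_conv snd_conv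
  proof (intro conjI ballI allI impI sampling_free_predict, elim conjE)
    fix c and D :: "(nat \<Rightarrow> real) list measure"
    assume c: "c \<in> \<C>" and D: "prob_space D" "sets D = sets (bag_space ?M)"
    obtain v where v: "v \<in> H" "ip_norm ip v \<le> B"
      and cv: "\<forall>x\<in>X. \<bar>c x - ip v (feature X K x)\<bar> \<le> \<epsilon> / (C * L)"
      using approx c unfolding uniformly_approximated_def by blast
    have "ip v (feature X K x) = v x" if "x \<in> X" for x
      using rkhs v(1) that unfolding rkhs_def by blast
    then have cv': "\<bar>c x - v x\<bar> \<le> \<epsilon> / (C * L)" if "x \<in> X" for x using cv that by auto
    interpret mil ?M K H ip u L c D v "\<epsilon> / (C * L)"
    proof (intro mil.intro rkhs_space.intro mil_axioms.intro)
      show "rkhs (space ?M) K H ip" using rkhs by (simp add: sp)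
      show "K x y \<le> 1" if "x \<in> space ?M" "y \<in> space ?M" for x y using K1 that by (simp add: sp)
      show "c \<in> borel_measurable ?M" using \<C> c by blast
      show "\<bar>c x - v x\<bar> \<le> \<epsilon> / (C * L)" if "x \<in> space ?M" for x using cv' that by (simp add: sp)
      show "prob_space D" by (rule D(1))
    qed (fact K u D(2) v(1))+
    have "\<epsilon> / (C * L) \<le> \<epsilon> / (16 * L)" using C u(3) \<epsilon> by (intro divide_left_mono mult_right_mono) auto
    moreover have "0 \<le> \<epsilon> / (C * L)" using C u(3) \<epsilon> by simp
    ultimately show "\<exists>E\<in>sets (run_space u c D). 1 - \<delta> \<le> measure (run_space u c D) E \<and>
      (\<forall>(S, W)\<in>space (run_space u c D). \<exists>t s h.
        exec \<lparr>kernel = K, kernel_time = \<kappa>, link = u\<rparr> S W train (initial_state [real n, B, L, \<epsilon>, \<delta>]) t s \<and>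
        real t \<le> 12 * V ^ 4 \<and>
        real (length (seen s)) \<le> 64 * c1 * (B * L / \<epsilon>)\<^sup>2 * ln (1 / \<delta>) \<and>
        represents_hypothesis \<lparr>kernel = K, kernel_time = \<kappa>, link = u\<rparr> S W ?M predict s (12 * V ^ 4) h \<and>
        ((S, W) \<in> E \<longrightarrow> h \<in> borel_measurable D \<and>
          (\<integral>\<^sup>+\<beta>. ennreal ((h \<beta> - u (bag_mean c \<beta>))\<^sup>2) \<partial>D) \<le> ennreal \<epsilon>))"
      using time by (intro learning[OF v(2) \<epsilon> \<delta>(1) \<delta>1 _ _ k_def \<eta>_def N_def m_def samples]) simp_all
  qed
qed

theorem theorem9:
  shows "\<exists>C0>0. \<forall>\<delta>0. 0 < \<delta>0 \<and> \<delta>0 < 1 \<longrightarrow>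
    (\<exists>(alg :: learner) (c0 :: real). \<forall>q :: nat poly. \<exists>(A :: real) (d :: nat).
      \<forall>(n :: nat) (X :: (nat \<Rightarrow> real) set) (\<C> :: ((nat \<Rightarrow> real) \<Rightarrow> real) set)
        (u :: real \<Rightarrow> real) (L :: real)
        (K :: (nat \<Rightarrow> real) \<Rightarrow> (nat \<Rightarrow> real) \<Rightarrow> real) (\<kappa> :: nat)
        (H :: ((nat \<Rightarrow> real) \<Rightarrow> real) set)
        (ip :: ((nat \<Rightarrow> real) \<Rightarrow> real) \<Rightarrow> ((nat \<Rightarrow> real) \<Rightarrow> real) \<Rightarrow> real)
        (B :: real) (C :: real) (\<epsilon> :: real) (\<delta> :: real).
        X \<subseteq> space (\<Pi>\<^sub>M i\<in>{..<n}. borel) \<and>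
        \<C> \<subseteq> borel_measurable (instance_space n X) \<and>
        mono u \<and> range u \<subseteq> {0..1} \<and> 0 < L \<and> L-lipschitz_on UNIV u \<and>
        rkhs X K H ip \<and>
        (\<forall>x\<in>X. \<forall>y\<in>X. K x y \<le> 1) \<and>
        (\<lambda>(x, y). K x y) \<in> borel_measurable (instance_space n X \<Otimes>\<^sub>M instance_space n X) \<and>
        \<kappa> \<le> poly q n \<and>
        0 < \<epsilon> \<and> 0 < \<delta> \<and> \<delta> \<le> \<delta>0 \<and> 0 \<le> B \<and> C0 \<le> C \<and>
        (\<forall>c\<in>\<C>. uniformly_approximated X K H ip (\<epsilon> / (C * L)) B c)
        \<longrightarrow>
        probabilistic_MIL alg [real n, B, L, \<epsilon>, \<delta>] K \<kappa> (instance_space n X) \<C> u \<epsilon> \<delta>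
          (c0 * (B * L / \<epsilon>)\<^sup>2 * ln (1 / \<delta>))
          (A * (1 + real n + B + L + 1 / \<epsilon> + ln (1 / \<delta>)) ^ d))"
  \<comment> \<open>The value 16 is the tolerance for the approximation error in
    \<open>failure_exponent_le\<close>.\<close>
  by (rule exI[of _ 16], rule conjI, simp, intro allI impI exI, elim conjE)
    (rule train_predict_learns; (assumption | intro conjI))

end
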